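(* Let $\mathbf{A}\in\mathbb{R}_+^{m\times n}$, $n\ge4$, be non-degenerate. Given an error parameter $\epsilon>0$ and $\mathbf{x}_0=\mathbf{0}$, consider the following algorithm $\mathcal{A}$ (SI-NNLS+ with restarts): initialize $k=1$; run (Lazy) SI-NNLS+ initialized at $\mathbf{x}_{k-1}$ until its output point $\widetilde{\mathbf{x}}^k$ satisfies $r(\widetilde{\mathbf{x}}^k)\le\frac12 r(\mathbf{x}_{k-1})$; set $\mathbf{x}_k=\widetilde{\mathbf{x}}^k$, restart SI-NNLS+ initialized at $\mathbf{x}_k$, and increment $k$; repeat until $r(\widetilde{\mathbf{x}}^k)\le\epsilon$. Then the total expected number of arithmetic operations of $\mathcal{A}$ is at most $$O\Big(\mathrm{nnz}(\mathbf{A})\Big(\log n+\frac{\sqrt n}{\mu}\Big)\log\Big(\frac{r(\mathbf{x}_0)}{\epsilon}\Big)\Big).$$ As a consequence, given $\bar\epsilon>0$, the total expected number of arithmetic operations until a point $\mathbf{x}$ with $f(\mathbf{x})-f(\mathbf{x}^\star)\le\bar\epsilon|f(\mathbf{x}^\star)|$ can be constructed by $\mathcal{A}$ is bounded by $$O\Big(\mathrm{nnz}(\mathbf{A})\Big(\log n+\frac{\sqrt n}{\mu}\Big)\log\Big(\frac{n}{\mu\bar\epsilon}\Big)\Big),$$ where $\mathbf{x}^\star\in\arg\min_{\mathbf{x}\ge\mathbf{0}}f(\mathbf{x})$.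
   Context: $\mathbf{A}\in\mathbb{R}_+^{m\times n}$ has nonnegative entries and is non-degenerate: no row or column is identically zero. $\mathbf{A}_{:j}$ is the $j$-th column, $\mathrm{nnz}(\cdot)$ the number of nonzero entries, $\mathbf{1}$ the all-ones vector, $\mathbf{e}_j$ the $j$-th standard basis vector, $\log$ the natural logarithm. $f(\mathbf{x})=\frac12\|\mathbf{A}\mathbf{x}\|_2^2-\mathbf{1}^\top\mathbf{x}$; $\mathcal{X}=\{\mathbf{x}\in\mathbb{R}^n:0\le x_j\le 1/\|\mathbf{A}_{:j}\|_2^2\ \forall j\}$; $\mathbf{\Lambda}=\mathrm{diag}(\|\mathbf{A}_{:1}\|_2^2,\dots,\|\mathbf{A}_{:n}\|_2^2)$; $\|\mathbf{x}\|_{\mathbf{\Lambda}}^2=\sum_i\|\mathbf{A}_{:i}\|_2^2x_i^2$. Natural residual: $\mathbf{R}(\mathbf{x})=\mathbf{x}-(\mathbf{x}-\mathbf{\Lambda}^{-1}\nabla f(\mathbf{x}))_+$, where $(\cdot)_+$ is the projection onto $\mathbb{R}^n_+$, and $r(\mathbf{x})=\|\mathbf{R}(\mathbf{x})\|_{\mathbf{\Lambda}}$. Error-bound constant: $\mu>0$ is a constant such that $r(\mathbf{x})\ge\mu\|\mathbf{x}-\mathbf{x}^\star\|_{\mathbf{\Lambda}}$ for every $\mathbf{x}\in\mathbb{R}^n$, where $\mathbf{x}^\star$ is the minimizer of $f$ over $\mathbb{R}^n_+$ closest to $\mathbf{x}$ in $\|\cdot\|_{\mathbf{\Lambda}}$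 (such $\mu$ exists by a known theorem on linear complementarity problems, as $\mathbf{A}$ is nonnegative and non-degenerate). SI-NNLS+ initialized at a point $\mathbf{x}_0\in\mathcal{X}$ (in $\mathcal{A}$, this role is played by $\mathbf{x}_{k-1}$). Put $\phi_0(\mathbf{x})=\frac12\|\mathbf{x}-\mathbf{x}_0\|_{\mathbf{\Lambda}}^2$. Step sizes: $A_0=0$, $a_1=\frac{1}{\sqrt2 n^{1.5}}$, $a_2=\frac{a_1}{n-1}$, $A_i=A_{i-1}+a_i$ for $i\ge1$, and $a_i=\min\{\frac{n a_{i-1}}{n-1},\frac{\sqrt{A_{i-1}}}{2n}\}$ for $i\ge3$. Set $\overline{\mathbf{y}}_0=\mathbf{y}_0=\mathbf{A}\mathbf{x}_0$. For $l=1,2,\dots$: sample $j_l$ uniformly from $\{1,\dots,n\}$, independently of the history; set $\mathbf{x}_l=\arg\min_{\mathbf{x}\in\mathcal{X}}\{a_1\langle\mathbf{A}^\top\overline{\mathbf{y}}_0-\mathbf{1},\mathbf{x}\rangle+\sum_{i=2}^l n a_i\langle\mathbf{A}^\top\overline{\mathbf{y}}_{i-1}-\mathbf{1},x_{j_i}\mathbf{e}_{j_i}\rangle+\phi_0(\mathbf{x})\}$; $\mathbf{y}_l=\arg\max_{\mathbf{y}\in\mathbb{R}^m}\{a_1\langle\mathbf{A}^\top\mathbf{y}-\mathbf{1},\mathbf{x}_1\rangle+\sum_{i=2}^l a_i\langle\mathbf{A}^\top\mathbf{y}-\mathbf{1},n\mathbf{x}_i-(n-1)\mathbf{x}_{i-1}\rangle-\frac{A_l}{2}\|\mathbf{y}\|_2^2\}$;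 $\overline{\mathbf{y}}_l=\mathbf{y}_l+\frac{a_l}{a_{l+1}}(\mathbf{y}_l-\mathbf{y}_{l-1})$. The output after $l$ iterations is $\widetilde{\mathbf{x}}_l$, where $\widetilde{\mathbf{x}}_1=\mathbf{x}_1$ and $\widetilde{\mathbf{x}}_l=\frac1{A_l}\big[A_{l-1}\widetilde{\mathbf{x}}_{l-1}+a_l(n\mathbf{x}_l-(n-1)\mathbf{x}_{l-1})\big]$ for $l\ge2$. Lazy SI-NNLS+ generates the same iterates but keeps $\widetilde{\mathbf{x}}_l,\mathbf{y}_l,\overline{\mathbf{y}}_l$ implicitly through $\mathbf{x}_l$, $\mathbf{A}\mathbf{x}_l$, $\mathbf{r}_l$, $\mathbf{s}_l$ and $\mathbf{A}(\mathbf{x}_l-\mathbf{x}_{l-1})$, where $\mathbf{r}_1=\mathbf{0}$, $\mathbf{s}_1=\mathbf{0}$ and for $l\ge2$, $\mathbf{r}_l=\mathbf{r}_{l-1}+((n-1)a_l-A_{l-1})(\mathbf{x}_l-\mathbf{x}_{l-1})$, $\mathbf{s}_l=\mathbf{s}_{l-1}+((n-1)a_l-A_{l-1})\mathbf{A}(\mathbf{x}_l-\mathbf{x}_{l-1})$, so that $\widetilde{\mathbf{x}}_l=\mathbf{x}_l+\mathbf{r}_l/A_l$ and $\mathbf{y}_l=\mathbf{A}\mathbf{x}_l+\mathbf{s}_l/A_l$; an iteration $l\ge2$ costs $O(\mathrm{nnz}(\mathbf{A}_{:j_l}))$ operations, i.e. $O(\mathrm{nnz}(\mathbf{A})/n)$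 in expectation. The operation count of $\mathcal{A}$ is the total cost of the iterations of the lazy runs.
   Formalization: In the first bound log(r(x_0)/ε) is replaced by max{1, log(r(x_0)/ε)}: at least one run is always executed, so the literal bound fails for ε near or above r(x_0); for ε ≤ r(x_0)/2 the two agree up to a constant factor. *)

theory Defs
  imports "HOL-Probability.Probability" "Jordan_Normal_Form.Matrix"
begin

unbundle no vec_syntax
unbundle no inner_syntax

text \<open>Vectors and matrices are those of Jordan_Normal_Form, whose dimensions are natural numbers, so that
  the constants in the O-bounds can be chosen independently of the dimensions. Columns and rows
  are numbered from 0; iterations \<open>l\<close> and runs \<open>k\<close> are numbered from 1.\<close>

definition nonneg_nondegenerate :: "real mat \<Rightarrow> bool" where
  "nonneg_nondegenerate A \<longleftrightarrow>
     (\<forall>i<dim_row A. \<forall>j<dim_col A. A $$ (i, j) \<ge> 0) \<and>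
     (\<forall>i<dim_row A. row A i \<noteq> 0\<^sub>v (dim_col A)) \<and>
     (\<forall>j<dim_col A. col A j \<noteq> 0\<^sub>v (dim_row A))"

definition nnz :: "real mat \<Rightarrow> nat" where
  "nnz A = card {(i, j). i < dim_row A \<and> j < dim_col A \<and> A $$ (i, j) \<noteq> 0}"

definition nnz_vec :: "real vec \<Rightarrow> nat" where
  "nnz_vec v = card {i. i < dim_vec v \<and> v $ i \<noteq> 0}"

definition ones_vec :: "nat \<Rightarrow> real vec" where
  "ones_vec n = Matrix.vec n (\<lambda>_. 1)"

definition nnls_obj :: "real mat \<Rightarrow> real vec \<Rightarrow> real" where
  "nnls_obj A x = 1 / 2 * ((A *\<^sub>v x) \<bullet> (A *\<^sub>v x)) - ones_vec (dim_col A) \<bullet> x"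

definition nnls_grad :: "real mat \<Rightarrow> real vec \<Rightarrow> real vec" where
  "nnls_grad A x = Matrix.vec (dim_col A)
     (\<lambda>i. deriv (\<lambda>t. nnls_obj A (x + t \<cdot>\<^sub>v unit_vec (dim_col A) i)) 0)"

definition col_sq :: "real mat \<Rightarrow> nat \<Rightarrow> real" where
  "col_sq A j = col A j \<bullet> col A j"

definition scaled_norm :: "real mat \<Rightarrow> real vec \<Rightarrow> real" where
  "scaled_norm A x = sqrt (\<Sum>j<dim_col A. col_sq A j * (x $ j)\<^sup>2)"

definition box :: "real mat \<Rightarrow> real vec set" where
  "box A = {x \<in> carrier_vec (dim_col A). \<forall>j<dim_col A. 0 \<le> x $ j \<and> x $ j \<le> 1 / col_sq A j}"

definition nonneg_orthant :: "nat \<Rightarrow> real vec set" where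
  "nonneg_orthant n = {x \<in> carrier_vec n. \<forall>j<n. 0 \<le> x $ j}"

definition is_nnls_minimizer :: "real mat \<Rightarrow> real vec \<Rightarrow> bool" where
  "is_nnls_minimizer A z \<longleftrightarrow> is_arg_min (nnls_obj A) (\<lambda>x. x \<in> nonneg_orthant (dim_col A)) z"

definition pos_part :: "real vec \<Rightarrow> real vec" where
  "pos_part v = map_vec (\<lambda>t. max 0 t) v"

definition residual_vec :: "real mat \<Rightarrow> real vec \<Rightarrow> real vec" where
  "residual_vec A x =
     x - pos_part (x - mat_diag (dim_col A) (\<lambda>j. 1 / col_sq A j) *\<^sub>v nnls_grad A x)"

definition residual :: "real mat \<Rightarrow> real vec \<Rightarrow> real" where
  "residual A x = scaled_norm A (residual_vec A x)"

definition error_bound_constant :: "real mat \<Rightarrow> real \<Rightarrow> bool" where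
  "error_bound_constant A \<mu> \<longleftrightarrow> \<mu> > 0 \<and>
     (\<forall>x \<in> carrier_vec (dim_col A). \<forall>xs.
        is_arg_min (\<lambda>z. scaled_norm A (x - z)) (is_nnls_minimizer A) xs \<longrightarrow>
        residual A x \<ge> \<mu> * scaled_norm A (x - xs))"

text \<open>\<open>step n i\<close> is $a_i$ and \<open>step_sum n i\<close> is $A_i$; the value \<open>step n 0\<close> plays no role.\<close>

function (sequential) step :: "nat \<Rightarrow> nat \<Rightarrow> real" and step_sum :: "nat \<Rightarrow> nat \<Rightarrow> real" where
  "step n 0 = 0"
| "step n (Suc 0) = 1 / (sqrt 2 * real n powr (3 / 2))"
| "step n (Suc (Suc 0)) = step n 1 / (real n - 1)"
| "step n (Suc (Suc (Suc i))) =
     min (real n * step n (Suc (Suc i)) / (real n - 1))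
         (sqrt (step_sum n (Suc (Suc i))) / (2 * real n))"
| "step_sum n 0 = 0"
| "step_sum n (Suc i) = step_sum n i + step n (Suc i)"
  by pat_completeness auto
termination
  by (relation "Wellfounded.measure (\<lambda>s. case s of Inl (n, i) \<Rightarrow> 2 * i | Inr (n, i) \<Rightarrow> 2 * i + 1)") auto

text \<open>The iterates for initial point \<open>x0\<close> and sampled coordinates \<open>j 1, j 2, \<dots>\<close>. Both optimisation problems
  have exactly one solution when no column of \<open>A\<close> is zero, so \<open>arg_min\<close> and \<open>arg_max\<close> make no
  arbitrary choice.\<close>

function si_x :: "real mat \<Rightarrow> real vec \<Rightarrow> (nat \<Rightarrow> nat) \<Rightarrow> nat \<Rightarrow> real vec"
  and si_y :: "real mat \<Rightarrow> real vec \<Rightarrow> (nat \<Rightarrow> nat) \<Rightarrow> nat \<Rightarrow> real vec"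
  and si_ybar :: "real mat \<Rightarrow> real vec \<Rightarrow> (nat \<Rightarrow> nat) \<Rightarrow> nat \<Rightarrow> real vec" where
  "si_x A x0 j l =
    (if l = 0 then x0
     else let n = dim_col A in
       arg_min
         (\<lambda>x. step n 1 * ((transpose_mat A *\<^sub>v si_ybar A x0 j 0 - ones_vec n) \<bullet> x)
            + (\<Sum>i = 2..l. real n * step n i *
                 ((transpose_mat A *\<^sub>v si_ybar A x0 j (i - 1) - ones_vec n)
                   \<bullet> ((x $ j i) \<cdot>\<^sub>v unit_vec n (j i))))
            + 1 / 2 * (scaled_norm A (x - x0))\<^sup>2)
         (\<lambda>x. x \<in> box A))"
| "si_y A x0 j l =
    (if l = 0 then A *\<^sub>v x0
     else let n = dim_col A in
       arg_max
         (\<lambda>y. step n 1 * ((transpose_mat A *\<^sub>v y - ones_vec n) \<bullet> si_x A x0 j 1)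
            + (\<Sum>i = 2..l. step n i *
                 ((transpose_mat A *\<^sub>v y - ones_vec n)
                   \<bullet> (real n \<cdot>\<^sub>v si_x A x0 j i - (real n - 1) \<cdot>\<^sub>v si_x A x0 j (i - 1))))
            - step_sum n l / 2 * (y \<bullet> y))
         (\<lambda>y. y \<in> carrier_vec (dim_row A)))"
| "si_ybar A x0 j l =
    (if l = 0 then A *\<^sub>v x0
     else let n = dim_col A in
       si_y A x0 j l
         + (step n l / step n (l + 1)) \<cdot>\<^sub>v (si_y A x0 j l - si_y A x0 j (l - 1)))"
  by pat_completeness auto
termination
  by (relation "Wellfounded.measure (\<lambda>s. case s of
         Inl (A, x0, j, l) \<Rightarrow> 3 * l
       | Inr (Inl (A, x0, j, l)) \<Rightarrow> 3 * l + 1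
       | Inr (Inr (A, x0, j, l)) \<Rightarrow> 3 * l + 2)") auto

text \<open>The defining equations are unconditional and would loop as rewrite rules.\<close>

declare si_x.simps [simp del] si_y.simps [simp del] si_ybar.simps [simp del]

text \<open>The output \<open>si_out A x0 j l\<close> is meaningful for \<open>l \<ge> 1\<close> only.\<close>

fun si_out :: "real mat \<Rightarrow> real vec \<Rightarrow> (nat \<Rightarrow> nat) \<Rightarrow> nat \<Rightarrow> real vec" where
  "si_out A x0 j 0 = x0"
| "si_out A x0 j (Suc 0) = si_x A x0 j 1"
| "si_out A x0 j (Suc (Suc l)) =
    (let n = dim_col A; l' = Suc (Suc l) in
       (1 / step_sum n l') \<cdot>\<^sub>v
         (step_sum n (l' - 1) \<cdot>\<^sub>v si_out A x0 j (Suc l)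
          + step n l' \<cdot>\<^sub>v (real n \<cdot>\<^sub>v si_x A x0 j l' - (real n - 1) \<cdot>\<^sub>v si_x A x0 j (l' - 1))))"

text \<open>A sample point \<open>\<omega>\<close> supplies the coordinate \<open>\<omega> (k, l)\<close> drawn in iteration \<open>l\<close> of run \<open>k\<close>;
  all draws are independent and uniform.\<close>

definition samples :: "nat \<Rightarrow> (nat \<times> nat \<Rightarrow> nat) measure" where
  "samples n = Pi\<^sub>M UNIV (\<lambda>_. measure_pmf (pmf_of_set {..<n}))"

definition stops_at :: "real mat \<Rightarrow> real vec \<Rightarrow> (nat \<Rightarrow> nat) \<Rightarrow> nat \<Rightarrow> bool" where
  "stops_at A x0 j l \<longleftrightarrow> 1 \<le> l \<and> residual A (si_out A x0 j l) \<le> 1 / 2 * residual A x0"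

definition run_length :: "real mat \<Rightarrow> real vec \<Rightarrow> (nat \<Rightarrow> nat) \<Rightarrow> nat" where
  "run_length A x0 j = (LEAST l. stops_at A x0 j l)"

text \<open>The restart point $x_k$. If run \<open>k\<close> never stops, its value is immaterial, since every cost below
  that involves run \<open>k\<close> is then infinite.\<close>

fun restart_point :: "real mat \<Rightarrow> (nat \<times> nat \<Rightarrow> nat) \<Rightarrow> nat \<Rightarrow> real vec" where
  "restart_point A \<omega> 0 = 0\<^sub>v (dim_col A)"
| "restart_point A \<omega> (Suc k) =
    (let x = restart_point A \<omega> k; j = (\<lambda>l. \<omega> (Suc k, l))
     in si_out A x j (run_length A x j))"

text \<open>\<open>ops k l \<omega>\<close> is the number of arithmetic operations spent on iteration \<open>l\<close> of run \<open>k\<close> of the lazy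
  implementation. The implied constant of the per-iteration bounds is \<open>K\<close>. The first iteration of
  a run works with full matrix-vector products, every later one with a single column.\<close>

definition lazy_op_count ::
  "real \<Rightarrow> real mat \<Rightarrow> (nat \<Rightarrow> nat \<Rightarrow> (nat \<times> nat \<Rightarrow> nat) \<Rightarrow> nat) \<Rightarrow> bool" where
  "lazy_op_count K A ops \<longleftrightarrow>
     (\<forall>k\<ge>1. \<forall>l\<ge>1. ops k l \<in> measurable (samples (dim_col A)) (count_space UNIV)) \<and>
     (\<forall>k\<ge>1. \<forall>\<omega>. (\<forall>p. \<omega> p < dim_col A) \<longrightarrow>
        real (ops k 1 \<omega>) \<le> K * real (nnz A) \<and>
        (\<forall>l\<ge>2. real (ops k l \<omega>) \<le> K * real (nnz_vec (col A (\<omega> (k, l))))))"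

definition run_cost ::
  "real mat \<Rightarrow> (nat \<Rightarrow> nat \<Rightarrow> (nat \<times> nat \<Rightarrow> nat) \<Rightarrow> nat) \<Rightarrow> (nat \<times> nat \<Rightarrow> nat) \<Rightarrow> nat \<Rightarrow> ennreal" where
  "run_cost A ops \<omega> k =
    (let x = restart_point A \<omega> (k - 1); j = (\<lambda>l. \<omega> (k, l))
     in if \<exists>l. stops_at A x j l
        then \<Sum>l = 1..run_length A x j. of_nat (ops k l \<omega>)
        else \<infinity>)"

text \<open>Total cost of the runs \<open>1, \<dots>, k\<close> for the least index \<open>k\<close> satisfying \<open>P\<close>.\<close>

definition cost_until ::
  "real mat \<Rightarrow> (nat \<Rightarrow> nat \<Rightarrow> (nat \<times> nat \<Rightarrow> nat) \<Rightarrow> nat) \<Rightarrow> (nat \<times> nat \<Rightarrow> nat) \<Rightarrow> (nat \<Rightarrow> bool) \<Rightarrow> ennreal" where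
  "cost_until A ops \<omega> P =
    (if \<exists>k. P k then \<Sum>k = 1..(LEAST k. P k). run_cost A ops \<omega> k else \<infinity>)"

text \<open>Cost of the whole algorithm with error parameter \<open>\<epsilon>\<close>; the exit test follows each run, so at least one run
  is performed.\<close>

definition total_cost ::
  "real mat \<Rightarrow> (nat \<Rightarrow> nat \<Rightarrow> (nat \<times> nat \<Rightarrow> nat) \<Rightarrow> nat) \<Rightarrow> real \<Rightarrow> (nat \<times> nat \<Rightarrow> nat) \<Rightarrow> ennreal" where
  "total_cost A ops \<epsilon> \<omega> =
    cost_until A ops \<omega> (\<lambda>k. 1 \<le> k \<and> residual A (restart_point A \<omega> k) \<le> \<epsilon>)"

text \<open>Cost until one of the points $x_0, x_1, \dots$ has relative optimality gap at most \<open>\<delta>\<close>; \<open>xs\<close> is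
  a minimizer. The starting point $x_0 = 0$ costs nothing; its gap is $|f(x^\star)|$, so it qualifies
  only for \<open>\<delta> \<ge> 1\<close>.\<close>

definition cost_to_relative_gap ::
  "real mat \<Rightarrow> (nat \<Rightarrow> nat \<Rightarrow> (nat \<times> nat \<Rightarrow> nat) \<Rightarrow> nat) \<Rightarrow> real \<Rightarrow> real vec \<Rightarrow> (nat \<times> nat \<Rightarrow> nat) \<Rightarrow> ennreal" where
  "cost_to_relative_gap A ops \<delta> xs \<omega> =
    cost_until A ops \<omega>
      (\<lambda>k. nnls_obj A (restart_point A \<omega> k) - nnls_obj A xs \<le> \<delta> * \<bar>nnls_obj A xs\<bar>)"

end

theory Submission
  imports Defs
begin

text \<open>Write \<open>A\<^sub>l\<close> for \<open>step_sum n l\<close>, \<open>|.|\<close> for the norm weighted by the squared column norms and \<open>f\<^sup>*\<close> for the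
minimum of the objective. The heart of the matter is the rate of a single run: for a start \<open>x0\<close> and
any \<open>z\<close> in the box, the output after \<open>l\<close> iterations satisfies
\<open>E (f (output) - f z) \<le> |z - x0|\<^sup>2 / (2 A\<^sub>l)\<close> (\<open>expected_gap\<close>). Pathwise this holds up to a noise
term that has mean zero given the earlier samples (\<open>gap_le_noise\<close>). The proof compares the minima of the
accumulated linear models (\<open>mirror_descent\<close>) and lets the errors of the extrapolated dual points
telescope (\<open>extrapolation_row\<close>). The products of primal and dual increments that survive are paid for
because a primal increment lives in one coordinate, where \<open>A\<close> preserves the weighted norm exactly,
and because \<open>n\<^sup>2 a\<^sub>l\<^sup>2 \<le> A\<^bsub>l-1\<^esub> / 4\<close> for \<open>l \<ge> 2\<close>.

Three facts turn this rate into a bound on the length of a run. A projected step along one coordinate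
shows \<open>r\<^sup>2 \<le> 2 n (f - f\<^sup>*)\<close> on the orthant (\<open>residual_sq_le_gap\<close>). The error bound, applied at the start
only, gives \<open>|x0 - x\<^sup>*| \<le> r(x0) / \<mu>\<close>. Finally \<open>A\<^sub>l\<close> grows geometrically to a constant
within about \<open>4 n ln n\<close> iterations and at least like \<open>((l - 4 n ln n) / (8 n))\<^sup>2\<close> afterwards. By Markov's
inequality a run is still going after \<open>l\<close> iterations with probability at most
\<open>min 1 (4 n / (\<mu>\<^sup>2 A\<^sub>l))\<close> (\<open>prob_not_stopped\<close>), and these numbers add up to \<open>O(n ln n + n\<^sup>3\<^sup>/\<^sup>2 / \<mu>)\<close>
(\<open>sum_tail_bound\<close>). The column drawn in iteration \<open>l + 1\<close> is independent of the event that this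
iteration takes place and has \<open>nnz A / n\<close> nonzero entries on average, which gives the expected cost
of a run (\<open>expected_run_bound\<close>).

Every run halves the residual, so the number of runs is bounded deterministically by about
\<open>log\<^sub>2 (r(0) / \<epsilon>)\<close>. For the second claim, \<open>f - f\<^sup>* \<le> n r(x) r(0)\<close> on the box (\<open>gap_le_residual\<close>) and
\<open>r(0)\<^sup>2 \<le> 2 n |f\<^sup>*|\<close> show that a reduction of the residual by the factor \<open>2 n\<^sup>2 / \<delta>\<close> suffices; since
\<open>\<mu> \<le> 1\<close> (\<open>error_bound_le_1\<close>), its logarithm is \<open>O(ln (n / (\<mu> \<delta>)))\<close>.

Conditioning on the past is expressed by resampling: replacing some coordinates of a sample point
by those of an independent copy preserves the product measure (\<open>distr_mix\<close>), so an expectation may first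
be taken over fresh values of these coordinates while all others stay frozen.\<close>

section \<open>Geometry of the nonnegative least squares problem\<close>

locale nnls =
  fixes A :: "real mat" and m n :: nat
  assumes carrier: "A \<in> carrier_mat m n"
    and nondegenerate: "nonneg_nondegenerate A"
begin

text \<open>Coordinate forms of \<open>A x\<close>, of the gradient and of the natural residual; \<open>mult_index\<close>,
\<open>nnls_grad_index\<close> and \<open>residual_vec_index\<close> relate them to the vector operations.\<close>

definition img :: "real vec \<Rightarrow> nat \<Rightarrow> real" where
  "img x r = (\<Sum>j<n. A $$ (r, j) * x $ j)"

definition grd :: "real vec \<Rightarrow> nat \<Rightarrow> real" where
  "grd x i = (\<Sum>r<m. A $$ (r, i) * img x r) - 1"

definition res :: "real vec \<Rightarrow> nat \<Rightarrow> real" where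
  "res x j = x $ j - max 0 (x $ j - grd x j / col_sq A j)"

lemma dims [simp]: "dim_row A = m" "dim_col A = n"
  using carrier by auto

lemma entry_nonneg: "r < m \<Longrightarrow> j < n \<Longrightarrow> 0 \<le> A $$ (r, j)"
  using nondegenerate by (auto simp: nonneg_nondegenerate_def)

lemma col_sq_eq: "j < n \<Longrightarrow> col_sq A j = (\<Sum>r<m. (A $$ (r, j))\<^sup>2)"
  by (auto simp: col_sq_def scalar_prod_def atLeast0LessThan power2_eq_square intro!: sum.cong)

lemma col_sq_pos: assumes "j < n" shows "0 < col_sq A j"
proof -
  have "col A j \<noteq> 0\<^sub>v m"
    using nondegenerate assms by (auto simp: nonneg_nondegenerate_def)
  then obtain r where "r < m" "A $$ (r, j) \<noteq> 0"
    using assms by (auto simp: vec_eq_iff)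
  then show ?thesis
    unfolding col_sq_eq[OF assms] by (intro sum_pos2[of _ r]) auto
qed

lemma col_sq_nonneg: "j < n \<Longrightarrow> 0 \<le> col_sq A j"
  using col_sq_pos[of j] by simp

lemma mult_index: "x \<in> carrier_vec n \<Longrightarrow> r < m \<Longrightarrow> (A *\<^sub>v x) $ r = img x r"
  by (auto simp: scalar_prod_def img_def atLeast0LessThan intro!: sum.cong)

lemma obj_eq:
  assumes "x \<in> carrier_vec n"
  shows "nnls_obj A x = 1 / 2 * (\<Sum>r<m. (img x r)\<^sup>2) - (\<Sum>j<n. x $ j)"
proof -
  have "(A *\<^sub>v x) \<bullet> (A *\<^sub>v x) = (\<Sum>r<m. (img x r)\<^sup>2)"
    unfolding scalar_prod_def[of "A *\<^sub>v x"]
    using assms by (intro sum.cong) (auto simp: mult_index power2_eq_square simp del: index_mult_mat_vec)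
  moreover have "ones_vec n \<bullet> x = (\<Sum>j<n. x $ j)"
    using assms by (auto simp: scalar_prod_def ones_vec_def atLeast0LessThan intro!: sum.cong)
  ultimately show ?thesis by (simp add: nnls_obj_def)
qed

lemma sum_grd:
  "(\<Sum>i<n. grd x i * d i) = (\<Sum>r<m. img x r * (\<Sum>i<n. A $$ (r, i) * d i)) - (\<Sum>i<n. d i)"
proof -
  have "(\<Sum>i<n. (\<Sum>r<m. A $$ (r, i) * img x r) * d i) = (\<Sum>i<n. \<Sum>r<m. img x r * (A $$ (r, i) * d i))"
    by (simp add: sum_distrib_right sum_distrib_left mult_ac)
  also have "\<dots> = (\<Sum>r<m. \<Sum>i<n. img x r * (A $$ (r, i) * d i))"
    by (rule sum.swap)
  finally show ?thesis
    by (simp add: grd_def left_diff_distrib sum_subtractf sum_distrib_left)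
qed

lemma img_diff: "(\<Sum>i<n. A $$ (r, i) * (z $ i - x $ i)) = img z r - img x r"
  by (simp add: img_def right_diff_distrib sum_subtractf)

text \<open>The objective is quadratic, so its second-order expansion is exact.\<close>

lemma obj_expand:
  assumes "x \<in> carrier_vec n" "z \<in> carrier_vec n"
  shows "nnls_obj A z = nnls_obj A x + (\<Sum>i<n. grd x i * (z $ i - x $ i))
           + 1 / 2 * (\<Sum>r<m. (img z r - img x r)\<^sup>2)"
proof -
  have "(\<Sum>r<m. (img z r - img x r)\<^sup>2) = (\<Sum>r<m. (img z r)\<^sup>2) - (\<Sum>r<m. (img x r)\<^sup>2)
      - 2 * (\<Sum>r<m. img x r * (img z r - img x r))"
    unfolding sum_distrib_left sum_subtractf[symmetric]
    by (rule sum.cong) (auto simp: power2_eq_square algebra_simps)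
  moreover have "(\<Sum>i<n. z $ i - x $ i) = (\<Sum>i<n. z $ i) - (\<Sum>i<n. x $ i)"
    by (rule sum_subtractf)
  ultimately show ?thesis
    unfolding obj_eq[OF assms(1)] obj_eq[OF assms(2)] sum_grd img_diff by linarith
qed

lemma obj_coordinate_step:
  assumes x: "x \<in> carrier_vec n" and i: "i < n"
  shows "nnls_obj A (x + t \<cdot>\<^sub>v unit_vec n i) = nnls_obj A x + t * grd x i + col_sq A i * t\<^sup>2 / 2"
proof -
  let ?z = "x + t \<cdot>\<^sub>v unit_vec n i"
  have z: "?z \<in> carrier_vec n" using x by auto
  have d: "?z $ k - x $ k = (if k = i then t else 0)" if "k < n" for k
    using that x i by auto
  have "img ?z r - img x r = A $$ (r, i) * t" for r
  proof -
    have "img ?z r - img x r = (\<Sum>k<n. A $$ (r, k) * (if k = i then t else 0))"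
      unfolding img_diff[symmetric] by (intro sum.cong) (auto simp only: d lessThan_iff)
    then show ?thesis using i by (simp add: if_distrib cong: if_cong)
  qed
  then have "(\<Sum>r<m. (img ?z r - img x r)\<^sup>2) = col_sq A i * t\<^sup>2"
    using i by (simp add: col_sq_eq sum_distrib_right power_mult_distrib)
  moreover have "(\<Sum>k<n. grd x k * (?z $ k - x $ k)) = grd x i * t"
  proof -
    have "(\<Sum>k<n. grd x k * (?z $ k - x $ k)) = (\<Sum>k<n. grd x k * (if k = i then t else 0))"
      by (intro sum.cong) (auto simp only: d lessThan_iff)
    then show ?thesis using i by (simp add: if_distrib cong: if_cong)
  qed
  ultimately show ?thesis
    unfolding obj_expand[OF x z] by simp
qed

lemma nnls_grad_index:
  assumes x: "x \<in> carrier_vec n" and i: "i < n"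
  shows "nnls_grad A x $ i = grd x i"
proof -
  have "((\<lambda>t. nnls_obj A x + t * grd x i + col_sq A i * t\<^sup>2 / 2) has_field_derivative grd x i) (at 0)"
    by (auto intro!: derivative_eq_intros)
  from DERIV_imp_deriv[OF this] show ?thesis
    using i by (simp add: nnls_grad_def obj_coordinate_step[OF x i])
qed

lemma residual_vec_index:
  assumes x: "x \<in> carrier_vec n" and i: "i < n"
  shows "residual_vec A x $ i = res x i"
proof -
  let ?D = "mat_diag n (\<lambda>j. 1 / col_sq A j)"
  have g: "dim_vec (nnls_grad A x) = n" by (simp add: nnls_grad_def)
  have "(?D *\<^sub>v nnls_grad A x) $ i = (\<Sum>k<n. ?D $$ (i, k) * nnls_grad A x $ k)"
    using i g by (auto simp: scalar_prod_def atLeast0LessThan mat_diag_def intro!: sum.cong)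
  also have "\<dots> = (\<Sum>k<n. if k = i then grd x i / col_sq A i else 0)"
    using i x by (intro sum.cong) (auto simp: mat_diag_def nnls_grad_index)
  finally have "(?D *\<^sub>v nnls_grad A x) $ i = grd x i / col_sq A i"
    using i by simp
  moreover have "dim_vec (?D *\<^sub>v nnls_grad A x) = n" by (simp add: mat_diag_def)
  ultimately show ?thesis
    using i x g unfolding residual_vec_def pos_part_def res_def dims
    by (simp del: index_mult_mat_vec dim_mult_mat_vec)
qed

lemma scaled_norm_sq: "(scaled_norm A x)\<^sup>2 = (\<Sum>j<n. col_sq A j * (x $ j)\<^sup>2)"
  unfolding scaled_norm_def dims
  by (rule real_sqrt_pow2) (auto intro!: sum_nonneg mult_nonneg_nonneg col_sq_nonneg)

lemma scaled_norm_nonneg: "0 \<le> scaled_norm A x"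
  unfolding scaled_norm_def dims
  by (rule real_sqrt_ge_zero) (auto intro!: sum_nonneg mult_nonneg_nonneg col_sq_nonneg)

lemma residual_nonneg: "0 \<le> residual A x"
  by (simp add: residual_def scaled_norm_nonneg)

lemma residual_sq:
  "x \<in> carrier_vec n \<Longrightarrow> (residual A x)\<^sup>2 = (\<Sum>j<n. col_sq A j * (res x j)\<^sup>2)"
  unfolding residual_def scaled_norm_sq by (simp add: residual_vec_index)

lemma scaled_norm_diff_sq:
  assumes "x \<in> carrier_vec n" "z \<in> carrier_vec n"
  shows "(scaled_norm A (x - z))\<^sup>2 = (\<Sum>j<n. col_sq A j * (x $ j - z $ j)\<^sup>2)"
  unfolding scaled_norm_sq using assms by simp

text \<open>Cauchy-Schwarz over the \<open>n\<close> entries of each row: \<open>A\<^sup>T A\<close> is at most \<open>n\<close> times its diagonal.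
Directions with several nonzero coordinates may pay this factor \<open>n\<close>.\<close>

lemma img_sq_le:
  "(\<Sum>r<m. (\<Sum>i<n. A $$ (r, i) * d i)\<^sup>2) \<le> real n * (\<Sum>i<n. col_sq A i * (d i)\<^sup>2)"
proof -
  have "(\<Sum>r<m. (\<Sum>i<n. A $$ (r, i) * d i)\<^sup>2) \<le> (\<Sum>r<m. (\<Sum>i<n. (A $$ (r, i) * d i)\<^sup>2) * real n)"
    by (rule sum_mono, rule order_trans[OF sum_squared_le_sum_of_squares]) simp
  also have "\<dots> = real n * (\<Sum>i<n. \<Sum>r<m. (A $$ (r, i) * d i)\<^sup>2)"
    by (subst sum.swap) (simp add: sum_distrib_left mult.commute)
  also have "\<dots> = real n * (\<Sum>i<n. col_sq A i * (d i)\<^sup>2)"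
    by (simp add: col_sq_eq sum_distrib_right power_mult_distrib)
  finally show ?thesis .
qed

text \<open>The Karush-Kuhn-Tucker conditions for minimizing the objective over the orthant.\<close>

definition kkt :: "real vec \<Rightarrow> bool" where
  "kkt x \<longleftrightarrow> x \<in> carrier_vec n \<and> (\<forall>i<n. 0 \<le> x $ i \<and> 0 \<le> grd x i \<and> x $ i * grd x i = 0)"

text \<open>The off-diagonal entries of \<open>A\<^sup>T A\<close> are nonnegative, so on the orthant the gradient is at least its
diagonal part. Hence the objective does not decrease in a coordinate beyond
\<open>1 / col_sq A i\<close>, which is why the box loses no minimizer.\<close>

lemma grd_lower_bound:
  assumes "x \<in> nonneg_orthant n" "i < n"
  shows "col_sq A i * x $ i - 1 \<le> grd x i"
proof -
  have "A $$ (r, i) * (A $$ (r, i) * x $ i) \<le> A $$ (r, i) * img x r" if "r < m" for r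
    unfolding img_def using assms that
    by (intro mult_left_mono member_le_sum) (auto simp: nonneg_orthant_def intro!: mult_nonneg_nonneg entry_nonneg)
  then have "(\<Sum>r<m. A $$ (r, i) * (A $$ (r, i) * x $ i)) \<le> (\<Sum>r<m. A $$ (r, i) * img x r)"
    by (intro sum_mono) auto
  then show ?thesis
    using assms by (simp add: grd_def col_sq_eq sum_distrib_right power2_eq_square mult.assoc)
qed

lemma kkt_minimizer: assumes "kkt x" shows "is_nnls_minimizer A x"
proof -
  have x: "x \<in> carrier_vec n" using assms by (simp add: kkt_def)
  have "nnls_obj A x \<le> nnls_obj A z" if z: "z \<in> nonneg_orthant n" for z
  proof -
    have "0 \<le> grd x i * (z $ i - x $ i)" if "i < n" for i
      using that z assms by (auto simp: kkt_def nonneg_orthant_def right_diff_distrib mult.commute[of "x $ i"])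
    then have "0 \<le> (\<Sum>i<n. grd x i * (z $ i - x $ i))"
      by (intro sum_nonneg) auto
    moreover have "0 \<le> (\<Sum>r<m. (img z r - img x r)\<^sup>2)"
      by (intro sum_nonneg) auto
    moreover have zc: "z \<in> carrier_vec n" using z by (simp add: nonneg_orthant_def)
    ultimately show ?thesis
      unfolding obj_expand[OF x zc] by linarith
  qed
  then show ?thesis
    using assms by (auto simp: is_nnls_minimizer_def is_arg_min_linorder kkt_def nonneg_orthant_def)
qed

lemma orthant_imp_carrier: "x \<in> nonneg_orthant n \<Longrightarrow> x \<in> carrier_vec n"
  by (simp add: nonneg_orthant_def)

lemma box_imp_orthant: "x \<in> box A \<Longrightarrow> x \<in> nonneg_orthant n"
  by (simp add: box_def nonneg_orthant_def)

lemma box_imp_carrier: "x \<in> box A \<Longrightarrow> x \<in> carrier_vec n"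
  by (simp add: box_def)

text \<open>Perturbing one coordinate at a time suffices. By \<open>grd_lower_bound\<close> a negative partial derivative leaves
room for a full coordinate step below the upper bound, so the upper bounds of the box never bind.\<close>

lemma kkt_if_box_minimal:
  assumes x: "x \<in> box A" and min: "\<And>z. z \<in> box A \<Longrightarrow> nnls_obj A x \<le> nnls_obj A z"
  shows "kkt x"
proof -
  have xc: "x \<in> carrier_vec n" using x by (simp add: box_def)
  have x0: "0 \<le> x $ i" "x $ i \<le> 1 / col_sq A i" if "i < n" for i
    using x that by (auto simp: box_def)
  have step: "0 \<le> t * (grd x i + col_sq A i * t / 2)"
    if i: "i < n" and t: "0 \<le> x $ i + t" "x $ i + t \<le> 1 / col_sq A i" for i t
  proof -
    have "x + t \<cdot>\<^sub>v unit_vec n i \<in> box A"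
      using xc x0 i t unfolding box_def by auto
    from min[OF this] show ?thesis
      unfolding obj_coordinate_step[OF xc i] by (simp add: algebra_simps power2_eq_square)
  qed
  have "0 \<le> grd x i" if i: "i < n" for i
  proof (rule ccontr)
    assume neg: "\<not> 0 \<le> grd x i"
    define L where "L = col_sq A i"
    have L: "0 < L" using col_sq_pos[OF i] by (simp add: L_def)
    have lb: "L * x $ i - 1 \<le> grd x i"
      using grd_lower_bound[OF box_imp_orthant[OF x] i] by (simp add: L_def)
    \<comment> \<open>The full coordinate step respects the upper bound, as the gradient is at least \<open>L * x $ i - 1\<close>.\<close>
    have "x $ i + - grd x i / L = (L * x $ i - grd x i) / L"
      using L by (simp add: field_simps)
    also have "\<dots> \<le> 1 / L"
      using L lb by (intro divide_right_mono) auto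
    finally have "x $ i + - grd x i / L \<le> 1 / L" .
    moreover have "0 \<le> - grd x i / L"
      using L neg by (intro divide_nonneg_pos) auto
    then have "0 \<le> x $ i + - grd x i / L"
      using x0(1)[OF i] by linarith
    ultimately have "0 \<le> (- grd x i / L) * (grd x i + L * (- grd x i / L) / 2)"
      using step[OF i, of "- grd x i / L"] by (simp add: L_def)
    also have "\<dots> = - ((grd x i)\<^sup>2 / (2 * L))"
      using L by (simp add: field_simps power2_eq_square)
    finally have "(grd x i)\<^sup>2 / (2 * L) \<le> 0" by simp
    moreover have "0 < (grd x i)\<^sup>2 / (2 * L)" using L neg by auto
    ultimately show False by simp
  qed
  moreover have "x $ i * grd x i = 0" if i: "i < n" for i
  proof (rule ccontr)
    assume "x $ i * grd x i \<noteq> 0"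
    then have p: "0 < x $ i" "0 < grd x i"
      using x0(1)[OF i] calculation[OF i] by (auto simp: order_less_le)
    define L where "L = col_sq A i"
    have L: "0 < L" using col_sq_pos[OF i] by (simp add: L_def)
    \<comment> \<open>The longest step down that keeps the coordinate nonnegative and does not overshoot.\<close>
    define t where "t = min (x $ i) (grd x i / L)"
    have t: "0 < t" "t \<le> x $ i" "L * t \<le> grd x i"
      using p L by (auto simp: t_def min_def field_simps)
    have "0 \<le> (- t) * (grd x i + L * (- t) / 2)"
      using step[OF i, of "- t"] t x0[OF i] by (simp add: L_def)
    then have "grd x i - L * t / 2 \<le> 0"
      using t by (simp add: mult_le_0_iff)
    then show False using t p by linarith
  qed
  ultimately show ?thesis
    using xc x0 by (auto simp: kkt_def)
qed

lemma kkt_imp_box: assumes "kkt x" shows "x \<in> box A"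
proof -
  have o: "x \<in> nonneg_orthant n" using assms by (auto simp: kkt_def nonneg_orthant_def)
  have "x $ i \<le> 1 / col_sq A i" if i: "i < n" for i
  proof (cases "x $ i = 0")
    case False
    then have "grd x i = 0" using assms i by (auto simp: kkt_def)
    then show ?thesis
      using grd_lower_bound[OF o i] col_sq_pos[OF i] by (simp add: field_simps)
  qed (use col_sq_pos[OF i] in simp)
  then show ?thesis
    using assms by (auto simp: kkt_def box_def)
qed

text \<open>The box as a set of functions that vanish from \<open>n\<close> on. Unlike vectors of variable dimension, functions
carry a topology, in which this set is compact by Tychonoff's theorem.\<close>

definition box_fun :: "(nat \<Rightarrow> real) set" where
  "box_fun = PiE UNIV (\<lambda>i. if i < n then {0..1 / col_sq A i} else {0})"

lemma compact_box_fun: "compact box_fun"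
proof -
  have "compactin (product_topology (\<lambda>_. euclidean) UNIV) box_fun"
    unfolding box_fun_def compactin_PiE by auto
  then show ?thesis
    by (simp add: euclidean_product_topology)
qed

lemma box_eq_image: "box A = Matrix.vec n ` box_fun"
proof (intro equalityI subsetI)
  fix x assume x: "x \<in> box A"
  then have "x = Matrix.vec n (\<lambda>i. if i < n then x $ i else 0)"
    by (auto simp: box_def)
  moreover have "(\<lambda>i. if i < n then x $ i else 0) \<in> box_fun"
    using x by (auto simp: box_def box_fun_def)
  ultimately show "x \<in> Matrix.vec n ` box_fun" by blast
next
  fix x assume "x \<in> Matrix.vec n ` box_fun"
  then obtain f where f: "f \<in> box_fun" "x = Matrix.vec n f" by auto
  then have "f i \<in> {0..1 / col_sq A i}" if "i < n" for i
    using that by (auto simp: box_fun_def PiE_iff dest!: spec[of _ i])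
  then show "x \<in> box A" using f by (auto simp: box_def)
qed

lemma continuous_obj: "continuous_on S (\<lambda>f. nnls_obj A (Matrix.vec n f))"
proof -
  have "(\<lambda>f. nnls_obj A (Matrix.vec n f)) =
     (\<lambda>f. 1 / 2 * (\<Sum>r<m. (\<Sum>j<n. A $$ (r, j) * f j)\<^sup>2) - (\<Sum>j<n. f j))"
    by (auto simp: obj_eq img_def)
  moreover have "continuous_on S (\<lambda>f. 1 / 2 * (\<Sum>r<m. (\<Sum>j<n. A $$ (r, j) * f j)\<^sup>2) - (\<Sum>j<n. f j))"
    by (auto intro!: continuous_intros continuous_on_subset[OF continuous_on_product_coordinates])
  ultimately show ?thesis
    by (simp only:)
qed

lemma ex_kkt: "\<exists>x. kkt x"
proof -
  have "box_fun \<noteq> {}"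
    using col_sq_nonneg by (auto simp: box_fun_def PiE_eq_empty_iff not_le)
  from continuous_attains_inf[OF compact_box_fun this continuous_obj]
  obtain f where "f \<in> box_fun" "\<And>g. g \<in> box_fun \<Longrightarrow> nnls_obj A (Matrix.vec n f) \<le> nnls_obj A (Matrix.vec n g)"
    by blast
  then have "kkt (Matrix.vec n f)"
    by (intro kkt_if_box_minimal) (auto simp: box_eq_image)
  then show ?thesis ..
qed

lemma minimizer_iff_kkt: "is_nnls_minimizer A x \<longleftrightarrow> kkt x"
proof
  assume x: "is_nnls_minimizer A x"
  obtain y where y: "kkt y" using ex_kkt ..
  have xo: "x \<in> nonneg_orthant n" and xm: "\<And>z. z \<in> nonneg_orthant n \<Longrightarrow> nnls_obj A x \<le> nnls_obj A z"
    using x by (auto simp: is_nnls_minimizer_def is_arg_min_linorder)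
  show "kkt x"
  proof -
    have xc: "x \<in> carrier_vec n" and yc: "y \<in> carrier_vec n" and yo: "y \<in> nonneg_orthant n"
      using xo y by (auto simp: nonneg_orthant_def kkt_def)
    \<comment> \<open>In the expansion around \<open>y\<close> the linear and the quadratic term are both nonnegative, so both
      vanish; the second one forces \<open>A x = A y\<close>, hence equal gradients.\<close>
    have nn: "0 \<le> grd y i * (x $ i - y $ i)" if "i < n" for i
      using that xo y by (auto simp: kkt_def nonneg_orthant_def right_diff_distrib mult.commute[of "y $ i"])
    have s: "0 \<le> (\<Sum>i<n. grd y i * (x $ i - y $ i))"
      by (rule sum_nonneg) (use nn in auto)
    have s': "0 \<le> (\<Sum>r<m. (img x r - img y r)\<^sup>2)"
      by (rule sum_nonneg) auto
    have "nnls_obj A x \<le> nnls_obj A y" using xm yo by blast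
    then have z: "(\<Sum>i<n. grd y i * (x $ i - y $ i)) = 0" "(\<Sum>r<m. (img x r - img y r)\<^sup>2) = 0"
      using s s' unfolding obj_expand[OF yc xc] by linarith+
    have "img x r = img y r" if "r < m" for r
      using z(2) that by (simp add: sum_nonneg_eq_0_iff)
    then have g: "grd x i = grd y i" for i by (simp add: grd_def)
    have "\<forall>i\<in>{..<n}. grd y i * (x $ i - y $ i) = 0"
      using z(1) nn by (subst sum_nonneg_eq_0_iff[symmetric]) auto
    then have "x $ i * grd y i = y $ i * grd y i" if "i < n" for i
      using that by (auto simp: algebra_simps)
    then show ?thesis
      using xo y g unfolding kkt_def nonneg_orthant_def by auto
  qed
qed (rule kkt_minimizer)

lemma ex_minimizer: "\<exists>x. is_nnls_minimizer A x"
  using ex_kkt minimizer_iff_kkt by blast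

lemma minimizer_in_box: "is_nnls_minimizer A x \<Longrightarrow> x \<in> box A"
  by (simp add: minimizer_iff_kkt kkt_imp_box)

lemma minimizer_le: "is_nnls_minimizer A xs \<Longrightarrow> z \<in> nonneg_orthant n \<Longrightarrow> nnls_obj A xs \<le> nnls_obj A z"
  by (auto simp: is_nnls_minimizer_def is_arg_min_linorder)

text \<open>The minimizers form a closed subset of the compact box. The error bound constant speaks about
nearest minimizers only, so it is of use at a point only once one exists.\<close>

lemma ex_nearest_minimizer:
  assumes x: "x \<in> carrier_vec n"
  shows "\<exists>xs. is_arg_min (\<lambda>z. scaled_norm A (x - z)) (is_nnls_minimizer A) xs"
proof -
  obtain y where y: "is_nnls_minimizer A y" using ex_minimizer ..
  let ?S = "box_fun \<inter> {f. nnls_obj A (Matrix.vec n f) \<le> nnls_obj A y}"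
  have S: "is_nnls_minimizer A z \<longleftrightarrow> z \<in> Matrix.vec n ` ?S" for z
  proof
    assume z: "is_nnls_minimizer A z"
    then have "z \<in> Matrix.vec n ` box_fun" using minimizer_in_box box_eq_image by blast
    moreover have "nnls_obj A z \<le> nnls_obj A y"
      using minimizer_le[OF z] minimizer_in_box[OF y] box_imp_orthant by blast
    ultimately show "z \<in> Matrix.vec n ` ?S" by auto
  next
    assume "z \<in> Matrix.vec n ` ?S"
    then have "z \<in> box A" and le: "nnls_obj A z \<le> nnls_obj A y" by (auto simp: box_eq_image)
    then show "is_nnls_minimizer A z"
      using minimizer_le[OF y] box_imp_orthant[of z]
      by (fastforce simp: is_nnls_minimizer_def is_arg_min_linorder)
  qed
  have "closed {f. nnls_obj A (Matrix.vec n f) \<le> nnls_obj A y}"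
    by (intro closed_Collect_le continuous_obj continuous_on_const)
  then have c: "compact ?S" by (rule compact_Int_closed[OF compact_box_fun])
  have "(\<lambda>f. scaled_norm A (x - Matrix.vec n f)) = (\<lambda>f. sqrt (\<Sum>j<n. col_sq A j * (x $ j - f j)\<^sup>2))"
    using x by (auto simp: scaled_norm_def)
  moreover have "continuous_on ?S (\<lambda>f. sqrt (\<Sum>j<n. col_sq A j * (x $ j - f j)\<^sup>2))"
    by (auto intro!: continuous_intros continuous_on_subset[OF continuous_on_product_coordinates])
  ultimately have "continuous_on ?S (\<lambda>f. scaled_norm A (x - Matrix.vec n f))"
    by (simp only:)
  moreover have "?S \<noteq> {}" using y S by blast
  ultimately obtain f where "f \<in> ?S"
    "\<And>g. g \<in> ?S \<Longrightarrow> scaled_norm A (x - Matrix.vec n f) \<le> scaled_norm A (x - Matrix.vec n g)"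
    using continuous_attains_inf[OF c] by blast
  then have "is_arg_min (\<lambda>z. scaled_norm A (x - z)) (is_nnls_minimizer A) (Matrix.vec n f)"
    unfolding is_arg_min_linorder S by blast
  then show ?thesis ..
qed

end

section \<open>Residual, optimality gap and the error bound constant\<close>

context nnls
begin

text \<open>A projected gradient step along coordinate \<open>i\<close> alone lowers the objective by at least
\<open>col_sq A i * (res x i)\<^sup>2 / 2\<close>, and no step gets below the minimum. So each of the \<open>n\<close> summands
of the squared residual is at most twice the gap.\<close>

lemma residual_sq_le_gap:
  assumes x: "x \<in> nonneg_orthant n" and xs: "is_nnls_minimizer A xs"
  shows "(residual A x)\<^sup>2 \<le> 2 * real n * (nnls_obj A x - nnls_obj A xs)"
proof -
  have xc: "x \<in> carrier_vec n" using x by (rule orthant_imp_carrier)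
  have "col_sq A i * (res x i)\<^sup>2 \<le> 2 * (nnls_obj A x - nnls_obj A xs)" if i: "i < n" for i
  proof -
    define L g R where "L = col_sq A i" and "g = grd x i" and "R = res x i"
    have L: "0 < L" using col_sq_pos[OF i] by (simp add: L_def)
    have xi: "0 \<le> x $ i" using x i by (simp add: nonneg_orthant_def)
    have R: "R = x $ i - max 0 (x $ i - g / L)"
      by (simp add: R_def res_def L_def g_def)
    have "L * R\<^sup>2 \<le> R * g"
    proof (cases "x $ i \<le> g / L")
      case True
      then have "R = x $ i" "L * R \<le> g" using R L by (auto simp: field_simps)
      then show ?thesis
        using mult_left_mono[of "L * R" g R] xi by (simp add: power2_eq_square mult_ac)
    next
      case False
      then have "R = g / L" using R by simp
      then show ?thesis using L by (simp add: power2_eq_square)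
    qed
    moreover have "x + (- R) \<cdot>\<^sub>v unit_vec n i \<in> nonneg_orthant n"
      using x i R unfolding nonneg_orthant_def by auto
    then have "nnls_obj A xs \<le> nnls_obj A x + (- R) * g + L * (- R)\<^sup>2 / 2"
      unfolding g_def L_def obj_coordinate_step[OF xc i, symmetric] by (rule minimizer_le[OF xs])
    ultimately have "L * R\<^sup>2 \<le> 2 * (nnls_obj A x - nnls_obj A xs)" by simp
    then show ?thesis by (simp add: L_def R_def)
  qed
  then have "(\<Sum>i<n. col_sq A i * (res x i)\<^sup>2) \<le> (\<Sum>i<n. 2 * (nnls_obj A x - nnls_obj A xs))"
    by (intro sum_mono) auto
  then show ?thesis unfolding residual_sq[OF xc] by (simp add: algebra_simps)
qed

lemma zero_in_box: "0\<^sub>v n \<in> box A"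
  using col_sq_nonneg by (auto simp: box_def)

lemma obj_zero: "nnls_obj A (0\<^sub>v n) = 0"
  by (simp add: obj_eq img_def)

lemma minimum_nonpos: "is_nnls_minimizer A xs \<Longrightarrow> nnls_obj A xs \<le> 0"
  using minimizer_le[of xs "0\<^sub>v n"] box_imp_orthant[OF zero_in_box] obj_zero by simp

lemma residual_zero_sq: "(residual A (0\<^sub>v n))\<^sup>2 = (\<Sum>j<n. 1 / col_sq A j)"
proof -
  have "res (0\<^sub>v n) j = - (1 / col_sq A j)" if "j < n" for j
    using that col_sq_pos[OF that] by (simp add: res_def grd_def img_def)
  then show ?thesis
    unfolding residual_sq[OF zero_carrier_vec]
    by (intro sum.cong) (auto simp: power2_eq_square dest: col_sq_pos)
qed

lemma residual_zero_sq_le: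
  assumes "is_nnls_minimizer A xs"
  shows "(residual A (0\<^sub>v n))\<^sup>2 \<le> 2 * real n * \<bar>nnls_obj A xs\<bar>"
  using residual_sq_le_gap[OF box_imp_orthant[OF zero_in_box] assms] minimum_nonpos[OF assms]
  by (simp add: obj_zero)

lemma residual_zero_pos: assumes "0 < n" shows "0 < residual A (0\<^sub>v n)"
proof -
  have "0 < (residual A (0\<^sub>v n))\<^sup>2"
    unfolding residual_zero_sq using assms by (intro sum_pos) (auto intro: col_sq_pos)
  then show ?thesis using residual_nonneg[of "0\<^sub>v n"] by (simp add: order_less_le)
qed

text \<open>By Cauchy-Schwarz \<open>(A\<^sup>T A)\<^sub>i\<^sub>j\<close> is at most the product of the two column norms, and \<open>x\<^sub>j\<close> is at most
the inverse square of the norm of column \<open>j\<close>.\<close>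

lemma grd_upper_bound:
  assumes x: "x \<in> box A" and i: "i < n"
  shows "grd x i \<le> sqrt (col_sq A i) * (\<Sum>j<n. 1 / sqrt (col_sq A j))"
proof -
  have ij: "(\<Sum>r<m. A $$ (r, i) * A $$ (r, j)) \<le> sqrt (col_sq A i) * sqrt (col_sq A j)" if "j < n" for j
  proof (rule power2_le_imp_le)
    show "(\<Sum>r<m. A $$ (r, i) * A $$ (r, j))\<^sup>2 \<le> (sqrt (col_sq A i) * sqrt (col_sq A j))\<^sup>2"
      using Cauchy_Schwarz_ineq_sum[of "\<lambda>r. A $$ (r, i)" "\<lambda>r. A $$ (r, j)" "{..<m}"] i that
      by (simp add: power_mult_distrib col_sq_nonneg flip: col_sq_eq)
    show "0 \<le> sqrt (col_sq A i) * sqrt (col_sq A j)"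
      using i that by (simp add: col_sq_nonneg)
  qed
  have "grd x i + 1 = (\<Sum>j<n. (\<Sum>r<m. A $$ (r, i) * A $$ (r, j)) * x $ j)"
    unfolding grd_def img_def sum_distrib_left sum_distrib_right
    by (subst sum.swap) (simp add: mult.assoc)
  also have "\<dots> \<le> (\<Sum>j<n. (sqrt (col_sq A i) * sqrt (col_sq A j)) * (1 / col_sq A j))"
    using x i by (intro sum_mono mult_mono ij) (auto simp: box_def col_sq_nonneg)
  also have "\<dots> = (\<Sum>j<n. sqrt (col_sq A i) * (1 / sqrt (col_sq A j)))"
  proof (rule sum.cong)
    fix j assume "j \<in> {..<n}"
    then have "0 < col_sq A j" using col_sq_pos by simp
    then show "sqrt (col_sq A i) * sqrt (col_sq A j) * (1 / col_sq A j) = sqrt (col_sq A i) * (1 / sqrt (col_sq A j))"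
      by (simp add: real_div_sqrt field_simps)
  qed simp
  finally show ?thesis by (simp add: sum_distrib_left)
qed

lemma sum_le_sqrt_card:
  assumes nn: "\<And>i. i < n \<Longrightarrow> 0 \<le> c i"
  shows "(\<Sum>i<n. sqrt (c i) * \<bar>d i\<bar>) \<le> sqrt (real n) * sqrt (\<Sum>i<n. c i * (d i)\<^sup>2)"
proof -
  have "(\<Sum>i<n. sqrt (c i) * \<bar>d i\<bar>)\<^sup>2 \<le> (\<Sum>i<n. (sqrt (c i) * \<bar>d i\<bar>)\<^sup>2) * card {..<n}"
    by (rule sum_squared_le_sum_of_squares)
  also have "\<dots> = real n * (\<Sum>i<n. c i * (d i)\<^sup>2)"
    using nn by (simp add: power_mult_distrib mult.commute)
  finally have "sqrt ((\<Sum>i<n. sqrt (c i) * \<bar>d i\<bar>)\<^sup>2) \<le> sqrt (real n * (\<Sum>i<n. c i * (d i)\<^sup>2))"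
    by (rule real_sqrt_le_mono)
  then show ?thesis
    by (simp add: real_sqrt_mult)
qed

text \<open>By convexity the gap is at most the inner product of the gradient with \<open>x - xs\<close>. Where the residual
equals \<open>x\<^sub>i\<close>, that coordinate contributes at most \<open>g\<^sub>i x\<^sub>i\<close>, bounded by \<open>grd_upper_bound\<close>; where it equals
\<open>g\<^sub>i / L\<^sub>i\<close>, the factor \<open>x\<^sub>i - xs\<^sub>i\<close> is at most \<open>1 / L\<^sub>i\<close> in absolute value.\<close>

lemma gap_le_residual:
  assumes x: "x \<in> box A" and xs: "is_nnls_minimizer A xs"
  shows "nnls_obj A x - nnls_obj A xs \<le> real n * residual A x * residual A (0\<^sub>v n)"
proof -
  let ?S = "\<Sum>j<n. 1 / sqrt (col_sq A j)"
  have xsb: "xs \<in> box A" by (rule minimizer_in_box[OF xs])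
  note xc = box_imp_carrier[OF x] and xsc = box_imp_carrier[OF xsb]
  have coord: "grd x i * (x $ i - xs $ i) \<le> ?S * (sqrt (col_sq A i) * \<bar>res x i\<bar>)" if i: "i < n" for i
  proof -
    define L g R where "L = col_sq A i" and "g = grd x i" and "R = res x i"
    have L: "0 < L" using col_sq_pos[OF i] by (simp add: L_def)
    have R: "R = x $ i - max 0 (x $ i - g / L)"
      by (simp add: R_def res_def L_def g_def)
    have b: "0 \<le> x $ i" "x $ i \<le> 1 / L" "0 \<le> xs $ i" "xs $ i \<le> 1 / L"
      using x xsb i by (auto simp: box_def L_def)
    have "g * (x $ i - xs $ i) \<le> ?S * (sqrt L * \<bar>R\<bar>)"
    proof (cases "x $ i \<le> g / L")
      case True
      then have "R = x $ i" using R by simp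
      moreover have "0 \<le> g" using True b(1) L by (simp add: field_simps) (smt (verit) mult_nonneg_nonneg)
      ultimately have "g * (x $ i - xs $ i) \<le> g * \<bar>R\<bar>"
        using b by (intro mult_left_mono) auto
      also have "\<dots> \<le> (sqrt L * ?S) * \<bar>R\<bar>"
        using grd_upper_bound[OF x i] by (intro mult_right_mono) (auto simp: g_def L_def)
      finally show ?thesis by (simp add: mult_ac)
    next
      case False
      then have gR: "g = L * R" using R L by simp
      have "g * (x $ i - xs $ i) \<le> \<bar>g\<bar> * \<bar>x $ i - xs $ i\<bar>"
        by (metis abs_ge_self abs_mult)
      also have "\<dots> \<le> (L * \<bar>R\<bar>) * (1 / L)"
        using b L by (intro mult_mono) (auto simp: gR abs_mult)
      also have "\<dots> = (1 / sqrt L) * (sqrt L * \<bar>R\<bar>)" using L by simp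
      also have "\<dots> \<le> ?S * (sqrt L * \<bar>R\<bar>)"
        unfolding L_def using i L
        by (intro mult_right_mono member_le_sum) (auto simp: L_def col_sq_nonneg)
      finally show ?thesis .
    qed
    then show ?thesis by (simp add: L_def g_def R_def)
  qed
  have Sn: "0 \<le> ?S" by (intro sum_nonneg) (auto simp: col_sq_nonneg)
  have "?S = (\<Sum>j<n. sqrt (col_sq A j) * \<bar>1 / col_sq A j\<bar>)"
  proof (rule sum.cong)
    fix j assume "j \<in> {..<n}"
    then have "0 < col_sq A j" using col_sq_pos by simp
    then show "1 / sqrt (col_sq A j) = sqrt (col_sq A j) * \<bar>1 / col_sq A j\<bar>"
      by (simp add: real_div_sqrt field_simps)
  qed simp
  also have "\<dots> \<le> sqrt (real n) * sqrt (\<Sum>j<n. col_sq A j * (1 / col_sq A j)\<^sup>2)"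
    by (rule sum_le_sqrt_card) (rule col_sq_nonneg)
  also have "(\<Sum>j<n. col_sq A j * (1 / col_sq A j)\<^sup>2) = (residual A (0\<^sub>v n))\<^sup>2"
    unfolding residual_zero_sq by (intro sum.cong) (auto simp: power2_eq_square dest: col_sq_pos)
  finally have S: "?S \<le> sqrt (real n) * residual A (0\<^sub>v n)"
    by (simp add: residual_nonneg)
  have Rs: "(\<Sum>i<n. sqrt (col_sq A i) * \<bar>res x i\<bar>) \<le> sqrt (real n) * residual A x"
    using sum_le_sqrt_card[of "col_sq A" "res x"] by (simp add: col_sq_nonneg residual_nonneg flip: residual_sq[OF xc])
  have "0 \<le> (\<Sum>r<m. (img xs r - img x r)\<^sup>2)" by (intro sum_nonneg) auto
  then have "nnls_obj A x - nnls_obj A xs \<le> - (\<Sum>i<n. grd x i * (xs $ i - x $ i))"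
    unfolding obj_expand[OF xc xsc] by linarith
  also have "\<dots> = (\<Sum>i<n. grd x i * (x $ i - xs $ i))"
    by (simp add: sum_negf[symmetric] algebra_simps)
  also have "\<dots> \<le> ?S * (\<Sum>i<n. sqrt (col_sq A i) * \<bar>res x i\<bar>)"
    unfolding sum_distrib_left by (intro sum_mono coord) auto
  also have "\<dots> \<le> (sqrt (real n) * residual A (0\<^sub>v n)) * (sqrt (real n) * residual A x)"
    using S Rs by (intro mult_mono) (auto intro!: mult_nonneg_nonneg sum_nonneg simp: residual_nonneg col_sq_nonneg)
  also have "\<dots> = real n * residual A x * residual A (0\<^sub>v n)"
  proof -
    have "(sqrt (real n) * a) * (sqrt (real n) * b) = (sqrt (real n) * sqrt (real n)) * b * a" for a b
      by (simp only: mult_ac)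
    then show ?thesis by simp
  qed
  finally show ?thesis .
qed

text \<open>Along \<open>t e\<^sub>0\<close> with \<open>t\<close> tending to infinity, the residual and the distance to the minimizers, which stay in
the box, differ from \<open>t\<close> times the norm of column \<open>0\<close> by bounded amounts only.\<close>

lemma error_bound_le_1:
  assumes mu: "error_bound_constant A \<mu>" and n: "0 < n"
  shows "\<mu> \<le> 1"
proof (rule ccontr)
  assume "\<not> \<mu> \<le> 1"
  then have mu1: "1 < \<mu>\<^sup>2" by (simp add: one_less_power)
  define L S where "L = col_sq A 0" and "S = (\<Sum>i<n. 1 / col_sq A i)"
  have L: "0 < L" using col_sq_pos[OF n] by (simp add: L_def)
  have *: "(\<mu>\<^sup>2 - 1) * (L * u\<^sup>2) \<le> S" if u: "0 \<le> u" for u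
  proof -
    \<comment> \<open>Coordinate \<open>0\<close> of a minimizer is at most \<open>1 / L\<close>, so \<open>x\<close> is at least \<open>u\<close> away from it there, while
      the residual of \<open>x\<close> in that coordinate is exactly \<open>u\<close>.\<close>
    define t where "t = u + 1 / L"
    define x where "x = t \<cdot>\<^sub>v unit_vec n 0"
    have t0: "0 \<le> t" using u L by (simp add: t_def)
    have xc: "x \<in> carrier_vec n" by (simp add: x_def)
    have xi: "x $ i = (if i = 0 then t else 0)" if "i < n" for i
      using that n by (simp add: x_def)
    obtain xs where xs: "is_arg_min (\<lambda>z. scaled_norm A (x - z)) (is_nnls_minimizer A) xs"
      using ex_nearest_minimizer[OF xc] ..
    then have "is_nnls_minimizer A xs" by (simp add: is_arg_min_def)
    then have xsb: "xs \<in> box A" by (rule minimizer_in_box)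
    have img: "img x r = A $$ (r, 0) * t" for r
    proof -
      have "img x r = (\<Sum>j<n. A $$ (r, j) * (if j = 0 then t else 0))"
        unfolding img_def by (intro sum.cong) (auto simp: xi)
      then show ?thesis using n by (simp add: if_distrib cong: if_cong)
    qed
    have g: "grd x i = t * (\<Sum>r<m. A $$ (r, i) * A $$ (r, 0)) - 1" for i
      by (simp add: grd_def img sum_distrib_left mult_ac)
    have R: "col_sq A i * (res x i)\<^sup>2 \<le> (if i = 0 then L * u\<^sup>2 else 0) + 1 / col_sq A i" if i: "i < n" for i
    proof (cases "i = 0")
      case True
      have "grd x 0 / L = u"
        using L by (simp add: g t_def L_def col_sq_eq[OF n, symmetric] power2_eq_square[symmetric] field_simps)
      then have "res x 0 = u"
        using n u L by (simp add: res_def xi t_def flip: L_def)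
      then show ?thesis using True L by (simp add: L_def)
    next
      case False
      have Li: "0 < col_sq A i" by (rule col_sq_pos[OF i])
      have "-1 \<le> grd x i"
        unfolding g using i n t0
        by (auto intro!: mult_nonneg_nonneg sum_nonneg entry_nonneg)
      then have "- (1 / col_sq A i) \<le> grd x i / col_sq A i"
        using Li by (simp add: field_simps)
      then have "\<bar>res x i\<bar> \<le> 1 / col_sq A i"
        using False i Li by (auto simp: res_def xi max_def)
      then have "(res x i)\<^sup>2 \<le> (1 / col_sq A i)\<^sup>2"
        by (metis abs_ge_zero power2_abs power_mono)
      then have "col_sq A i * (res x i)\<^sup>2 \<le> col_sq A i * (1 / col_sq A i)\<^sup>2"
        using Li by (intro mult_left_mono) auto
      then show ?thesis using Li False by (simp add: power2_eq_square)
    qed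
    have "(residual A x)\<^sup>2 \<le> (\<Sum>i<n. (if i = 0 then L * u\<^sup>2 else 0) + 1 / col_sq A i)"
      unfolding residual_sq[OF xc] by (intro sum_mono R) auto
    also have "\<dots> = L * u\<^sup>2 + S" using n by (simp add: sum.distrib S_def)
    finally have up: "(residual A x)\<^sup>2 \<le> L * u\<^sup>2 + S" .
    have "u \<le> t - xs $ 0" using xsb n by (auto simp: box_def t_def L_def)
    then have "L * u\<^sup>2 \<le> L * (t - xs $ 0)\<^sup>2"
      using u L by (intro mult_left_mono power_mono) auto
    also have "\<dots> \<le> (scaled_norm A (x - xs))\<^sup>2"
      unfolding scaled_norm_diff_sq[OF xc box_imp_carrier[OF xsb]]
      using member_le_sum[of 0 "{..<n}" "\<lambda>j. col_sq A j * (x $ j - xs $ j)\<^sup>2"] n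
      by (simp add: xi L_def col_sq_nonneg)
    finally have "\<mu>\<^sup>2 * (L * u\<^sup>2) \<le> (\<mu> * scaled_norm A (x - xs))\<^sup>2"
      by (simp add: power_mult_distrib mult_left_mono)
    also have "\<dots> \<le> (residual A x)\<^sup>2"
      using mu xs xc by (intro power_mono) (auto simp: error_bound_constant_def scaled_norm_nonneg)
    finally show ?thesis using up by (simp add: algebra_simps)
  qed
  have S: "0 \<le> S" unfolding S_def by (intro sum_nonneg) (auto simp: col_sq_nonneg)
  define c where "c = (\<mu>\<^sup>2 - 1) * L"
  have c: "0 < c" using mu1 L by (simp add: c_def)
  define u where "u = sqrt ((S + 1) / c)"
  have "0 \<le> u" "c * u\<^sup>2 = S + 1" using S c by (auto simp: u_def)
  moreover have "c * u\<^sup>2 \<le> S" using *[OF \<open>0 \<le> u\<close>] by (simp add: c_def mult.assoc)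
  ultimately show False by simp
qed

end

section \<open>Growth of the step sizes\<close>

text \<open>As rewrite rules these equations would unfold a step into ever smaller ones, several per level.\<close>

declare step.simps [simp del] step_sum.simps [simp del]

lemma step_1_sq: assumes "1 \<le> n" shows "real n ^ 3 * (step n 1)\<^sup>2 = 1 / 2"
proof -
  have "(real n powr (3 / 2))\<^sup>2 = real n ^ 3"
    using assms powr_realpow[of "real n" 3] by (simp add: power2_eq_square flip: powr_add)
  then show ?thesis
    using assms by (simp add: step.simps power_divide power_mult_distrib)
qed

lemma step_1_pos: "1 \<le> n \<Longrightarrow> 0 < step n 1"
  by (simp add: step.simps)

lemma step_1_le: assumes "4 \<le> n" shows "step n 1 \<le> 1 / 8"
proof (rule power2_le_imp_le)
  have n3: "(4::real) ^ 3 \<le> real n ^ 3" using assms by (intro power_mono) auto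
  have "64 * (step n 1)\<^sup>2 \<le> real n ^ 3 * (step n 1)\<^sup>2"
    using n3 by (intro mult_right_mono) auto
  then show "(step n 1)\<^sup>2 \<le> (1 / 8)\<^sup>2"
    using step_1_sq[of n] assms by (simp add: power2_eq_square)
qed simp

lemma step_1_ge: assumes "4 \<le> n" shows "1 / (real n)\<^sup>2 \<le> step n 1"
proof (rule power2_le_imp_le)
  have "(1 / (real n)\<^sup>2)\<^sup>2 * real n ^ 3 = 1 / real n"
    using assms by (simp add: power2_eq_square power3_eq_cube)
  also have "\<dots> \<le> 1 / 2" using assms by (simp add: field_simps)
  also have "\<dots> = (step n 1)\<^sup>2 * real n ^ 3" using step_1_sq[of n] assms by (simp add: mult.commute)
  finally show "(1 / (real n)\<^sup>2)\<^sup>2 \<le> (step n 1)\<^sup>2"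
    by (rule mult_right_le_imp_le) (use assms in simp)
  show "0 \<le> step n 1" using step_1_pos[of n] assms by linarith
qed

lemma step_sum_1: "step_sum n (Suc 0) = step n (Suc 0)"
  by (simp add: step_sum.simps)

text \<open>The recursion through the previous step, rewritten as one through the sum alone. While the first
alternative is active, \<open>A\<^sub>l = n a\<^sub>l\<close>, so that \<open>n a\<^sub>l / (n - 1) = A\<^sub>l / (n - 1)\<close>; it is
the smaller one exactly until \<open>sqrt A\<^sub>l\<close> reaches \<open>(n - 1) / (2 n)\<close>, and from then on the second
alternative stays active.\<close>

lemma step_Suc:
  assumes n: "4 \<le> n" and l: "1 \<le> l"
  shows "0 < step_sum n l \<and>
    step n (Suc l) = min (step_sum n l / (real n - 1)) (sqrt (step_sum n l) / (2 * real n))"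
  using l
proof (induction l rule: dec_induct)
  case base
  have "sqrt (step n 1) \<le> sqrt ((3 / 8)\<^sup>2)"
    using step_1_le[OF n] by (intro real_sqrt_le_mono) (simp add: power2_eq_square)
  then have s: "sqrt (step n 1) \<le> 3 / 8" by simp
  have p: "0 < step n 1" using step_1_pos[of n] n by linarith
  have "sqrt (step n 1) * (2 * real n) \<le> 3 / 8 * (2 * real n)"
    by (rule mult_right_mono[OF s]) simp
  also have "\<dots> \<le> real n - 1" using n by simp
  finally have "sqrt (step n 1) \<le> (real n - 1) / (2 * real n)"
    using n by (simp add: pos_le_divide_eq)
  then have "sqrt (step n 1) * sqrt (step n 1) \<le> sqrt (step n 1) * ((real n - 1) / (2 * real n))"
    by (rule mult_left_mono) (use p in simp)
  then have "step n 1 \<le> sqrt (step n 1) * ((real n - 1) / (2 * real n))"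
    using p by simp
  then have "step n 1 / (real n - 1) \<le> sqrt (step n 1) / (2 * real n)"
    using n by (simp add: field_simps)
  moreover have "step n (Suc (Suc 0)) = step n 1 / (real n - 1)"
    by (rule step.simps(3))
  ultimately show ?case
    using p by (simp add: step_sum_1 min_def)
next
  case (step l)
  define N s a where "N = real n" and "s = sqrt (step_sum n l)" and "a = step n (Suc l)"
  have N: "4 \<le> N" using n by (simp add: N_def)
  have s: "0 < s" "step_sum n l = s\<^sup>2" using step.IH by (auto simp: s_def)
  have a: "a = min (s\<^sup>2 / (N - 1)) (s / (2 * N))"
    using step.IH s by (simp add: a_def N_def)
  have apos: "0 < a" using s N by (simp add: a)
  define s' where "s' = sqrt (step_sum n (Suc l))"
  have S': "step_sum n (Suc l) = s\<^sup>2 + a" using s by (simp add: a_def step_sum.simps)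
  have s': "0 < s'" "s'\<^sup>2 = s\<^sup>2 + a" using apos s by (auto simp: s'_def S' add_pos_pos)
  obtain l' where l': "l = Suc l'" using step.hyps by (cases l) auto
  have rec: "step n (Suc (Suc l)) = min (N * a / (N - 1)) (s' / (2 * N))"
    by (simp add: l' N_def a_def s'_def step.simps)
  have "min (N * a / (N - 1)) (s' / (2 * N)) = min (s'\<^sup>2 / (N - 1)) (s' / (2 * N))"
  \<comment> \<open>The two alternatives for \<open>a\<close> coincide at this threshold.\<close>
  proof (cases "s \<le> (N - 1) / (2 * N)")
    case True
    then have "s * s \<le> s * ((N - 1) / (2 * N))" using s by (intro mult_left_mono) auto
    then have "s\<^sup>2 / (N - 1) \<le> s / (2 * N)" using N by (simp add: field_simps power2_eq_square)
    then have "a = s\<^sup>2 / (N - 1)" by (simp add: a)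
    then have "s'\<^sup>2 = N * a" using N s' by (simp add: field_simps)
    then show ?thesis by simp
  next
    case False
    then have sb: "(N - 1) / (2 * N) \<le> s" by simp
    then have "s * ((N - 1) / (2 * N)) \<le> s * s" using s by (intro mult_left_mono) auto
    then have "s / (2 * N) \<le> s\<^sup>2 / (N - 1)" using N by (simp add: field_simps power2_eq_square)
    then have aa: "a = s / (2 * N)" by (simp add: a)
    have "s' \<le> s + 1 / (4 * N)"
    proof (rule power2_le_imp_le)
      have "(s + 1 / (4 * N))\<^sup>2 = s\<^sup>2 + s / (2 * N) + (1 / (4 * N))\<^sup>2"
        using N by (simp add: power2_eq_square field_simps)
      then show "s'\<^sup>2 \<le> (s + 1 / (4 * N))\<^sup>2" using s' aa by simp
    qed (use s N in simp)
    then have "s' * (N - 1) \<le> (s + 1 / (4 * N)) * (N - 1)" using N by (intro mult_right_mono) auto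
    also have "\<dots> = s * N - (s - (N - 1) / (4 * N))" using N by (simp add: field_simps)
    also have "\<dots> \<le> s * N"
    proof -
      have "(N - 1) / (4 * N) \<le> (N - 1) / (2 * N)" using N by (simp add: field_simps)
      then show ?thesis using sb by linarith
    qed
    finally have "s' / (2 * N) \<le> N * a / (N - 1)" using N by (simp add: aa field_simps)
    moreover have "s \<le> s'" by (rule power2_le_imp_le) (use s' apos in auto)
    then have "s' * ((N - 1) / (2 * N)) \<le> s' * s'" using sb s' by (intro mult_left_mono) auto
    then have "s' / (2 * N) \<le> s'\<^sup>2 / (N - 1)" using N by (simp add: field_simps power2_eq_square)
    ultimately show ?thesis by simp
  qed
  then show ?case
    using rec s' S' by (simp add: N_def s'_def)
qed

lemma step_sum_pos: "4 \<le> n \<Longrightarrow> 1 \<le> l \<Longrightarrow> 0 < step_sum n l"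
  using step_Suc by blast

lemma step_pos: assumes "4 \<le> n" "1 \<le> l" shows "0 < step n l"
proof (cases "l = 1")
  case True then show ?thesis using assms step_1_pos[of n] by simp
next
  case False
  then obtain l' where "l = Suc l'" "1 \<le> l'" using assms by (cases l) auto
  then show ?thesis using step_Suc[OF assms(1), of l'] assms(1) by simp
qed

text \<open>This caps the steps so that extrapolation errors can be absorbed in \<open>extrapolation_row\<close>.\<close>

lemma step_sq_le:
  assumes "4 \<le> n" "1 \<le> l"
  shows "(real n)\<^sup>2 * (step n (Suc l))\<^sup>2 \<le> step_sum n l / 4"
proof -
  have "step n (Suc l) \<le> sqrt (step_sum n l) / (2 * real n)"
    using step_Suc[OF assms] by simp
  then have "real n * step n (Suc l) \<le> sqrt (step_sum n l) / 2"
    using assms by (simp add: field_simps)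
  then have "(real n * step n (Suc l))\<^sup>2 \<le> (sqrt (step_sum n l) / 2)\<^sup>2"
    using step_pos[OF assms(1), of "Suc l"] by (intro power_mono) auto
  then show ?thesis
    using step_sum_pos[OF assms] by (simp add: power_mult_distrib power_divide)
qed

lemma step_2: "4 \<le> n \<Longrightarrow> (real n - 1) * step n 2 = step n 1"
  by (simp add: numeral_2_eq_2 step.simps(3))

text \<open>This makes the output a convex combination of the iterates, see \<open>T_box\<close>.\<close>

lemma step_ratio:
  assumes "4 \<le> n" "2 \<le> l"
  shows "(real n - 1) * step n (Suc l) \<le> real n * step n l"
proof -
  obtain k where "l = Suc (Suc k)" using assms(2) by (metis Suc_le_D numeral_2_eq_2 Suc_le_mono)
  then have "step n (Suc l) \<le> real n * step n l / (real n - 1)" by (simp add: step.simps)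
  then show ?thesis using assms by (simp add: field_simps)
qed

text \<open>One inequality for both phases: growth by the factor \<open>1 + 1 / (2 n)\<close> below \<open>1 / 4\<close>, and by the
constant \<open>1 / (8 n)\<close> above.\<close>

lemma sqrt_step_sum_Suc:
  assumes n: "4 \<le> n" and l: "1 \<le> l"
  shows "sqrt (step_sum n l) + min (sqrt (step_sum n l)) (1 / 4) / (2 * real n) \<le> sqrt (step_sum n (Suc l))"
proof -
  define N s a where "N = real n" and "s = sqrt (step_sum n l)" and "a = step n (Suc l)"
  have N: "4 \<le> N" using n by (simp add: N_def)
  have s: "0 < s" "step_sum n l = s\<^sup>2" using step_Suc[OF n l] by (auto simp: s_def)
  have a: "a = min (s\<^sup>2 / (N - 1)) (s / (2 * N))"
    using step_Suc[OF n l] s by (simp add: a_def N_def)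
  have S': "step_sum n (Suc l) = s\<^sup>2 + a" using s by (simp add: a_def step_sum.simps)
  have "(s + min s (1 / 4) / (2 * N))\<^sup>2 \<le> s\<^sup>2 + a"
  proof (cases "s\<^sup>2 / (N - 1) \<le> s / (2 * N)")
    case True
    have "(s + min s (1 / 4) / (2 * N))\<^sup>2 \<le> (s + s / (2 * N))\<^sup>2"
      using s N by (intro power_mono add_left_mono divide_right_mono add_nonneg_nonneg divide_nonneg_pos) auto
    also have "\<dots> = s\<^sup>2 + s\<^sup>2 * (1 / N + 1 / (4 * N\<^sup>2))"
      using N by (simp add: power2_eq_square field_simps)
    also have "1 / N + 1 / (4 * N\<^sup>2) \<le> 1 / (N - 1)"
      using N by (simp add: power2_eq_square field_simps)
    finally show ?thesis using True by (simp add: a mult_left_mono)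
  next
    case False
    then have aa: "a = s / (2 * N)" by (simp add: a)
    have "s * (N - 1) < s * (2 * N * s)" using False N by (simp add: field_simps power2_eq_square)
    then have "N - 1 < 2 * (N * s)" using s by (simp add: mult.assoc)
    moreover have "3 / 4 * N \<le> N - 1" using N by simp
    ultimately have "N * (3 / 8) \<le> N * s" by linarith
    then have s38: "3 / 8 \<le> s" using N by simp
    have "(s + min s (1 / 4) / (2 * N))\<^sup>2 \<le> (s + 1 / 4 / (2 * N))\<^sup>2"
      using s N by (intro power_mono add_left_mono divide_right_mono add_nonneg_nonneg divide_nonneg_pos) auto
    also have "\<dots> = s\<^sup>2 + (s / 4 + 1 / (64 * N)) / N"
      using N by (simp add: power2_eq_square field_simps)
    also have "\<dots> \<le> s\<^sup>2 + (s / 2) / N"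
    proof -
      have "1 / (64 * N) \<le> 1 / 64" using N by (simp add: field_simps)
      then have "s / 4 + 1 / (64 * N) \<le> s / 2" using s38 by linarith
      then show ?thesis using N by (intro add_left_mono divide_right_mono) auto
    qed
    finally show ?thesis by (simp add: aa)
  qed
  then have "s + min s (1 / 4) / (2 * N) \<le> sqrt (s\<^sup>2 + a)"
    by (rule real_le_rsqrt)
  then show ?thesis by (simp add: S' s_def[symmetric] N_def)
qed

lemma sqrt_step_sum_exponential:
  assumes n: "4 \<le> n"
  shows "min (1 / 4) ((1 + 1 / (2 * real n)) ^ p / real n) \<le> sqrt (step_sum n (Suc p))"
proof (induction p)
  case 0
  have "1 / real n = sqrt (1 / (real n)\<^sup>2)" using n by (simp add: real_sqrt_divide)
  also have "\<dots> \<le> sqrt (step n 1)" using step_1_ge[OF n] by (rule real_sqrt_le_mono)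
  finally show ?case by (simp add: step_sum_1 min.coboundedI2)
next
  case (Suc p)
  define q s s' where "q = (1 + 1 / (2 * real n)) ^ p / real n" and "s = sqrt (step_sum n (Suc p))"
    and "s' = sqrt (step_sum n (Suc (Suc p)))"
  have g: "s + min s (1 / 4) / (2 * real n) \<le> s'"
    using sqrt_step_sum_Suc[OF n, of "Suc p"] by (simp add: s_def s'_def)
  have s: "0 < s" using step_sum_pos[OF n, of "Suc p"] by (simp add: s_def)
  have IH: "min (1 / 4) q \<le> s" using Suc by (simp add: q_def s_def)
  have "min (1 / 4) ((1 + 1 / (2 * real n)) * q) \<le> s'"
  proof (cases "s \<le> 1 / 4")
    case True
    then have "s * (1 + 1 / (2 * real n)) \<le> s'" using g by (simp add: algebra_simps)
    moreover have "s' \<ge> 1 / 4 \<or> q \<le> s"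
    proof -
      have "s \<le> s'" using g s by (smt (verit) divide_nonneg_nonneg of_nat_0_le_iff)
      then show ?thesis using IH by (auto simp: min_le_iff_disj)
    qed
    moreover have "(1 + 1 / (2 * real n)) * q \<le> (1 + 1 / (2 * real n)) * s" if "q \<le> s"
      using that by (intro mult_left_mono) auto
    ultimately show ?thesis by (auto simp: min_le_iff_disj mult.commute)
  next
    case False
    then have "1 / 4 \<le> s'" using g s by (smt (verit) divide_nonneg_nonneg of_nat_0_le_iff)
    then show ?thesis by simp
  qed
  then show ?case by (simp add: q_def s'_def)
qed

text \<open>The square root of the sum starts at no less than \<open>1 / n\<close>, passes \<open>1 / 4\<close> within \<open>4 n ln n\<close>
iterations, and gains \<open>1 / (8 n)\<close> in each later one.\<close>

lemma step_sum_quadratic: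
  assumes n: "4 \<le> n" and p: "4 * real n * ln (real n) \<le> real p"
  shows "(real k / (8 * real n))\<^sup>2 \<le> step_sum n (Suc p + k)"
proof -
  \<comment> \<open>As \<open>exp x \<le> 1 + 2 * x\<close>, the growth factor \<open>1 + 1 / (2 * n)\<close> is at least \<open>exp (1 / (4 * n))\<close>, and \<open>p\<close>
    iterations multiply \<open>1 / n\<close> by at least \<open>n\<close>.\<close>
  define x where "x = 1 / (4 * real n)"
  have x: "0 < x" "x \<le> 1" using n by (auto simp: x_def field_simps)
  have "exp x \<le> 1 + x + x\<^sup>2" using x by (intro exp_bound) auto
  also have "\<dots> \<le> 1 + 2 * x" using x by (simp add: power2_eq_square mult_left_le)
  finally have "exp x ^ p \<le> (1 + 2 * x) ^ p" by (intro power_mono) auto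
  moreover have "ln (real n) \<le> real p * x" using p n by (simp add: x_def field_simps)
  then have "exp (ln (real n)) \<le> exp (real p * x)" by simp
  then have "real n \<le> exp x ^ p" using n by (simp add: exp_of_nat_mult)
  ultimately have "real n \<le> (1 + 1 / (2 * real n)) ^ p" by (simp add: x_def)
  then have "1 \<le> (1 + 1 / (2 * real n)) ^ p / real n" using n by simp
  then have base: "1 / 4 \<le> sqrt (step_sum n (Suc p))"
    using sqrt_step_sum_exponential[OF n, of p] by linarith
  have "1 / 4 + real k / (8 * real n) \<le> sqrt (step_sum n (Suc p + k))"
  proof (induction k)
    case (Suc k)
    have "0 \<le> real k / (8 * real n)" by simp
    then have "min (sqrt (step_sum n (Suc p + k))) (1 / 4) = 1 / 4" using Suc by linarith
    then have "sqrt (step_sum n (Suc p + k)) + 1 / 4 / (2 * real n) \<le> sqrt (step_sum n (Suc p + Suc k))"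
      using sqrt_step_sum_Suc[OF n, of "Suc p + k"] by simp
    moreover have "real (Suc k) / (8 * real n) = real k / (8 * real n) + 1 / 4 / (2 * real n)"
      using n by (simp add: field_simps)
    ultimately show ?case using Suc by linarith
  qed (use base in simp)
  then have "real k / (8 * real n) \<le> sqrt (step_sum n (Suc p + k))" by linarith
  then have "(real k / (8 * real n))\<^sup>2 \<le> (sqrt (step_sum n (Suc p + k)))\<^sup>2"
    by (intro power_mono) auto
  then show ?thesis using step_sum_pos[OF n, of "Suc p + k"] by simp
qed

text \<open>Since \<open>D + k\<close> is at most twice the larger of \<open>D\<close> and \<open>k\<close>, each term is at most \<open>4 D\<^sup>2 / (D + k)\<^sup>2\<close>; this
is dominated by a telescoping sum.\<close>

lemma sum_min_inverse_square:
  fixes h :: "nat \<Rightarrow> real"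
  assumes D: "0 < D" and h1: "\<And>k. 1 \<le> k \<Longrightarrow> h k \<le> 1" and h2: "\<And>k. 1 \<le> k \<Longrightarrow> h k \<le> (D / real k)\<^sup>2"
  shows "(\<Sum>k=1..N. h k) \<le> 4 * D"
proof -
  have "(\<Sum>k=1..N. h k) \<le> 4 * D\<^sup>2 * (1 / D - 1 / (D + real N))"
  proof (induction N)
    case (Suc N)
    define k where "k = real (Suc N)"
    have k: "1 \<le> k" by (simp add: k_def)
    have "h (Suc N) \<le> 4 * D\<^sup>2 / (D + k)\<^sup>2"
    proof (cases "k \<le> D")
      case True
      have "(D + k)\<^sup>2 \<le> (2 * D)\<^sup>2" using True D k by (intro power_mono) auto
      then have "1 \<le> 4 * D\<^sup>2 / (D + k)\<^sup>2" using D k by (simp add: field_simps)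
      then show ?thesis using h1[of "Suc N"] by simp
    next
      case False
      have "(D + k)\<^sup>2 \<le> (2 * k)\<^sup>2" using False D k by (intro power_mono) auto
      then have "D\<^sup>2 * (D + k)\<^sup>2 \<le> D\<^sup>2 * (4 * k\<^sup>2)" by (intro mult_left_mono) auto
      then have "(D / k)\<^sup>2 \<le> 4 * D\<^sup>2 / (D + k)\<^sup>2" using D k by (simp add: field_simps)
      then show ?thesis using h2[of "Suc N"] by (simp add: k_def)
    qed
    also have "\<dots> = 4 * D\<^sup>2 * (1 / (D + k)\<^sup>2)" by simp
    also have "\<dots> \<le> 4 * D\<^sup>2 * (1 / ((D + k - 1) * (D + k)))"
    proof -
      have "(D + k - 1) * (D + k) \<le> (D + k)\<^sup>2" using D k by (simp add: power2_eq_square mult_right_mono)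
      then show ?thesis using D k by (intro mult_left_mono divide_left_mono) auto
    qed
    also have "1 / ((D + k - 1) * (D + k)) = 1 / (D + k - 1) - 1 / (D + k)"
      using D k by (simp add: field_simps)
    finally show ?case using Suc by (simp add: k_def algebra_simps)
  qed simp
  also have "\<dots> \<le> 4 * D\<^sup>2 * (1 / D)" using D by (intro mult_left_mono) auto
  finally show ?thesis using D by (simp add: power2_eq_square)
qed

lemma ln_ge_1: assumes "4 \<le> n" shows "1 \<le> ln (real n)"
proof -
  have "exp 1 \<le> (3::real)" by (rule exp_le)
  then have "exp 1 \<le> real n" using assms by simp
  then have "ln (exp 1) \<le> ln (real n)" using assms by (subst ln_le_cancel_iff) auto
  then show ?thesis by simp
qed

text \<open>With \<open>h l\<close> the probability that a run is still going after iteration \<open>l\<close>, this bounds the expected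
number of iterations: the exponential phase is charged in full, the quadratic phase by
\<open>sum_min_inverse_square\<close>.\<close>

lemma sum_tail_bound:
  fixes h :: "nat \<Rightarrow> real"
  assumes n: "4 \<le> n" and mu: "0 < \<mu>"
    and h0: "\<And>l. 1 \<le> l \<Longrightarrow> 0 \<le> h l" and h1: "\<And>l. 1 \<le> l \<Longrightarrow> h l \<le> 1"
    and h2: "\<And>l. 1 \<le> l \<Longrightarrow> h l \<le> 4 * real n / (\<mu>\<^sup>2 * step_sum n l)"
  shows "(\<Sum>l=1..N. h l) \<le> 6 * real n * ln (real n) + 64 * real n * sqrt (real n) / \<mu>"
proof -
  \<comment> \<open>\<open>D\<close> is such that \<open>4 * n / (\<mu>\<^sup>2 * S) = (D / k)\<^sup>2\<close> for \<open>S = (k / (8 * n))\<^sup>2\<close>, the bound on the sum in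
    iteration \<open>p + 1 + k\<close>.\<close>
  define D p where "D = 16 * (real n * sqrt (real n)) / \<mu>" and "p = nat \<lceil>4 * real n * ln (real n)\<rceil>"
  have ln1: "1 \<le> ln (real n)" by (rule ln_ge_1[OF n])
  have p: "4 * real n * ln (real n) \<le> real p" "real p \<le> 4 * real n * ln (real n) + 1"
    using ln1 unfolding p_def by (auto simp: of_nat_nat)
  have D: "0 < D" using n mu by (simp add: D_def)
  have tail: "h (Suc p + k) \<le> (D / real k)\<^sup>2" if k: "1 \<le> k" for k
  proof -
    have "4 * real n / (\<mu>\<^sup>2 * step_sum n (Suc p + k)) \<le> 4 * real n / (\<mu>\<^sup>2 * (real k / (8 * real n))\<^sup>2)"
      using step_sum_quadratic[OF n p(1), of k] mu k n step_sum_pos[OF n, of "Suc p + k"]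
      by (intro divide_left_mono mult_left_mono mult_pos_pos) auto
    also have "\<dots> = (D / real k)\<^sup>2"
      using mu k n by (simp add: D_def power_mult_distrib power_divide power2_eq_square field_simps)
    finally show ?thesis using h2[of "Suc p + k"] by simp
  qed
  have "(\<Sum>l=1..N. h l) \<le> (\<Sum>l=1..Suc p + N. h l)"
    using h0 by (intro sum_mono2) auto
  also have "\<dots> = (\<Sum>l=1..Suc p. h l) + (\<Sum>l=Suc p + 1..Suc p + N. h l)"
    by (rule sum.ub_add_nat) simp
  also have "(\<Sum>l=Suc p + 1..Suc p + N. h l) = (\<Sum>k=1..N. h (Suc p + k))"
    using sum.shift_bounds_cl_nat_ivl[of h 1 "Suc p" N] by (simp add: add.commute)
  also have "\<dots> \<le> 4 * D" by (rule sum_min_inverse_square[OF D]) (use h1 tail in auto)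
  also have "(\<Sum>l=1..Suc p. h l) \<le> (\<Sum>l=1..Suc p. 1)" by (intro sum_mono h1) auto
  also have "(\<Sum>l=1..Suc p. 1::real) = real p + 1" by simp
  finally have "(\<Sum>l=1..N. h l) \<le> real p + 1 + 4 * D" by simp
  moreover have "2 \<le> 2 * real n * ln (real n)"
  proof -
    have "1 * 1 \<le> real n * ln (real n)" using n ln1 by (intro mult_mono) auto
    then show ?thesis by simp
  qed
  ultimately show ?thesis using p(2) by (simp add: D_def algebra_simps)
qed

section \<open>Telescoping of the extrapolated dual sequence\<close>

lemma young: fixes c W x e :: real
  assumes "c\<^sup>2 \<le> W" shows "c * x * e \<le> W * x\<^sup>2 + e\<^sup>2 / 4"
proof -
  have "0 \<le> (c * x - e / 2)\<^sup>2" by simp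
  then have "c * x * e \<le> c\<^sup>2 * x\<^sup>2 + e\<^sup>2 / 4" by (simp add: power2_eq_square algebra_simps)
  also have "c\<^sup>2 * x\<^sup>2 \<le> W * x\<^sup>2" using assms by (intro mult_right_mono) auto
  finally show ?thesis by simp
qed

lemma sum_split_first: "1 \<le> l \<Longrightarrow> (\<Sum>i=1..l. f i) = f 1 + (\<Sum>i=2..l. f i :: real)" for l :: nat
  by (subst sum.atLeast_Suc_atMost) (auto simp: numeral_2_eq_2)

text \<open>Expansion of one summand of \<open>extrapolation_row\<close>. The hypothesis says that \<open>y'\<close> is the average of
\<open>y\<close> and \<open>w\<close> with weights \<open>S\<close> and \<open>b\<close>.\<close>

lemma extrapolation_identity:
  fixes S b w y y' a d ys :: real
  assumes "S * (y' - y) = b * (w - y')"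
  shows "(b * y + a * d) * (w - ys) - (S + b) / 2 * y'\<^sup>2 + (S + b) / 2 * ys\<^sup>2
      + S / 2 * y\<^sup>2 - S / 2 * ys\<^sup>2
    = b / 2 * (y' - ys)\<^sup>2 + S / 2 * (y' - y)\<^sup>2 - b * (y' - y) * (w - ys) + a * d * (w - ys)"
proof -
  have "2 * ((b * y + a * d) * (w - ys)) - (S + b) * y'\<^sup>2 + (S + b) * ys\<^sup>2 + S * y\<^sup>2 - S * ys\<^sup>2
    = b * (y' - ys)\<^sup>2 + S * (y' - y)\<^sup>2 - 2 * (b * (y' - y) * (w - ys)) + 2 * (a * d * (w - ys))"
  proof -
    have "2 * ((b * y + a * d) * (w - ys)) - (S + b) * y'\<^sup>2 + (S + b) * ys\<^sup>2 + S * y\<^sup>2 - S * ys\<^sup>2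
      - (b * (y' - ys)\<^sup>2 + S * (y' - y)\<^sup>2 - 2 * (b * (y' - y) * (w - ys)) + 2 * (a * d * (w - ys)))
      = 2 * y' * (b * (w - y') - S * (y' - y))"
      by (simp add: power2_eq_square algebra_simps)
    then show ?thesis using assms by simp
  qed
  then show ?thesis by linarith
qed

text \<open>This concerns one row of \<open>A\<close>: \<open>y\<close> and \<open>yb\<close> are the dual points and their extrapolations, \<open>u i\<close> is the image
of the primal iterate \<open>x\<^sub>i\<close>, \<open>w i\<close> that of \<open>N x\<^sub>i - (N - 1) x\<^bsub>i-1\<^esub>\<close>, and \<open>ys\<close> that of the point
compared with. Because of the extrapolation, the terms \<open>a i * (y i - y (i - 1)) * (u i - ys)\<close> telescope.
What remains are products of a dual increment with an increment of \<open>u\<close>; Young's inequality splits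
each of them between \<open>(u i - u (i - 1))\<^sup>2 / 4\<close> and a part of \<open>S (i - 1) / 2 * (y i - y (i - 1))\<^sup>2\<close>, the gain
from strong concavity in \<open>y\<close>. Every dual increment occurs in two products. \<open>W l\<close> is the half of its
gain that is still unspent after step \<open>l\<close>. The first increment comes without a gain, as \<open>S 0 = 0\<close>, so
its share is borrowed and reappears as the subtracted term with \<open>(y 1 - y 0)\<^sup>2\<close>.\<close>

lemma extrapolation_row:
  fixes a S y yb w u :: "nat \<Rightarrow> real" and N ys :: real
  assumes S0: "S 0 = 0" and SS: "\<And>i. S (Suc i) = S i + a (Suc i)"
    and apos: "\<And>i. 1 \<le> i \<Longrightarrow> 0 < a i"
    and yb0: "yb 0 = y 0"
    and yb: "\<And>i. 1 \<le> i \<Longrightarrow> yb i = y i + a i / a (Suc i) * (y i - y (i - 1))"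
    and Sy: "\<And>i. S (Suc i) * y (Suc i) = S i * y i + a (Suc i) * w (Suc i)"
    and w1: "w 1 = u 1" and w: "\<And>i. 2 \<le> i \<Longrightarrow> w i = N * u i - (N - 1) * u (i - 1)"
    and N: "1 \<le> N" and step_le: "\<And>i. 1 \<le> i \<Longrightarrow> N\<^sup>2 * (a (Suc i))\<^sup>2 \<le> S i / 4"
    and W1: "W 1 = N\<^sup>2 * (a 1)\<^sup>2" and W: "\<And>i. 1 \<le> i \<Longrightarrow> W (Suc i) = S i / 4"
    and l: "1 \<le> l"
  shows "W l * (y l - y (l - 1))\<^sup>2 - a l * (y l - y (l - 1)) * (u l - ys)
      - N\<^sup>2 * (a 1)\<^sup>2 * (y 1 - y 0)\<^sup>2 - (\<Sum>i=2..l. (u i - u (i - 1))\<^sup>2) / 2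
    \<le> (\<Sum>i=1..l. a i * (yb (i - 1) * (w i - ys))) - S l / 2 * (y l)\<^sup>2 + S l / 2 * ys\<^sup>2"
  using l
proof (induction l rule: dec_induct)
  case base
  have S1: "S 1 = a 1" using SS[of 0] S0 by simp
  have y1: "y 1 = u 1" using Sy[of 0] S0 S1 apos[of 1] w1 by simp
  have "0 \<le> a 1 * (y 1 - ys)\<^sup>2 / 2" using apos[of 1] by simp
  then show ?case
    using S1 y1 w1 yb0 W1 by (simp add: power2_eq_square algebra_simps)
next
  case (step l)
  define d d' e where "d = y l - y (l - 1)" and "d' = y (Suc l) - y l" and "e = u (Suc l) - u l"
  have a: "0 < a l" "0 < a (Suc l)" using apos[of l] apos[of "Suc l"] step.hyps by auto
  have ybl: "a (Suc l) * yb l = a (Suc l) * y l + a l * d"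
    using yb[of l] a step.hyps by (simp add: d_def field_simps)
  have wl: "w (Suc l) = u (Suc l) + (N - 1) * e" "w (Suc l) = u l + N * e"
    using w[of "Suc l"] step.hyps by (auto simp: e_def algebra_simps)
  have Sd: "S l * d' = a (Suc l) * (w (Suc l) - y (Suc l))"
    using Sy[of l] SS[of l] by (simp add: d'_def algebra_simps)
  then have Sd: "S l * (y (Suc l) - y l) = a (Suc l) * (w (Suc l) - y (Suc l))"
    by (simp add: d'_def)
  have id: "a (Suc l) * (yb l * (w (Suc l) - ys)) - S (Suc l) / 2 * (y (Suc l))\<^sup>2 + S (Suc l) / 2 * ys\<^sup>2
      + S l / 2 * (y l)\<^sup>2 - S l / 2 * ys\<^sup>2
    = a (Suc l) / 2 * (y (Suc l) - ys)\<^sup>2 + S l / 2 * d'\<^sup>2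
      - a (Suc l) * d' * (w (Suc l) - ys) + a l * d * (w (Suc l) - ys)"
    using extrapolation_identity[OF Sd, of "a l" d ys]
    unfolding SS d'_def[symmetric] ybl[symmetric] by (simp add: mult.assoc)
  have W_ge: "N\<^sup>2 * (a l)\<^sup>2 \<le> W l"
    
  proof (cases "l = 1")
    case False
    then obtain k where "l = Suc k" "1 \<le> k" using step.hyps by (cases l) auto
    then show ?thesis using W[of k] step_le[of k] by simp
  qed (use W1 in simp)
  have Y1: "N * a l * d * (- e) \<le> W l * d\<^sup>2 + (- e)\<^sup>2 / 4"
    using W_ge by (rule young[OF ord_eq_le_trans, rotated]) (simp add: power_mult_distrib)
  then have Y1': "- (N * a l * d * e) \<le> W l * d\<^sup>2 + e\<^sup>2 / 4" by simp
  have "((N - 1) * a (Suc l))\<^sup>2 \<le> (N * a (Suc l))\<^sup>2"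
    using N a by (intro power_mono mult_right_mono) auto
  also have "\<dots> \<le> S l / 4" using step_le[of l] step.hyps by (simp add: power_mult_distrib)
  finally have Y2: "(N - 1) * a (Suc l) * d' * e \<le> S l / 4 * d'\<^sup>2 + e\<^sup>2 / 4"
    by (rule young)
  have sq: "0 \<le> a (Suc l) / 2 * (y (Suc l) - ys)\<^sup>2" using a by simp
  have c1: "a (Suc l) * d' * (w (Suc l) - ys) = a (Suc l) * d' * (u (Suc l) - ys) + (N - 1) * a (Suc l) * d' * e"
    unfolding wl(1) by (simp add: algebra_simps)
  have c2: "a l * d * (w (Suc l) - ys) = a l * d * (u l - ys) + N * a l * d * e"
    unfolding wl(2) by (simp add: algebra_simps)
  have sum1: "(\<Sum>i=2..Suc l. (u i - u (i - 1))\<^sup>2) = (\<Sum>i=2..l. (u i - u (i - 1))\<^sup>2) + e\<^sup>2"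
    using step.hyps by (simp add: e_def)
  have sum2: "(\<Sum>i=1..Suc l. a i * (yb (i - 1) * (w i - ys))) =
      (\<Sum>i=1..l. a i * (yb (i - 1) * (w i - ys))) + a (Suc l) * (yb l * (w (Suc l) - ys))"
    by simp
  have Wl: "W (Suc l) * d'\<^sup>2 = S l / 4 * d'\<^sup>2" using W[of l] step.hyps by simp
  have half: "S l / 2 * d'\<^sup>2 = 2 * (S l / 4 * d'\<^sup>2)" by simp
  have dd: "y (Suc l) - y (Suc l - 1) = d'" by (simp add: d'_def)
  have combine: "P' - q' - C - (s + E) / 2 \<le> L + t - v + z"
    if "P - q - C - s / 2 \<le> L - y1 + y2" "t - v + z + y1 - y2 = o1 + h - r1 + r2"
      "- k \<le> P + E / 4" "k' \<le> g + E / 4" "0 \<le> o1" "r1 = q' + k'" "r2 = q + k" "P' = g" "h = 2 * g"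
    for P P' q q' C s E L t v z y1 y2 o1 h r1 r2 k k' g :: real
    using that by argo
  show ?case
    unfolding sum1 sum2 dd
    by (rule combine[OF step.IH[folded d_def] id Y1' Y2 sq c1 c2 Wl half])
qed

section \<open>Pathwise analysis of one run\<close>

text \<open>The three-point inequality for a quadratic on an interval: the minimizer \<open>q\<close> is the projection of the
free minimizer, and strong convexity yields the extra term.\<close>

lemma clamp_prox:
  fixes L C p t u :: real
  assumes L: "0 < L" and t: "0 \<le> t" "t \<le> u"
  defines "q \<equiv> max 0 (min u (p - C / L))"
  shows "C * q + L / 2 * (q - p)\<^sup>2 + L / 2 * (t - q)\<^sup>2 \<le> C * t + L / 2 * (t - p)\<^sup>2"
proof -
  have "0 \<le> (t - q) * (q - (p - C / L))"
  proof (cases "q = p - C / L")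
    case False
    then have "(q = 0 \<and> p - C / L \<le> q) \<or> (q = u \<and> q \<le> p - C / L)"
      unfolding q_def using t by (auto simp: max_def min_def split: if_splits)
    then show ?thesis using t by (auto intro: mult_nonneg_nonneg mult_nonpos_nonpos)
  qed simp
  then have "0 \<le> L * ((t - q) * (q - (p - C / L)))" using L by simp
  also have "\<dots> = (t - q) * (L * (q - p) + C)" using L by (simp add: field_simps)
  finally show ?thesis by (simp add: power2_eq_square algebra_simps add_divide_distrib diff_divide_distrib)
qed

text \<open>The gradient at the extrapolated dual point \<open>i\<close>, whose coefficients enter the linear model in
iteration \<open>i + 1\<close>.\<close>

definition si_slope :: "real mat \<Rightarrow> real vec \<Rightarrow> (nat \<Rightarrow> nat) \<Rightarrow> nat \<Rightarrow> nat \<Rightarrow> real" where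
  "si_slope A x0 j i c = (transpose_mat A *\<^sub>v si_ybar A x0 j i - ones_vec (dim_col A)) $ c"

text \<open>The sampled linear term of iteration \<open>i\<close>, scaled by \<open>n\<close>, minus its average over the sampled coordinate,
both evaluated at the displacement \<open>z - x\<^bsub>i-1\<^esub>\<close>. That displacement and the slope do not depend on \<open>j i\<close>.\<close>

definition si_noise :: "real mat \<Rightarrow> real vec \<Rightarrow> (nat \<Rightarrow> nat) \<Rightarrow> nat \<Rightarrow> real vec \<Rightarrow> real" where
  "si_noise A x0 j i z =
     real (dim_col A) * (si_slope A x0 j (i - 1) (j i) * (z $ j i - si_x A x0 j (i - 1) $ j i))
     - (\<Sum>c<dim_col A. si_slope A x0 j (i - 1) c * (z $ c - si_x A x0 j (i - 1) $ c))"

context nnls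
begin

definition dist_sq :: "real vec \<Rightarrow> real vec \<Rightarrow> real" where
  "dist_sq z x = (\<Sum>c<n. col_sq A c * (z $ c - x $ c)\<^sup>2) / 2"

lemma dist_sq_nonneg: "0 \<le> dist_sq z x"
  by (auto simp: dist_sq_def intro!: sum_nonneg mult_nonneg_nonneg col_sq_nonneg)

end

locale nnls_run = nnls +
  fixes x0 :: "real vec" and j :: "nat \<Rightarrow> nat"
  assumes n4: "4 \<le> n" and x0_box: "x0 \<in> box A" and j_less: "\<And>i. j i < n"
begin

abbreviation "X \<equiv> si_x A x0 j"
abbreviation "Y \<equiv> si_y A x0 j"
abbreviation "Yb \<equiv> si_ybar A x0 j"
abbreviation "T \<equiv> si_out A x0 j"
abbreviation "a \<equiv> step n"
abbreviation "S \<equiv> step_sum n"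

abbreviation "G \<equiv> si_slope A x0 j"
abbreviation "noise \<equiv> si_noise A x0 j"

lemma G_def: "G i c = (transpose_mat A *\<^sub>v Yb i - ones_vec n) $ c"
  by (simp add: si_slope_def)

lemma noise_def: "noise i z = real n * (G (i - 1) (j i) * (z $ j i - X (i - 1) $ j i))
     - (\<Sum>c<n. G (i - 1) c * (z $ c - X (i - 1) $ c))"
  by (simp add: si_noise_def)

text \<open>The function that \<open>X l\<close> minimizes over the box is \<open>estimate l\<close>. It is separable, and \<open>lin_coeff l c\<close> is its
linear coefficient in coordinate \<open>c\<close>.\<close>

definition lin_coeff :: "nat \<Rightarrow> nat \<Rightarrow> real" where
  "lin_coeff l c = a 1 * G 0 c + (\<Sum>i=2..l. if j i = c then real n * a i * G (i - 1) c else 0)"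

definition estimate :: "nat \<Rightarrow> real vec \<Rightarrow> real" where
  "estimate l x = (\<Sum>c<n. lin_coeff l c * x $ c) + dist_sq x x0"

lemma X_objective:
  assumes x: "x \<in> box A"
  shows "a 1 * ((transpose_mat A *\<^sub>v Yb 0 - ones_vec n) \<bullet> x)
      + (\<Sum>i = 2..l. real n * a i * ((transpose_mat A *\<^sub>v Yb (i - 1) - ones_vec n)
                   \<bullet> ((x $ j i) \<cdot>\<^sub>v unit_vec n (j i))))
      + 1 / 2 * (scaled_norm A (x - x0))\<^sup>2 = estimate l x"
proof -
  have xc: "x \<in> carrier_vec n" and x0c: "x0 \<in> carrier_vec n"
    using x x0_box by (auto simp: box_def)
  have gc: "transpose_mat A *\<^sub>v Yb i - ones_vec n \<in> carrier_vec n" for i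
    by (intro carrier_vecI) (simp add: ones_vec_def)
  have 1: "(transpose_mat A *\<^sub>v Yb 0 - ones_vec n) \<bullet> x = (\<Sum>c<n. G 0 c * x $ c)"
    using xc by (simp add: scalar_prod_def G_def atLeast0LessThan)
  have 2: "(transpose_mat A *\<^sub>v Yb i - ones_vec n) \<bullet> ((x $ j k) \<cdot>\<^sub>v unit_vec n (j k)) = x $ j k * G i (j k)" for i k
    unfolding G_def scalar_prod_smult_distrib[OF gc unit_vec_carrier]
    using j_less by (subst scalar_prod_right_unit) auto
  have 3: "(\<Sum>i = 2..l. real n * a i * (x $ j i * G (i - 1) (j i)))
    = (\<Sum>c<n. (\<Sum>i=2..l. if j i = c then real n * a i * G (i - 1) c else 0) * x $ c)"
  proof -
    have "(\<Sum>i = 2..l. real n * a i * (x $ j i * G (i - 1) (j i)))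
      = (\<Sum>i = 2..l. \<Sum>c<n. (if j i = c then real n * a i * G (i - 1) c * x $ c else 0))"
      using j_less by (intro sum.cong) (auto simp: mult_ac)
    also have "\<dots> = (\<Sum>c<n. \<Sum>i = 2..l. (if j i = c then real n * a i * G (i - 1) c * x $ c else 0))"
      by (rule sum.swap)
    also have "\<dots> = (\<Sum>c<n. (\<Sum>i=2..l. if j i = c then real n * a i * G (i - 1) c else 0) * x $ c)"
      unfolding sum_distrib_right by (intro sum.cong) auto
    finally show ?thesis .
  qed
  show ?thesis
    unfolding 1 2 3 estimate_def lin_coeff_def dist_sq_def scaled_norm_diff_sq[OF xc x0c]
    by (simp add: distrib_left sum.distrib sum_distrib_left mult_ac flip: sum_divide_distrib)
qed

definition clamped :: "nat \<Rightarrow> real vec" where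
  "clamped l = Matrix.vec n (\<lambda>c. max 0 (min (1 / col_sq A c) (x0 $ c - lin_coeff l c / col_sq A c)))"

lemma clamped_box: "clamped l \<in> box A"
  using col_sq_nonneg by (auto simp: clamped_def box_def)

text \<open>Summing \<open>clamp_prox\<close> over the coordinates gives minimality and strong convexity at once.\<close>

lemma estimate_clamped:
  assumes z: "z \<in> box A"
  shows "estimate l (clamped l) + dist_sq z (clamped l) \<le> estimate l z"
proof -
  have "lin_coeff l c * clamped l $ c + col_sq A c / 2 * (clamped l $ c - x0 $ c)\<^sup>2 + col_sq A c / 2 * (z $ c - clamped l $ c)\<^sup>2
     \<le> lin_coeff l c * z $ c + col_sq A c / 2 * (z $ c - x0 $ c)\<^sup>2" if c: "c < n" for c
    using clamp_prox[OF col_sq_pos[OF c], of "z $ c" "1 / col_sq A c" "lin_coeff l c" "x0 $ c"] z c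
    by (simp add: clamped_def box_def)
  then have "(\<Sum>c<n. lin_coeff l c * clamped l $ c + col_sq A c / 2 * (clamped l $ c - x0 $ c)\<^sup>2 + col_sq A c / 2 * (z $ c - clamped l $ c)\<^sup>2)
    \<le> (\<Sum>c<n. lin_coeff l c * z $ c + col_sq A c / 2 * (z $ c - x0 $ c)\<^sup>2)"
    by (intro sum_mono) auto
  then show ?thesis
    by (simp add: estimate_def dist_sq_def sum.distrib sum_divide_distrib)
qed

lemma X_0: "X 0 = x0"
  by (subst si_x.simps) simp

lemma X_clamped: assumes l: "1 \<le> l" shows "X l = clamped l"
proof -
  let ?f = "\<lambda>x. a 1 * ((transpose_mat A *\<^sub>v Yb 0 - ones_vec n) \<bullet> x)
      + (\<Sum>i = 2..l. real n * a i * ((transpose_mat A *\<^sub>v Yb (i - 1) - ones_vec n)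
                   \<bullet> ((x $ j i) \<cdot>\<^sub>v unit_vec n (j i))))
      + 1 / 2 * (scaled_norm A (x - x0))\<^sup>2"
  have min: "is_arg_min ?f (\<lambda>x. x \<in> box A) x \<longleftrightarrow> x = clamped l" for x
  proof
    assume x: "is_arg_min ?f (\<lambda>x. x \<in> box A) x"
    then have xb: "x \<in> box A" by (simp add: is_arg_min_def)
    have "?f x \<le> ?f (clamped l)" using x clamped_box by (simp add: is_arg_min_linorder)
    then have "estimate l x \<le> estimate l (clamped l)"
      by (simp only: X_objective[OF xb] X_objective[OF clamped_box])
    then have "dist_sq x (clamped l) \<le> 0" using estimate_clamped[OF xb, of l] by linarith
    then have "(\<Sum>c<n. col_sq A c * (x $ c - clamped l $ c)\<^sup>2) = 0"
      using dist_sq_nonneg[of x "clamped l"] by (simp add: dist_sq_def)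
    then have "\<forall>c\<in>{..<n}. col_sq A c * (x $ c - clamped l $ c)\<^sup>2 = 0"
      by (subst (asm) sum_nonneg_eq_0_iff) (auto intro!: mult_nonneg_nonneg col_sq_nonneg)
    then have "x $ c = clamped l $ c" if "c < n" for c
    proof -
      have "col_sq A c * (x $ c - clamped l $ c)\<^sup>2 = 0"
        using \<open>\<forall>c\<in>{..<n}. _\<close> that by blast
      then show ?thesis using col_sq_pos[OF that] by simp
    qed
    then show "x = clamped l"
      using xb by (intro eq_vecI) (auto simp: box_def clamped_def)
  next
    assume "x = clamped l"
    moreover have "?f (clamped l) \<le> ?f y" if y: "y \<in> box A" for y
    proof -
      have "estimate l (clamped l) \<le> estimate l y"
        using estimate_clamped[OF y, of l] dist_sq_nonneg[of y "clamped l"] by linarith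
      then show ?thesis by (simp only: X_objective[OF y] X_objective[OF clamped_box])
    qed
    ultimately show "is_arg_min ?f (\<lambda>x. x \<in> box A) x"
      using clamped_box by (simp add: is_arg_min_linorder)
  qed
  have "X l = arg_min ?f (\<lambda>x. x \<in> box A)"
    using l by (subst si_x.simps) (simp add: Let_def)
  also have "\<dots> = clamped l" unfolding arg_min_def min by simp
  finally show ?thesis .
qed

lemma X_box: "X l \<in> box A"
  by (cases l) (use x0_box clamped_box in \<open>auto simp: X_0 X_clamped\<close>)

lemma X_carrier: "X l \<in> carrier_vec n"
  by (rule box_imp_carrier[OF X_box])

lemma lin_coeff_Suc: "1 \<le> l \<Longrightarrow>
  lin_coeff (Suc l) c = lin_coeff l c + (if j (Suc l) = c then real n * a (Suc l) * G l c else 0)"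
  by (simp add: lin_coeff_def)

lemma X_Suc_other: "1 \<le> l \<Longrightarrow> c < n \<Longrightarrow> c \<noteq> j (Suc l) \<Longrightarrow> X (Suc l) $ c = X l $ c"
  by (simp add: X_clamped clamped_def lin_coeff_Suc)

lemma estimate_Suc:
  assumes "1 \<le> l"
  shows "estimate (Suc l) x = estimate l x + real n * a (Suc l) * (G l (j (Suc l)) * x $ j (Suc l))"
proof -
  have "(\<Sum>c<n. lin_coeff (Suc l) c * x $ c) = (\<Sum>c<n. lin_coeff l c * x $ c + (if j (Suc l) = c then real n * a (Suc l) * G l c * x $ c else 0))"
    using assms by (intro sum.cong) (auto simp: lin_coeff_Suc distrib_right)
  also have "\<dots> = (\<Sum>c<n. lin_coeff l c * x $ c) + real n * a (Suc l) * G l (j (Suc l)) * x $ j (Suc l)"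
    using j_less by (simp add: sum.distrib)
  finally show ?thesis by (simp add: estimate_def mult.assoc)
qed

lemma estimate_X_lower:
  assumes "1 \<le> l"
  shows "a 1 * (\<Sum>c<n. G 0 c * X 1 $ c) + dist_sq (X 1) x0
    + (\<Sum>i=2..l. dist_sq (X i) (X (i - 1)) + real n * a i * (G (i - 1) (j i) * X i $ j i)) \<le> estimate l (X l)"
  using assms
proof (induction l rule: dec_induct)
  case base
  show ?case by (simp add: estimate_def lin_coeff_def sum_distrib_left mult.assoc)
next
  case (step l)
  have "estimate l (X l) + dist_sq (X (Suc l)) (X l) \<le> estimate l (X (Suc l))"
    using estimate_clamped[OF X_box, of l "Suc l"] step.hyps by (simp add: X_clamped)
  then show ?case using step by (simp add: estimate_Suc)
qed

lemma estimate_eq: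
  assumes "1 \<le> l"
  shows "estimate l z = a 1 * (\<Sum>c<n. G 0 c * z $ c) + dist_sq z x0
    + (\<Sum>i=2..l. real n * a i * (G (i - 1) (j i) * z $ j i))"
  using assms
proof (induction l rule: dec_induct)
  case base
  show ?case by (simp add: estimate_def lin_coeff_def sum_distrib_left mult.assoc)
next
  case (step l)
  then show ?case by (simp add: estimate_Suc)
qed

text \<open>The minimum of \<open>estimate l\<close> is bounded from below by adding up the strong convexity gains of all
iterations, and from above by the value at \<open>z\<close>, again with a strong convexity gain.\<close>

lemma mirror_descent:
  assumes l: "1 \<le> l" and z: "z \<in> box A"
  shows "a 1 * (\<Sum>c<n. G 0 c * (X 1 $ c - z $ c))
    + (\<Sum>i=2..l. real n * a i * (G (i - 1) (j i) * (X i $ j i - z $ j i)))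
    + dist_sq (X 1) x0 + (\<Sum>i=2..l. dist_sq (X i) (X (i - 1))) + dist_sq z (X l) \<le> dist_sq z x0"
proof -
  have "estimate l (X l) + dist_sq z (X l) \<le> estimate l z"
    using estimate_clamped[OF z, of l] l by (simp add: X_clamped)
  then show ?thesis
    using estimate_X_lower[OF l] unfolding estimate_eq[OF l]
    by (simp add: right_diff_distrib sum_subtractf sum.distrib)
qed

text \<open>The direction that iteration \<open>i\<close> contributes to the output and to the dual point. Its average over the
sampled coordinate is the point that an update of all coordinates would produce.\<close>

definition extrap :: "nat \<Rightarrow> nat \<Rightarrow> real" where
  "extrap i c = (if i = 1 then X 1 $ c else real n * X i $ c - (real n - 1) * X (i - 1) $ c)"

definition extrap_img :: "nat \<Rightarrow> nat \<Rightarrow> real" where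
  "extrap_img i r = (\<Sum>c<n. A $$ (r, c) * extrap i c)"

lemma extrap_img_eq: "extrap_img 1 r = img (X 1) r"
  "2 \<le> i \<Longrightarrow> extrap_img i r = real n * img (X i) r - (real n - 1) * img (X (i - 1)) r"
  by (auto simp: extrap_img_def extrap_def img_def sum_distrib_left right_diff_distrib sum_subtractf mult_ac)

lemma dual_product:
  assumes y: "y \<in> carrier_vec m" and v: "v \<in> carrier_vec n"
  shows "(transpose_mat A *\<^sub>v y - ones_vec n) \<bullet> v
    = (\<Sum>r<m. y $ r * (\<Sum>c<n. A $$ (r, c) * v $ c)) - (\<Sum>c<n. v $ c)"
proof -
  have i: "(transpose_mat A *\<^sub>v y - ones_vec n) $ c = (\<Sum>r<m. A $$ (r, c) * y $ r) - 1" if "c < n" for c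
    using that y by (simp add: scalar_prod_def ones_vec_def atLeast0LessThan)
  have "(transpose_mat A *\<^sub>v y - ones_vec n) \<bullet> v = (\<Sum>c<n. ((\<Sum>r<m. A $$ (r, c) * y $ r) - 1) * v $ c)"
    unfolding scalar_prod_def atLeast0LessThan using v by (intro sum.cong) (auto simp only: i carrier_vecD lessThan_iff)
  also have "\<dots> = (\<Sum>c<n. \<Sum>r<m. y $ r * (A $$ (r, c) * v $ c)) - (\<Sum>c<n. v $ c)"
    by (simp add: left_diff_distrib right_diff_distrib sum_subtractf sum_distrib_left sum_distrib_right mult_ac)
  also have "(\<Sum>c<n. \<Sum>r<m. y $ r * (A $$ (r, c) * v $ c)) = (\<Sum>r<m. \<Sum>c<n. y $ r * (A $$ (r, c) * v $ c))"
    by (rule sum.swap)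
  finally show ?thesis by (simp add: sum_distrib_left)
qed

lemma Y_0: "Y 0 = A *\<^sub>v x0" "Yb 0 = A *\<^sub>v x0"
  by (subst si_y.simps, simp) (subst si_ybar.simps, simp)

definition dual_mean :: "nat \<Rightarrow> real vec" where
  "dual_mean l = Matrix.vec m (\<lambda>r. (\<Sum>i=1..l. a i * extrap_img i r) / S l)"

text \<open>Completing the square in \<open>y\<close>; \<open>dual_mean l\<close> is the weighted mean of the images of the contributed directions.\<close>

lemma Y_objective:
  assumes l: "1 \<le> l" and y: "y \<in> carrier_vec m"
  shows "a 1 * ((transpose_mat A *\<^sub>v y - ones_vec n) \<bullet> X 1)
    + (\<Sum>i = 2..l. a i * ((transpose_mat A *\<^sub>v y - ones_vec n) \<bullet> (real n \<cdot>\<^sub>v X i - (real n - 1) \<cdot>\<^sub>v X (i - 1))))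
    - S l / 2 * (y \<bullet> y)
   = S l / 2 * ((\<Sum>r<m. (dual_mean l $ r)\<^sup>2) - (\<Sum>r<m. (y $ r - dual_mean l $ r)\<^sup>2)) - (\<Sum>i=1..l. a i * (\<Sum>c<n. extrap i c))"
proof -
  have t: "(transpose_mat A *\<^sub>v y - ones_vec n) \<bullet> (real n \<cdot>\<^sub>v X i - (real n - 1) \<cdot>\<^sub>v X (i - 1))
    = (\<Sum>r<m. y $ r * extrap_img i r) - (\<Sum>c<n. extrap i c)" if "2 \<le> i" for i
  proof -
    let ?v = "real n \<cdot>\<^sub>v X i - (real n - 1) \<cdot>\<^sub>v X (i - 1)"
    have "?v \<in> carrier_vec n" using X_carrier by auto
    moreover have "?v $ c = extrap i c" if "c < n" for c
      using that \<open>2 \<le> i\<close> X_carrier[of i] X_carrier[of "i - 1"] by (simp add: extrap_def)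
    ultimately show ?thesis using dual_product[OF y, of ?v] by (simp add: extrap_img_def)
  qed
  have t1: "(transpose_mat A *\<^sub>v y - ones_vec n) \<bullet> X 1 = (\<Sum>r<m. y $ r * extrap_img 1 r) - (\<Sum>c<n. extrap 1 c)"
    using dual_product[OF y X_carrier, of 1] by (simp add: extrap_img_def extrap_def)
  have "a 1 * ((transpose_mat A *\<^sub>v y - ones_vec n) \<bullet> X 1)
    + (\<Sum>i = 2..l. a i * ((transpose_mat A *\<^sub>v y - ones_vec n) \<bullet> (real n \<cdot>\<^sub>v X i - (real n - 1) \<cdot>\<^sub>v X (i - 1))))
    = (\<Sum>i = 1..l. a i * ((\<Sum>r<m. y $ r * extrap_img i r) - (\<Sum>c<n. extrap i c)))"
    unfolding sum_split_first[OF l] t1 using t by simp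
  also have "\<dots> = (\<Sum>r<m. y $ r * (\<Sum>i = 1..l. a i * extrap_img i r)) - (\<Sum>i=1..l. a i * (\<Sum>c<n. extrap i c))"
  proof -
    have "(\<Sum>i = 1..l. a i * (\<Sum>r<m. y $ r * extrap_img i r)) = (\<Sum>i = 1..l. \<Sum>r<m. y $ r * (a i * extrap_img i r))"
      by (simp add: sum_distrib_left mult_ac)
    also have "\<dots> = (\<Sum>r<m. \<Sum>i = 1..l. y $ r * (a i * extrap_img i r))" by (rule sum.swap)
    finally show ?thesis by (simp add: right_diff_distrib sum_subtractf sum_distrib_left)
  qed
  finally have 1: "a 1 * ((transpose_mat A *\<^sub>v y - ones_vec n) \<bullet> X 1)
    + (\<Sum>i = 2..l. a i * ((transpose_mat A *\<^sub>v y - ones_vec n) \<bullet> (real n \<cdot>\<^sub>v X i - (real n - 1) \<cdot>\<^sub>v X (i - 1))))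
    = (\<Sum>r<m. y $ r * (\<Sum>i = 1..l. a i * extrap_img i r)) - (\<Sum>i=1..l. a i * (\<Sum>c<n. extrap i c))" .
  have yy: "y \<bullet> y = (\<Sum>r<m. (y $ r)\<^sup>2)"
    using y by (simp add: scalar_prod_def power2_eq_square atLeast0LessThan)
  have Sp: "0 < S l" using step_sum_pos[OF n4 l] .
  have "(\<Sum>r<m. y $ r * (\<Sum>i = 1..l. a i * extrap_img i r)) - S l / 2 * (\<Sum>r<m. (y $ r)\<^sup>2)
    = (\<Sum>r<m. S l / 2 * ((dual_mean l $ r)\<^sup>2 - (y $ r - dual_mean l $ r)\<^sup>2))"
    unfolding sum_distrib_left sum_subtractf[symmetric]
  proof (rule sum.cong)
    fix r assume "r \<in> {..<m}"
    then have "(\<Sum>i = 1..l. a i * extrap_img i r) = S l * dual_mean l $ r"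
      using Sp by (simp add: dual_mean_def)
    then show "(\<Sum>i = 1..l. y $ r * (a i * extrap_img i r)) - S l / 2 * (y $ r)\<^sup>2
        = S l / 2 * ((dual_mean l $ r)\<^sup>2 - (y $ r - dual_mean l $ r)\<^sup>2)"
      unfolding sum_distrib_left[symmetric] by (simp add: power2_eq_square algebra_simps)
  qed simp
  also have "\<dots> = S l / 2 * ((\<Sum>r<m. (dual_mean l $ r)\<^sup>2) - (\<Sum>r<m. (y $ r - dual_mean l $ r)\<^sup>2))"
    by (simp only: sum_distrib_left[symmetric] sum_subtractf)
  finally show ?thesis unfolding 1 yy by linarith
qed

lemma Y_dual_mean: assumes l: "1 \<le> l" shows "Y l = dual_mean l"
proof -
  let ?f = "\<lambda>y. a 1 * ((transpose_mat A *\<^sub>v y - ones_vec n) \<bullet> X 1)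
    + (\<Sum>i = 2..l. a i * ((transpose_mat A *\<^sub>v y - ones_vec n) \<bullet> (real n \<cdot>\<^sub>v X i - (real n - 1) \<cdot>\<^sub>v X (i - 1))))
    - S l / 2 * (y \<bullet> y)"
  have dm: "dual_mean l \<in> carrier_vec m" by (simp add: dual_mean_def)
  have Sp: "0 < S l" using step_sum_pos[OF n4 l] .
  have nn: "0 \<le> S l / 2 * (\<Sum>r<m. (y $ r - dual_mean l $ r)\<^sup>2)" for y
    using Sp by (auto intro!: mult_nonneg_nonneg sum_nonneg)
  have f: "?f y = ?f (dual_mean l) - S l / 2 * (\<Sum>r<m. (y $ r - dual_mean l $ r)\<^sup>2)" if "y \<in> carrier_vec m" for y
    unfolding Y_objective[OF l that] Y_objective[OF l dm] by (simp add: right_diff_distrib)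
  have max: "is_arg_max ?f (\<lambda>y. y \<in> carrier_vec m) y \<longleftrightarrow> y = dual_mean l" for y
  proof
    assume y: "is_arg_max ?f (\<lambda>y. y \<in> carrier_vec m) y"
    then have yc: "y \<in> carrier_vec m" by (simp add: is_arg_max_def)
    have "?f (dual_mean l) \<le> ?f y" using y dm by (simp add: is_arg_max_linorder)
    then have "S l / 2 * (\<Sum>r<m. (y $ r - dual_mean l $ r)\<^sup>2) = 0"
      using f[OF yc] nn[of y] by linarith
    then have "(\<Sum>r<m. (y $ r - dual_mean l $ r)\<^sup>2) = 0" using Sp by simp
    then have "\<And>r. r < m \<Longrightarrow> y $ r = dual_mean l $ r" by (simp add: sum_nonneg_eq_0_iff)
    then show "y = dual_mean l" using yc dm by (intro eq_vecI) auto
  next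
    assume "y = dual_mean l"
    moreover have "?f y \<le> ?f (dual_mean l)" if "y \<in> carrier_vec m" for y
      using f[OF that] nn[of y] by linarith
    ultimately show "is_arg_max ?f (\<lambda>y. y \<in> carrier_vec m) y"
      using dm by (simp add: is_arg_max_linorder)
  qed
  have "Y l = arg_max ?f (\<lambda>y. y \<in> carrier_vec m)"
    using l by (subst si_y.simps) (simp add: Let_def)
  also have "\<dots> = dual_mean l" unfolding arg_max_def max by simp
  finally show ?thesis .
qed

lemma Y_carrier: "Y l \<in> carrier_vec m"
  by (cases l) (auto simp: Y_0 Y_dual_mean dual_mean_def intro: carrier_vecI)

lemma Yb_eq: "1 \<le> l \<Longrightarrow> Yb l = Y l + (a l / a (Suc l)) \<cdot>\<^sub>v (Y l - Y (l - 1))"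
  by (subst si_ybar.simps) (simp add: Let_def)

lemma Yb_carrier: "Yb l \<in> carrier_vec m"
  by (cases l) (use Y_carrier in \<open>auto simp: Y_0 Yb_eq intro: carrier_vecI\<close>)

lemma Yb_index: "1 \<le> l \<Longrightarrow> r < m \<Longrightarrow> Yb l $ r = Y l $ r + a l / a (Suc l) * (Y l $ r - Y (l - 1) $ r)"
  using Y_carrier[of l] Y_carrier[of "l - 1"] by (simp add: Yb_eq)

lemma Y_index: "1 \<le> l \<Longrightarrow> r < m \<Longrightarrow> S l * Y l $ r = (\<Sum>i=1..l. a i * extrap_img i r)"
  using step_sum_pos[OF n4, of l] by (simp add: Y_dual_mean dual_mean_def)

lemma G_eq: "c < n \<Longrightarrow> G i c = (\<Sum>r<m. A $$ (r, c) * Yb i $ r) - 1"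
  using Yb_carrier[of i] by (simp add: G_def scalar_prod_def ones_vec_def atLeast0LessThan)

lemma sum_G: "(\<Sum>c<n. G i c * d c) = (\<Sum>r<m. Yb i $ r * (\<Sum>c<n. A $$ (r, c) * d c)) - (\<Sum>c<n. d c)"
proof -
  have "(\<Sum>c<n. G i c * d c) = (\<Sum>c<n. \<Sum>r<m. Yb i $ r * (A $$ (r, c) * d c)) - (\<Sum>c<n. d c)"
    by (simp add: G_eq left_diff_distrib right_diff_distrib sum_subtractf sum_distrib_left sum_distrib_right mult_ac)
  also have "(\<Sum>c<n. \<Sum>r<m. Yb i $ r * (A $$ (r, c) * d c)) = (\<Sum>r<m. \<Sum>c<n. Yb i $ r * (A $$ (r, c) * d c))"
    by (rule sum.swap)
  finally show ?thesis by (simp add: sum_distrib_left)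
qed

lemma T_Suc: assumes "1 \<le> l" shows "T (Suc l) = (1 / S (Suc l)) \<cdot>\<^sub>v (S l \<cdot>\<^sub>v T l
          + a (Suc l) \<cdot>\<^sub>v (real n \<cdot>\<^sub>v X (Suc l) - (real n - 1) \<cdot>\<^sub>v X l))"
  using assms by (cases l) (auto simp: Let_def)

lemma T_coordinates:
  assumes "1 \<le> l"
  shows "T l \<in> carrier_vec n \<and> (\<forall>c<n. S l * T l $ c = (\<Sum>i=1..l. a i * extrap i c))"
  using assms
proof (induction l rule: dec_induct)
  case base
  then show ?case using X_carrier[of 1] by (simp add: extrap_def step_sum_1)
next
  case (step l)
  have Tc: "T l \<in> carrier_vec n" "dim_vec (T l) = n" using step.IH by auto
  have T: "T (Suc l) = (1 / S (Suc l)) \<cdot>\<^sub>v (S l \<cdot>\<^sub>v T l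
      + a (Suc l) \<cdot>\<^sub>v (real n \<cdot>\<^sub>v X (Suc l) - (real n - 1) \<cdot>\<^sub>v X l))"
    using step.hyps by (intro T_Suc) auto
  have Sp: "0 < S (Suc l)" using step_sum_pos[OF n4, of "Suc l"] by simp
  show ?case
  proof (intro conjI allI impI)
    show "T (Suc l) \<in> carrier_vec n" unfolding T using Tc X_carrier by simp
    fix c assume c: "c < n"
    have "S (Suc l) * T (Suc l) $ c = S l * T l $ c + a (Suc l) * (real n * X (Suc l) $ c - (real n - 1) * X l $ c)"
      unfolding T using Tc X_carrier[of l] X_carrier[of "Suc l"] c Sp by (simp add: carrier_vecD)
    also have "S l * T l $ c = (\<Sum>i=1..l. a i * extrap i c)" using step.IH c by simp
    finally show "S (Suc l) * T (Suc l) $ c = (\<Sum>i=1..Suc l. a i * extrap i c)"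
      using step.hyps by (simp add: extrap_def)
  qed
qed

lemma T_carrier: "1 \<le> l \<Longrightarrow> T l \<in> carrier_vec n"
  using T_coordinates by blast

text \<open>The dual point is the image of the output, so that \<open>1 / 2 * (\<Sum>r<m. (Y l $ r)\<^sup>2)\<close> is the quadratic part
of the objective at the output.\<close>

lemma img_T: assumes l: "1 \<le> l" and r: "r < m" shows "img (T l) r = Y l $ r"
proof -
  have "S l * img (T l) r = (\<Sum>c<n. A $$ (r, c) * (S l * T l $ c))"
    by (simp add: img_def sum_distrib_left mult_ac)
  also have "\<dots> = (\<Sum>c<n. \<Sum>i=1..l. a i * (A $$ (r, c) * extrap i c))"
    using T_coordinates[OF l] by (simp add: sum_distrib_left mult_ac)
  also have "\<dots> = (\<Sum>i=1..l. \<Sum>c<n. a i * (A $$ (r, c) * extrap i c))" by (rule sum.swap)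
  also have "\<dots> = S l * Y l $ r" unfolding Y_index[OF l r] by (simp add: extrap_img_def sum_distrib_left)
  finally show ?thesis using step_sum_pos[OF n4 l] by simp
qed

text \<open>In \<open>S l \<cdot> T l\<close> the iterate \<open>X l\<close> has weight \<open>n a\<^sub>l\<close>. The next iteration takes \<open>(n - 1) a\<^bsub>l+1\<^esub>\<close> away from it,
which leaves a nonnegative weight by \<open>step_ratio\<close>. For \<open>X 1\<close> the second step size makes the remaining weight
exactly zero. The induction tracks everything except the weight of the last iterate.\<close>

lemma T_box: assumes l: "1 \<le> l" shows "T l \<in> box A"
proof -
  have X: "0 \<le> X i $ c" "X i $ c \<le> 1 / col_sq A c" if "c < n" for i c
    using X_box[of i] that by (auto simp: box_def)
  have inv: "0 \<le> S l - real n * a l \<and> (\<forall>c<n. 0 \<le> S l * T l $ c - real n * a l * X l $ c \<and>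
    S l * T l $ c - real n * a l * X l $ c \<le> (S l - real n * a l) * (1 / col_sq A c))" if "2 \<le> l" for l
    using that
  proof (induction l rule: dec_induct)
    case base
    have a2: "(real n - 1) * a 2 = a 1" by (rule step_2[OF n4])
    have S2: "S 2 = real n * a 2"
      using a2 by (simp add: numeral_2_eq_2 step_sum.simps algebra_simps)
    have "T 2 $ c = X 2 $ c" if "c < n" for c
    proof -
      have "S 2 * T 2 $ c = a 1 * X 1 $ c + a 2 * (real n * X 2 $ c - (real n - 1) * X 1 $ c)"
        using T_coordinates[of 2] that by (simp add: numeral_2_eq_2 extrap_def)
      also have "\<dots> = real n * a 2 * X 2 $ c" unfolding a2[symmetric] by (simp add: algebra_simps)
      finally have "real n * a 2 * T 2 $ c = real n * a 2 * X 2 $ c" by (simp only: S2)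
      then show ?thesis using step_pos[OF n4, of 2] n4 by simp
    qed
    then show ?case using S2 by simp
  next
    case (step l)
    have r: "(real n - 1) * a (Suc l) \<le> real n * a l" using step_ratio[OF n4] step.hyps by simp
    have SS: "S (Suc l) - real n * a (Suc l) = (S l - real n * a l) + (real n * a l - (real n - 1) * a (Suc l))"
      by (simp add: step_sum.simps algebra_simps)
    have TT: "S (Suc l) * T (Suc l) $ c - real n * a (Suc l) * X (Suc l) $ c
       = (S l * T l $ c - real n * a l * X l $ c) + (real n * a l - (real n - 1) * a (Suc l)) * X l $ c" if "c < n" for c
      using T_coordinates[of "Suc l"] T_coordinates[of l] that step.hyps
      by (simp add: extrap_def algebra_simps)
    have "0 \<le> (real n * a l - (real n - 1) * a (Suc l)) * X l $ c"
      "(real n * a l - (real n - 1) * a (Suc l)) * X l $ c \<le> (real n * a l - (real n - 1) * a (Suc l)) * (1 / col_sq A c)"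
      if "c < n" for c
      using X[OF that, of l] r by (auto intro!: mult_nonneg_nonneg mult_left_mono simp del: times_divide_eq_right)
    then show ?case
      using step.IH r unfolding SS distrib_right by (simp add: TT add_mono del: times_divide_eq_right)
  qed
  show ?thesis
  proof (cases "l = 1")
    case True
    then show ?thesis using X_box[of 1] by simp
  next
    case False
    then have l2: "2 \<le> l" using l by simp
    have "0 \<le> T l $ c \<and> T l $ c \<le> 1 / col_sq A c" if c: "c < n" for c
    proof -
      have an: "0 \<le> real n * a l" using step_pos[OF n4 l] by simp
      have "0 \<le> real n * a l * X l $ c" "real n * a l * X l $ c \<le> real n * a l * (1 / col_sq A c)"
        using X[OF c, of l] an by (auto intro: mult_left_mono simp del: times_divide_eq_right)
      then have "S l * 0 \<le> S l * T l $ c" "S l * T l $ c \<le> S l * (1 / col_sq A c)"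
        using inv[OF l2] c unfolding left_diff_distrib by fastforce+
      then show ?thesis using step_sum_pos[OF n4 l] by (simp only: mult_le_cancel_left_pos)
    qed
    then show ?thesis using T_carrier[OF l] by (auto simp: box_def)
  qed
qed

text \<open>Only coordinate \<open>j i\<close> changes in iteration \<open>i\<close>, so \<open>n\<close> times the change is the whole displacement
\<open>extrap i - X (i - 1)\<close>.\<close>

lemma noise_eq:
  assumes i: "2 \<le> i"
  shows "real n * (G (i - 1) (j i) * (X i $ j i - z $ j i))
    = (\<Sum>c<n. G (i - 1) c * (extrap i c - z $ c)) - noise i z"
proof -
  have other: "X i $ c = X (i - 1) $ c" if "c < n" "c \<noteq> j i" for c
    using X_Suc_other[of "i - 1" c] i that by simp
  have "(\<Sum>c<n. G (i - 1) c * (extrap i c - z $ c))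
    = (\<Sum>c<n. real n * (G (i - 1) c * (X i $ c - X (i - 1) $ c)) - G (i - 1) c * (z $ c - X (i - 1) $ c))"
    using i by (intro sum.cong) (auto simp: extrap_def algebra_simps)
  also have "\<dots> = real n * (\<Sum>c<n. G (i - 1) c * (X i $ c - X (i - 1) $ c)) - (\<Sum>c<n. G (i - 1) c * (z $ c - X (i - 1) $ c))"
    by (simp add: sum_subtractf sum_distrib_left)
  also have "(\<Sum>c<n. G (i - 1) c * (X i $ c - X (i - 1) $ c))
    = (\<Sum>c<n. if c = j i then G (i - 1) (j i) * (X i $ j i - X (i - 1) $ j i) else 0)"
    by (intro sum.cong) (auto simp: other)
  also have "\<dots> = G (i - 1) (j i) * (X i $ j i - X (i - 1) $ j i)"
    using j_less by simp
  finally show ?thesis by (simp add: noise_def algebra_simps)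
qed

text \<open>A move along one coordinate is mapped by \<open>A\<close> without loss, whereas \<open>img_sq_le\<close> would cost a factor \<open>n\<close>.\<close>

lemma dist_sq_one_coordinate:
  assumes i: "2 \<le> i"
  shows "(\<Sum>r<m. (img (X i) r - img (X (i - 1)) r)\<^sup>2) = 2 * dist_sq (X i) (X (i - 1))"
proof -
  have other: "X i $ c = X (i - 1) $ c" if "c < n" "c \<noteq> j i" for c
    using X_Suc_other[of "i - 1" c] i that by simp
  have "img (X i) r - img (X (i - 1)) r = A $$ (r, j i) * (X i $ j i - X (i - 1) $ j i)" for r
  proof -
    have "img (X i) r - img (X (i - 1)) r = (\<Sum>c<n. if c = j i then A $$ (r, j i) * (X i $ j i - X (i - 1) $ j i) else 0)"
      unfolding img_diff[symmetric] by (intro sum.cong) (auto simp: other)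
    then show ?thesis using j_less by simp
  qed
  then have "(\<Sum>r<m. (img (X i) r - img (X (i - 1)) r)\<^sup>2) = col_sq A (j i) * (X i $ j i - X (i - 1) $ j i)\<^sup>2"
    using j_less by (simp add: col_sq_eq power_mult_distrib sum_distrib_right)
  also have "\<dots> = (\<Sum>c<n. if c = j i then col_sq A (j i) * (X i $ j i - X (i - 1) $ j i)\<^sup>2 else 0)"
    using j_less by simp
  also have "\<dots> = (\<Sum>c<n. col_sq A c * (X i $ c - X (i - 1) $ c)\<^sup>2)"
    by (intro sum.cong) (auto simp: other)
  finally show ?thesis by (simp add: dist_sq_def)
qed

lemma img_dist_sq_le: "(\<Sum>r<m. (img z r - img x r)\<^sup>2) \<le> 2 * real n * dist_sq z x"
  using img_sq_le[of "\<lambda>c. z $ c - x $ c"] by (simp add: img_diff dist_sq_def)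

lemma dist_sq_commute: "dist_sq z x = dist_sq x z"
  by (simp add: dist_sq_def power2_commute)

text \<open>The row inequalities are summed and combined with \<open>mirror_descent\<close>. The primal increments they ask for
are those that \<open>mirror_descent\<close> supplies: for iterations \<open>i \<ge> 2\<close> by \<open>dist_sq_one_coordinate\<close>, and
for the first iteration, which moves all coordinates, because \<open>n\<^sup>3 a\<^sub>1\<^sup>2 = 1 / 2\<close>.\<close>

lemma gap_le_noise:
  assumes l: "1 \<le> l" and z: "z \<in> box A"
  shows "S l * (nnls_obj A (T l) - nnls_obj A z) \<le> dist_sq z x0 + (\<Sum>i=2..l. a i * noise i z)"
proof -
  define W where "W k = (if k = 1 then (real n)\<^sup>2 * (a 1)\<^sup>2 else S (k - 1) / 4)" for k
  have zc: "z \<in> carrier_vec n" using z by (rule box_imp_carrier)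
  have n1: "1 \<le> real n" using n4 by simp
  let ?row = "\<lambda>r. \<Sum>i=1..l. a i * (Yb (i - 1) $ r * (extrap_img i r - img z r))"
  have Wn: "(real n)\<^sup>2 * (a l)\<^sup>2 \<le> W l"
  proof (cases "l = 1")
    case False
    then show ?thesis using step_sq_le[OF n4, of "l - 1"] l by (simp add: W_def)
  qed (simp add: W_def)
  \<comment> \<open>The boundary term \<open>a l * d * e\<close> left over by the telescoping is absorbed by the reserve
    \<open>W l * d\<^sup>2\<close> and, after summation over the rows, by \<open>dist_sq z (X l)\<close>.\<close>
  have row: "- (img (X l) r - img z r)\<^sup>2 / (2 * real n) - (real n)\<^sup>2 * (a 1)\<^sup>2 * (img (X 1) r - img x0 r)\<^sup>2
      - (\<Sum>i=2..l. (img (X i) r - img (X (i - 1)) r)\<^sup>2) / 2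
    \<le> ?row r - S l / 2 * (Y l $ r)\<^sup>2 + S l / 2 * (img z r)\<^sup>2" if r: "r < m" for r
  proof -
    define d e where "d = Y l $ r - Y (l - 1) $ r" and "e = img (X l) r - img z r"
    have y0: "Y 0 $ r = img x0 r" "Yb 0 $ r = img x0 r"
      using r x0_box by (auto simp: Y_0 mult_index box_imp_carrier simp del: index_mult_mat_vec)
    have y1: "Y 1 $ r = img (X 1) r"
      using Y_index[of 1 r] r step_pos[OF n4, of 1] by (simp add: step_sum_1 extrap_img_eq(1)[simplified])
    have "W l * d\<^sup>2 - a l * d * e
      - (real n)\<^sup>2 * (a 1)\<^sup>2 * (Y 1 $ r - Y 0 $ r)\<^sup>2 - (\<Sum>i=2..l. (img (X i) r - img (X (i - 1)) r)\<^sup>2) / 2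
      \<le> ?row r - S l / 2 * (Y l $ r)\<^sup>2 + S l / 2 * (img z r)\<^sup>2"
      unfolding d_def e_def
    proof (rule extrapolation_row)
      show "S (Suc i) * Y (Suc i) $ r = S i * Y i $ r + a (Suc i) * extrap_img (Suc i) r" for i
        using Y_index[of "Suc i" r] Y_index[of i r] r by (cases "i = 0") (auto simp: step_sum.simps)
    qed (use l n1 r y0 in \<open>auto simp: step_sum.simps step_pos[OF n4] Yb_index extrap_img_eq W_def step_sq_le[OF n4, simplified]
            extrap_img_eq(1)[simplified]\<close>)
    moreover have "a l * d * e \<le> W l * d\<^sup>2 + e\<^sup>2 / (2 * real n)"
    proof -
      have "a l * d * e = (real n * a l) * d * (e / real n)" using n1 by simp
      also have "\<dots> \<le> W l * d\<^sup>2 + (e / real n)\<^sup>2 / 4"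
        using Wn by (intro young) (simp add: power_mult_distrib)
      also have "(e / real n)\<^sup>2 / 4 \<le> e\<^sup>2 / (2 * real n)"
      proof -
        have "e\<^sup>2 / ((real n)\<^sup>2 * 4) \<le> e\<^sup>2 / (2 * real n)"
          using n1 by (intro divide_left_mono) (auto simp: power2_eq_square)
        then show ?thesis by (simp add: power_divide)
      qed
      finally show ?thesis by simp
    qed
    ultimately show ?thesis unfolding y0 y1 e_def by simp
  qed
  have "(\<Sum>r<m. - (img (X l) r - img z r)\<^sup>2 / (2 * real n) - (real n)\<^sup>2 * (a 1)\<^sup>2 * (img (X 1) r - img x0 r)\<^sup>2
      - (\<Sum>i=2..l. (img (X i) r - img (X (i - 1)) r)\<^sup>2) / 2)
    \<le> (\<Sum>r<m. ?row r - S l / 2 * (Y l $ r)\<^sup>2 + S l / 2 * (img z r)\<^sup>2)"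
    by (intro sum_mono row) auto
  then have rows: "- (\<Sum>r<m. (img (X l) r - img z r)\<^sup>2) / (2 * real n)
      - (real n)\<^sup>2 * (a 1)\<^sup>2 * (\<Sum>r<m. (img (X 1) r - img x0 r)\<^sup>2)
      - (\<Sum>r<m. \<Sum>i=2..l. (img (X i) r - img (X (i - 1)) r)\<^sup>2) / 2
    \<le> (\<Sum>r<m. ?row r) - S l / 2 * (\<Sum>r<m. (Y l $ r)\<^sup>2) + S l / 2 * (\<Sum>r<m. (img z r)\<^sup>2)"
    by (simp add: sum_subtractf sum.distrib sum_negf sum_distrib_left sum_divide_distrib)
  have b1: "(\<Sum>r<m. (img (X l) r - img z r)\<^sup>2) / (2 * real n) \<le> dist_sq z (X l)"
    using img_dist_sq_le[of "X l" z] n1 by (simp add: dist_sq_commute[of z] field_simps)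
  have b2: "(real n)\<^sup>2 * (a 1)\<^sup>2 * (\<Sum>r<m. (img (X 1) r - img x0 r)\<^sup>2) \<le> dist_sq (X 1) x0"
  proof -
    have "(real n)\<^sup>2 * (a 1)\<^sup>2 * (\<Sum>r<m. (img (X 1) r - img x0 r)\<^sup>2) \<le> (real n)\<^sup>2 * (a 1)\<^sup>2 * (2 * real n * dist_sq (X 1) x0)"
      by (intro mult_left_mono img_dist_sq_le) auto
    also have "\<dots> = 2 * (real n ^ 3 * (a 1)\<^sup>2) * dist_sq (X 1) x0"
      by (simp add: power2_eq_square power3_eq_cube)
    also have "\<dots> = dist_sq (X 1) x0" using step_1_sq[of n] n4 by simp
    finally show ?thesis .
  qed
  have b3: "(\<Sum>r<m. \<Sum>i=2..l. (img (X i) r - img (X (i - 1)) r)\<^sup>2) / 2 = (\<Sum>i=2..l. dist_sq (X i) (X (i - 1)))"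
  proof -
    have "(\<Sum>r<m. \<Sum>i=2..l. (img (X i) r - img (X (i - 1)) r)\<^sup>2) = (\<Sum>i=2..l. \<Sum>r<m. (img (X i) r - img (X (i - 1)) r)\<^sup>2)"
      by (rule sum.swap)
    also have "\<dots> = (\<Sum>i=2..l. 2 * dist_sq (X i) (X (i - 1)))"
      by (intro sum.cong dist_sq_one_coordinate) auto
    finally show ?thesis by (simp flip: sum_distrib_left)
  qed
  \<comment> \<open>Replacing every sampled linear term by its average leaves the noise as the only trace of
    the sampling.\<close>
  have "a 1 * (\<Sum>c<n. G 0 c * (X 1 $ c - z $ c)) + (\<Sum>i=2..l. real n * a i * (G (i - 1) (j i) * (X i $ j i - z $ j i)))
    = (\<Sum>i=1..l. a i * (\<Sum>c<n. G (i - 1) c * (extrap i c - z $ c))) - (\<Sum>i=2..l. a i * noise i z)"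
  proof -
    have "(\<Sum>i=2..l. real n * a i * (G (i - 1) (j i) * (X i $ j i - z $ j i)))
      = (\<Sum>i=2..l. a i * (\<Sum>c<n. G (i - 1) c * (extrap i c - z $ c)) - a i * noise i z)"
    proof (rule sum.cong)
      fix i assume "i \<in> {2..l}"
      then have i: "2 \<le> i" by simp
      have "real n * a i * (G (i - 1) (j i) * (X i $ j i - z $ j i)) = a i * (real n * (G (i - 1) (j i) * (X i $ j i - z $ j i)))"
        by (simp only: mult.assoc mult.left_commute)
      also note noise_eq[OF i]
      also have "a i * ((\<Sum>c<n. G (i - 1) c * (extrap i c - z $ c)) - noise i z)
         = a i * (\<Sum>c<n. G (i - 1) c * (extrap i c - z $ c)) - a i * noise i z"
        by (rule right_diff_distrib)
      finally show "real n * a i * (G (i - 1) (j i) * (X i $ j i - z $ j i))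
         = a i * (\<Sum>c<n. G (i - 1) c * (extrap i c - z $ c)) - a i * noise i z" .
    qed simp
    then show ?thesis unfolding sum_split_first[OF l] by (simp add: sum_subtractf extrap_def)
  qed
  moreover have "(\<Sum>i=1..l. a i * (\<Sum>c<n. G (i - 1) c * (extrap i c - z $ c)))
    = (\<Sum>r<m. ?row r) - (\<Sum>i=1..l. a i * (\<Sum>c<n. extrap i c - z $ c))"
  proof -
    have "(\<Sum>i=1..l. a i * (\<Sum>c<n. G (i - 1) c * (extrap i c - z $ c)))
      = (\<Sum>i=1..l. (\<Sum>r<m. a i * (Yb (i - 1) $ r * (extrap_img i r - img z r))) - a i * (\<Sum>c<n. extrap i c - z $ c))"
    proof (rule sum.cong)
      fix i
      have "(\<Sum>c<n. A $$ (r, c) * (extrap i c - z $ c)) = extrap_img i r - img z r" for r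
        by (simp add: extrap_img_def img_def right_diff_distrib sum_subtractf)
      then show "a i * (\<Sum>c<n. G (i - 1) c * (extrap i c - z $ c))
        = (\<Sum>r<m. a i * (Yb (i - 1) $ r * (extrap_img i r - img z r))) - a i * (\<Sum>c<n. extrap i c - z $ c)"
        unfolding sum_G by (simp add: right_diff_distrib sum_distrib_left)
    qed simp
    also have "\<dots> = (\<Sum>i=1..l. \<Sum>r<m. a i * (Yb (i - 1) $ r * (extrap_img i r - img z r))) - (\<Sum>i=1..l. a i * (\<Sum>c<n. extrap i c - z $ c))"
      by (simp add: sum_subtractf)
    also have "(\<Sum>i=1..l. \<Sum>r<m. a i * (Yb (i - 1) $ r * (extrap_img i r - img z r))) = (\<Sum>r<m. ?row r)"
      by (rule sum.swap)
    finally show ?thesis .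
  qed
  moreover note mirror_descent[OF l z]
  ultimately have up: "(\<Sum>r<m. ?row r) - (\<Sum>i=1..l. a i * (\<Sum>c<n. extrap i c - z $ c))
      - (\<Sum>i=2..l. a i * noise i z) + dist_sq (X 1) x0 + (\<Sum>i=2..l. dist_sq (X i) (X (i - 1))) + dist_sq z (X l) \<le> dist_sq z x0"
    by linarith
  have sumT: "S l * (\<Sum>c<n. T l $ c) - S l * (\<Sum>c<n. z $ c) = (\<Sum>i=1..l. a i * (\<Sum>c<n. extrap i c - z $ c))"
  proof -
    have Ssum: "S l = (\<Sum>i=1..l. a i)"
      by (induction l) (auto simp: step_sum.simps)
    have "S l * (\<Sum>c<n. T l $ c) = (\<Sum>c<n. \<Sum>i=1..l. a i * extrap i c)"
      using T_coordinates[OF l] by (simp add: sum_distrib_left)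
    also have "\<dots> = (\<Sum>i=1..l. a i * (\<Sum>c<n. extrap i c))"
      by (subst sum.swap) (simp add: sum_distrib_left)
    finally show ?thesis
      by (simp add: sum_subtractf right_diff_distrib Ssum sum_distrib_right)
  qed
  have objT: "nnls_obj A (T l) = 1 / 2 * (\<Sum>r<m. (Y l $ r)\<^sup>2) - (\<Sum>c<n. T l $ c)"
    using T_carrier[OF l] l by (simp add: obj_eq img_T)
  have objz: "nnls_obj A z = 1 / 2 * (\<Sum>r<m. (img z r)\<^sup>2) - (\<Sum>c<n. z $ c)"
    by (rule obj_eq[OF zc])
  have "S l * (nnls_obj A (T l) - nnls_obj A z)
    = S l / 2 * (\<Sum>r<m. (Y l $ r)\<^sup>2) - S l / 2 * (\<Sum>r<m. (img z r)\<^sup>2) - (\<Sum>i=1..l. a i * (\<Sum>c<n. extrap i c - z $ c))"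
    unfolding sumT[symmetric] objT objz by (simp add: algebra_simps)
  then show ?thesis using up rows b1 b2 b3 by linarith
qed

end

section \<open>Resampling and discrete random variables\<close>

definition mix :: "'i set \<Rightarrow> ('i \<Rightarrow> 'a) \<Rightarrow> ('i \<Rightarrow> 'a) \<Rightarrow> 'i \<Rightarrow> 'a" where
  "mix J \<omega> \<omega>' = (\<lambda>i. if i \<in> J then \<omega>' i else \<omega> i)"

lemma measurable_mix [measurable]:
  "(\<lambda>(\<omega>, \<omega>'). mix J \<omega> \<omega>') \<in> measurable (PiM UNIV N \<Otimes>\<^sub>M PiM UNIV N) (PiM UNIV N)"
proof -
  have "(\<lambda>p. mix J (fst p) (snd p)) \<in> measurable (PiM UNIV N \<Otimes>\<^sub>M PiM UNIV N) (PiM UNIV N)"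
    unfolding mix_def
  proof (rule measurable_PiM_single')
    show "(\<lambda>p. if i \<in> J then snd p i else fst p i) \<in> measurable (PiM UNIV N \<Otimes>\<^sub>M PiM UNIV N) (N i)" for i
      by (cases "i \<in> J") simp_all
    show "(\<lambda>p i. if i \<in> J then snd p i else fst p i) \<in> space (PiM UNIV N \<Otimes>\<^sub>M PiM UNIV N) \<rightarrow> (\<Pi>\<^sub>E i\<in>UNIV. space (N i))"
      by (auto simp: space_pair_measure space_PiM PiE_iff)
  qed
  then show ?thesis by (simp add: case_prod_beta')
qed

text \<open>Both sides agree on cylinders, because the factors over \<open>J\<close> and over its complement separate.\<close>

lemma distr_mix:
  assumes N: "\<And>i. prob_space (N i)"
  shows "distr (PiM UNIV N \<Otimes>\<^sub>M PiM UNIV N) (PiM UNIV N) (\<lambda>(\<omega>, \<omega>'). mix J \<omega> \<omega>') = PiM UNIV N"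
proof (rule measure_eqI_PiM_infinite[symmetric, OF refl])
  interpret P: prob_space "PiM UNIV N" by (rule prob_space_PiM[OF N])
  show "finite_measure (PiM UNIV N)" by unfold_locales
  fix A K assume K: "finite K" "K \<subseteq> UNIV" and A: "\<And>i. i \<in> K \<Longrightarrow> A i \<in> sets (N i)"
  let ?emb = "\<lambda>K. prod_emb UNIV N K (Pi\<^sub>E K A)"
  have em: "emeasure (PiM UNIV N) (?emb K') = (\<Prod>i\<in>K'. emeasure (N i) (A i))" if "K' \<subseteq> K" for K'
    using that K A by (intro emeasure_PiM_emb N) (auto intro: finite_subset)
  have s: "?emb K' \<in> sets (PiM UNIV N)" if "K' \<subseteq> K" for K'
    using that K A by (intro sets_PiM_I) (auto intro: finite_subset)
  have "emeasure (PiM UNIV N) (?emb K) = (\<Prod>i\<in>(K - J) \<union> (K \<inter> J). emeasure (N i) (A i))"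
    by (simp add: em Un_Diff_Int)
  also have "\<dots> = (\<Prod>i\<in>K - J. emeasure (N i) (A i)) * (\<Prod>i\<in>K \<inter> J. emeasure (N i) (A i))"
    using K by (intro prod.union_disjoint) auto
  also have "\<dots> = emeasure (PiM UNIV N) (?emb (K - J)) * emeasure (PiM UNIV N) (?emb (K \<inter> J))"
    by (simp add: em)
  also have "\<dots> = emeasure (PiM UNIV N \<Otimes>\<^sub>M PiM UNIV N) (?emb (K - J) \<times> ?emb (K \<inter> J))"
    using s by (intro P.emeasure_pair_measure_Times[symmetric]) auto
  also have "?emb (K - J) \<times> ?emb (K \<inter> J) = (\<lambda>(\<omega>, \<omega>'). mix J \<omega> \<omega>') -` ?emb K \<inter> space (PiM UNIV N \<Otimes>\<^sub>M PiM UNIV N)"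
    by (auto simp: prod_emb_def space_PiM space_pair_measure PiE_iff mix_def split: if_splits)
  also have "emeasure (PiM UNIV N \<Otimes>\<^sub>M PiM UNIV N) \<dots>
     = emeasure (distr (PiM UNIV N \<Otimes>\<^sub>M PiM UNIV N) (PiM UNIV N) (\<lambda>(\<omega>, \<omega>'). mix J \<omega> \<omega>')) (?emb K)"
    using s by (intro emeasure_distr[symmetric]) auto
  finally show "emeasure (PiM UNIV N) (?emb K)
     = emeasure (distr (PiM UNIV N \<Otimes>\<^sub>M PiM UNIV N) (PiM UNIV N) (\<lambda>(\<omega>, \<omega>'). mix J \<omega> \<omega>')) (?emb K)" .
qed simp

lemma space_samples [simp]: "space (samples n) = UNIV"
  by (simp add: samples_def space_PiM)

lemma prob_space_samples: "prob_space (samples n)"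
  unfolding samples_def by (rule prob_space_PiM) (rule measure_pmf.prob_space_axioms)

lemma measurable_mix_samples:
  "(\<lambda>(\<omega>, \<omega>'). mix J \<omega> \<omega>') \<in> measurable (samples n \<Otimes>\<^sub>M samples n) (samples n)"
  unfolding samples_def by (rule measurable_mix)

lemma distr_mix_samples:
  "distr (samples n \<Otimes>\<^sub>M samples n) (samples n) (\<lambda>(\<omega>, \<omega>'). mix J \<omega> \<omega>') = samples n"
  unfolding samples_def by (rule distr_mix) (rule measure_pmf.prob_space_axioms)

lemma nn_integral_resample:
  assumes f: "f \<in> borel_measurable (samples n)"
  shows "(\<integral>\<^sup>+\<omega>. f \<omega> \<partial>samples n) = (\<integral>\<^sup>+\<omega>. \<integral>\<^sup>+\<omega>'. f (mix J \<omega> \<omega>') \<partial>samples n \<partial>samples n)"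
proof -
  interpret prob_space "samples n" by (rule prob_space_samples)
  have fm: "(\<lambda>p. f (case p of (\<omega>, \<omega>') \<Rightarrow> mix J \<omega> \<omega>')) \<in> borel_measurable (samples n \<Otimes>\<^sub>M samples n)"
    by (rule measurable_compose[OF measurable_mix_samples f])
  have "(\<integral>\<^sup>+\<omega>. f \<omega> \<partial>samples n) = (\<integral>\<^sup>+p. f (case p of (\<omega>, \<omega>') \<Rightarrow> mix J \<omega> \<omega>') \<partial>(samples n \<Otimes>\<^sub>M samples n))"
    using nn_integral_distr[OF measurable_mix_samples[of J n], of f] f
    by (simp add: distr_mix_samples)
  also have "\<dots> = (\<integral>\<^sup>+\<omega>. \<integral>\<^sup>+\<omega>'. f (mix J \<omega> \<omega>') \<partial>samples n \<partial>samples n)"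
    using nn_integral_fst[OF fm] by simp
  finally show ?thesis .
qed

lemma integral_resample:
  fixes f :: "_ \<Rightarrow> real"
  assumes f: "integrable (samples n) f"
  shows "(\<integral>\<omega>. f \<omega> \<partial>samples n) = (\<integral>\<omega>. \<integral>\<omega>'. f (mix J \<omega> \<omega>') \<partial>samples n \<partial>samples n)"
proof -
  interpret prob_space "samples n" by (rule prob_space_samples)
  interpret pair_sigma_finite "samples n" "samples n" ..
  have fm: "f \<in> borel_measurable (samples n)" using f by simp
  have "integrable (distr (samples n \<Otimes>\<^sub>M samples n) (samples n) (\<lambda>(\<omega>, \<omega>'). mix J \<omega> \<omega>')) f"
    unfolding distr_mix_samples by (rule f)
  then have int: "integrable (samples n \<Otimes>\<^sub>M samples n) (\<lambda>(\<omega>, \<omega>'). f (mix J \<omega> \<omega>'))"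
    unfolding integrable_distr_eq[OF measurable_mix_samples fm] by (simp add: case_prod_beta')
  have "(\<integral>\<omega>. f \<omega> \<partial>samples n) = (\<integral>p. f (case p of (\<omega>, \<omega>') \<Rightarrow> mix J \<omega> \<omega>') \<partial>(samples n \<Otimes>\<^sub>M samples n))"
    by (subst distr_mix_samples[of n J, symmetric]) (rule integral_distr[OF measurable_mix_samples fm])
  also have "\<dots> = (\<integral>\<omega>. \<integral>\<omega>'. f (mix J \<omega> \<omega>') \<partial>samples n \<partial>samples n)"
    using integral_fst'[OF int] by (simp add: case_prod_beta')
  finally show ?thesis .
qed

lemma measurable_coordinate: "(\<lambda>\<omega>. \<omega> p) \<in> measurable (samples n) (count_space UNIV)"
proof -
  have "(\<lambda>\<omega>. \<omega> p) \<in> measurable (samples n) (measure_pmf (pmf_of_set {..<n}))"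
    unfolding samples_def by (rule measurable_component_singleton) simp
  then show ?thesis by (simp add: measurable_pmf_measure2)
qed

lemma distr_coordinate:
  "distr (samples n) (measure_pmf (pmf_of_set {..<n})) (\<lambda>\<omega>. \<omega> p) = measure_pmf (pmf_of_set {..<n})"
  unfolding samples_def by (rule distr_PiM_component) (auto intro: measure_pmf.prob_space_axioms)

lemma measurable_coordinate': "(\<lambda>\<omega>. \<omega> p) \<in> measurable (samples n) (measure_pmf (pmf_of_set {..<n}))"
  using measurable_coordinate by (simp add: measurable_pmf_measure2)

lemma integral_coordinate:
  fixes h :: "nat \<Rightarrow> real"
  assumes "0 < n"
  shows "(\<integral>\<omega>. h (\<omega> p) \<partial>samples n) = (\<Sum>c<n. h c) / real n"
proof -
  have "(\<integral>\<omega>. h (\<omega> p) \<partial>samples n) = (\<integral>c. h c \<partial>measure_pmf (pmf_of_set {..<n}))"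
    using integral_distr[OF measurable_coordinate'[of p n], of h] by (simp add: distr_coordinate)
  also have "\<dots> = (\<Sum>c<n. h c) / real n"
    using assms by (subst integral_pmf_of_set) auto
  finally show ?thesis .
qed

lemma nn_integral_coordinate:
  assumes "0 < n" and h: "\<And>c. 0 \<le> h c"
  shows "(\<integral>\<^sup>+\<omega>. ennreal (h (\<omega> p)) \<partial>samples n) = ennreal ((\<Sum>c<n. h c) / real n)"
proof -
  have "(\<integral>\<^sup>+\<omega>. ennreal (h (\<omega> p)) \<partial>samples n) = (\<integral>\<^sup>+c. ennreal (h c) \<partial>measure_pmf (pmf_of_set {..<n}))"
    using nn_integral_distr[OF measurable_coordinate'[of p n], of "\<lambda>c. ennreal (h c)"]
    by (simp add: distr_coordinate)
  also have "\<dots> = (\<Sum>c<n. ennreal (h c)) / of_nat n"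
    using assms by (subst nn_integral_pmf_of_set) auto
  also have "\<dots> = ennreal (\<Sum>c<n. h c) / ennreal (real n)"
    by (simp only: sum_ennreal[OF h] ennreal_of_nat_eq_real_of_nat)
  also have "\<dots> = ennreal ((\<Sum>c<n. h c) / real n)"
    using assms by (intro divide_ennreal sum_nonneg) auto
  finally show ?thesis .
qed

lemma AE_samples_less: assumes "0 < n" shows "AE \<omega> in samples n. \<forall>p. \<omega> p < n"
proof -
  have "AE \<omega> in samples n. \<omega> p < n" for p
    unfolding samples_def
    by (rule AE_PiM_component) (use assms in \<open>auto simp: measure_pmf.prob_space_axioms AE_measure_pmf_iff lessThan_empty_iff\<close>)
  then show ?thesis by (subst AE_all_countable) blast
qed

text \<open>The coordinates of a sample point are natural numbers, almost surely below \<open>n\<close>, so dependence on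
finitely many of them implies measurability and almost sure boundedness.\<close>

definition finitely_determined :: "(('i \<Rightarrow> 'a) \<Rightarrow> 'b) \<Rightarrow> bool" where
  "finitely_determined F \<longleftrightarrow> (\<exists>S. finite S \<and> (\<forall>\<omega> \<omega>'. (\<forall>p\<in>S. \<omega> p = \<omega>' p) \<longrightarrow> F \<omega> = F \<omega>'))"

lemma finitely_determinedI:
  "finite S \<Longrightarrow> (\<And>\<omega> \<omega>'. (\<And>p. p \<in> S \<Longrightarrow> \<omega> p = \<omega>' p) \<Longrightarrow> F \<omega> = F \<omega>') \<Longrightarrow> finitely_determined F"
  unfolding finitely_determined_def by blast

lemma finitely_determined_compose: "finitely_determined F \<Longrightarrow> finitely_determined (\<lambda>\<omega>. h (F \<omega>))"
  unfolding finitely_determined_def by metis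

text \<open>Vectors of variable dimension are given the discrete sigma-algebra; the countable range is what
lets such a random variable be substituted for a parameter (\<open>discrete_rv_compose\<close>).\<close>

definition discrete_rv :: "'a measure \<Rightarrow> ('a \<Rightarrow> 'b) \<Rightarrow> bool" where
  "discrete_rv M X \<longleftrightarrow> X \<in> measurable M (count_space UNIV) \<and> countable (range X)"

lemma discrete_rv_finitely_determined:
  fixes F :: "(nat \<times> nat \<Rightarrow> nat) \<Rightarrow> 'b"
  assumes "finitely_determined F"
  shows "discrete_rv (samples n) F"
proof -
  obtain S where S: "finite S" and F: "\<And>\<omega> \<omega>'. (\<forall>p\<in>S. \<omega> p = \<omega>' p) \<Longrightarrow> F \<omega> = F \<omega>'"
    using assms unfolding finitely_determined_def by blast
  let ?R = "PiE S (\<lambda>_. UNIV :: nat set)"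
  have R: "countable ?R" using S by (intro countable_PiE) auto
  have Fr: "F = (\<lambda>\<omega>. F (restrict \<omega> S))" by (rule ext, rule F) auto
  have "(\<lambda>\<omega>. restrict \<omega> S) \<in> measurable (samples n) (count_space ?R)"
    unfolding measurable_count_space_eq_countable[OF R]
  proof (intro conjI ballI)
    fix b assume b: "b \<in> ?R"
    have "(\<lambda>\<omega>. restrict \<omega> S) -` {b} \<inter> space (samples n) = {\<omega> \<in> space (samples n). \<forall>p\<in>S. \<omega> p = b p}"
      using b by (auto simp: fun_eq_iff restrict_def PiE_iff extensional_def)
    also have "\<dots> \<in> sets (samples n)"
    proof (rule sets.sets_Collect_finite_All[OF _ S])
      fix p assume "p \<in> S"
      show "{\<omega> \<in> space (samples n). \<omega> p = b p} \<in> sets (samples n)"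
        using measurable_sets[OF measurable_coordinate, of "{b p}" p n] by (simp add: vimage_def)
    qed
    finally show "(\<lambda>\<omega>. restrict \<omega> S) -` {b} \<inter> space (samples n) \<in> sets (samples n)" .
  qed auto
  then have "(\<lambda>\<omega>. F (restrict \<omega> S)) \<in> measurable (samples n) (count_space UNIV)"
    by (rule measurable_compose) simp
  then have "F \<in> measurable (samples n) (count_space UNIV)"
    by (simp only: Fr[symmetric])
  moreover have "range F \<subseteq> F ` ?R"
  proof
    fix y assume "y \<in> range F"
    then obtain \<omega> where "y = F \<omega>" by auto
    then have "y = F (restrict \<omega> S)" using fun_cong[OF Fr, of \<omega>] by simp
    then show "y \<in> F ` ?R" by auto
  qed
  then have "countable (range F)" using R by (meson countable_image countable_subset)
  ultimately show ?thesis unfolding discrete_rv_def ..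
qed

lemma discrete_rv_compose:
  assumes X: "discrete_rv M X" and Y: "\<And>x. discrete_rv M (Y x)"
  shows "discrete_rv M (\<lambda>\<omega>. Y (X \<omega>) \<omega>)"
proof -
  have "X \<in> measurable M (count_space (range X))"
    using X unfolding discrete_rv_def by (auto simp: measurable_def)
  then have "(\<lambda>\<omega>. Y (X \<omega>) \<omega>) \<in> measurable M (count_space UNIV)"
    using X Y unfolding discrete_rv_def
    by (intro measurable_compose_countable'[where f = Y and g = X and I = "range X"]) simp_all
  moreover have "range (\<lambda>\<omega>. Y (X \<omega>) \<omega>) \<subseteq> (\<Union>x\<in>range X. range (Y x))" by auto
  moreover have "countable (\<Union>x\<in>range X. range (Y x))"
    using X Y unfolding discrete_rv_def by (intro countable_UN) simp_all
  ultimately show ?thesis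
    unfolding discrete_rv_def by (meson countable_subset)
qed

lemma measurable_discrete_compose:
  assumes X: "discrete_rv M X" and Y: "\<And>x. Y x \<in> measurable M N"
  shows "(\<lambda>\<omega>. Y (X \<omega>) \<omega>) \<in> measurable M N"
proof -
  have "X \<in> measurable M (count_space (range X))"
    using X unfolding discrete_rv_def by (auto simp: measurable_def)
  then show ?thesis
    using X Y unfolding discrete_rv_def
    by (intro measurable_compose_countable'[where f = Y and g = X and I = "range X"]) simp_all
qed

lemma borel_measurable_finitely_determined:
  fixes F :: "(nat \<times> nat \<Rightarrow> nat) \<Rightarrow> 'b::topological_space"
  assumes "finitely_determined F"
  shows "F \<in> borel_measurable (samples n)"
  using discrete_rv_finitely_determined[OF assms, of n]
  unfolding discrete_rv_def using measurable_compose[of F "samples n" "count_space UNIV" "\<lambda>x. x" borel] by simp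

lemma integrable_finitely_determined:
  fixes F :: "(nat \<times> nat \<Rightarrow> nat) \<Rightarrow> real"
  assumes F: "finitely_determined F" and n: "0 < n"
  shows "integrable (samples n) F"
proof -
  interpret prob_space "samples n" by (rule prob_space_samples)
  obtain S where S: "finite S" and Fd: "\<And>\<omega> \<omega>'. (\<forall>p\<in>S. \<omega> p = \<omega>' p) \<Longrightarrow> F \<omega> = F \<omega>'"
    using F unfolding finitely_determined_def by blast
  let ?R = "PiE S (\<lambda>_. {..<n})"
  have R: "finite ?R" using S by (intro finite_PiE) auto
  have bound: "norm (F \<omega>) \<le> (\<Sum>b\<in>?R. \<bar>F b\<bar>)" if "\<forall>p. \<omega> p < n" for \<omega>
  proof -
    have "F \<omega> = F (restrict \<omega> S)" by (rule Fd) auto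
    moreover have "restrict \<omega> S \<in> ?R" using that by auto
    ultimately show ?thesis using member_le_sum[of "restrict \<omega> S" ?R "\<lambda>b. \<bar>F b\<bar>"] R by simp
  qed
  have "AE \<omega> in samples n. norm (F \<omega>) \<le> (\<Sum>b\<in>?R. \<bar>F b\<bar>)"
    using AE_samples_less[OF n] by (rule eventually_mono) (rule bound)
  then show ?thesis
    by (rule integrable_const_bound[OF _ borel_measurable_finitely_determined[OF F]])
qed

section \<open>Expected progress of one run\<close>

text \<open>The first iteration moves all coordinates at once, so samples \<open>2, \<dots>, l\<close> determine the iterates up to \<open>l\<close>.\<close>

lemma si_cong:
  assumes "\<And>i. 2 \<le> i \<Longrightarrow> i \<le> l \<Longrightarrow> j i = j' i"
  shows "si_x A x0 j l = si_x A x0 j' l \<and> si_y A x0 j l = si_y A x0 j' l \<and> si_ybar A x0 j l = si_ybar A x0 j' l"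
  using assms
proof (induction l rule: less_induct)
  case (less l)
  show ?case
  proof (cases "l = 0")
    case True
    then show ?thesis by (simp add: si_x.simps[of A x0 _ 0] si_y.simps[of A x0 _ 0] si_ybar.simps[of A x0 _ 0])
  next
    case False
    have IH: "si_x A x0 j i = si_x A x0 j' i" "si_y A x0 j i = si_y A x0 j' i" "si_ybar A x0 j i = si_ybar A x0 j' i"
      if "i < l" for i
      using less.IH[OF that] less.prems that by auto
    have sx: "(\<Sum>i = 2..l. real (dim_col A) * step (dim_col A) i *
             ((transpose_mat A *\<^sub>v si_ybar A x0 j (i - 1) - ones_vec (dim_col A)) \<bullet> ((x $ j i) \<cdot>\<^sub>v unit_vec (dim_col A) (j i))))
      = (\<Sum>i = 2..l. real (dim_col A) * step (dim_col A) i *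
             ((transpose_mat A *\<^sub>v si_ybar A x0 j' (i - 1) - ones_vec (dim_col A)) \<bullet> ((x $ j' i) \<cdot>\<^sub>v unit_vec (dim_col A) (j' i))))" for x
      using IH(3) less.prems by (intro sum.cong) auto
    have x: "si_x A x0 j l = si_x A x0 j' l"
      unfolding si_x.simps[of A x0 j l] si_x.simps[of A x0 j' l]
      using False IH(3)[of 0] by (simp only: Let_def if_False sx neq0_conv)
    have x': "si_x A x0 j i = si_x A x0 j' i" if "i \<le> l" for i
      using that x IH(1)[of i] by (cases "i = l") auto
    have sy: "(\<Sum>i = 2..l. step (dim_col A) i *
             ((transpose_mat A *\<^sub>v y - ones_vec (dim_col A))
               \<bullet> (real (dim_col A) \<cdot>\<^sub>v si_x A x0 j i - (real (dim_col A) - 1) \<cdot>\<^sub>v si_x A x0 j (i - 1))))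
      = (\<Sum>i = 2..l. step (dim_col A) i *
             ((transpose_mat A *\<^sub>v y - ones_vec (dim_col A))
               \<bullet> (real (dim_col A) \<cdot>\<^sub>v si_x A x0 j' i - (real (dim_col A) - 1) \<cdot>\<^sub>v si_x A x0 j' (i - 1))))" for y
      using x' by (intro sum.cong) auto
    have y: "si_y A x0 j l = si_y A x0 j' l"
      unfolding si_y.simps[of A x0 j l] si_y.simps[of A x0 j' l]
      using False x'[of 1] by (simp only: Let_def if_False sy neq0_conv)
    moreover have "si_ybar A x0 j l = si_ybar A x0 j' l"
      unfolding si_ybar.simps[of A x0 j l] si_ybar.simps[of A x0 j' l]
      using False y IH(2)[of "l - 1"] by (simp add: Let_def)
    ultimately show ?thesis using x by blast
  qed
qed

lemma si_out_cong:
  assumes "\<And>i. 2 \<le> i \<Longrightarrow> i \<le> l \<Longrightarrow> j i = j' i"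
  shows "si_out A x0 j l = si_out A x0 j' l"
  using assms
proof (induction A x0 j l rule: si_out.induct)
  case (3 A x0 j l)
  then have "si_x A x0 j (Suc (Suc l)) = si_x A x0 j' (Suc (Suc l))" "si_x A x0 j (Suc l) = si_x A x0 j' (Suc l)"
    by (auto intro!: si_cong[THEN conjunct1])
  with 3 show ?case by (simp add: Let_def)
qed (auto intro!: si_cong[THEN conjunct1])

lemma si_noise_cong:
  assumes "\<And>i'. 2 \<le> i' \<Longrightarrow> i' < i \<Longrightarrow> j i' = j' i'"
  shows "si_slope A x0 j (i - 1) = si_slope A x0 j' (i - 1)" "si_x A x0 j (i - 1) = si_x A x0 j' (i - 1)"
  using si_cong[of "i - 1" j j' A x0] assms by (auto simp: si_slope_def)

lemma finitely_determined_si_out: "finitely_determined (\<lambda>\<omega>. si_out A x0 (\<lambda>i. \<omega> (k, i)) l)"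
  by (rule finitely_determinedI[of "Pair k ` {..l}"]) (auto intro!: si_out_cong)

lemma finitely_determined_si_noise:
  fixes k :: 'a
  shows "finitely_determined (\<lambda>\<omega>. si_noise A x0 (\<lambda>i. \<omega> (k, i)) i z)"
proof (rule finitely_determinedI[of "Pair k ` {..i}"])
  fix \<omega> \<omega>' :: "'a \<times> nat \<Rightarrow> nat" assume "\<And>p. p \<in> Pair k ` {..i} \<Longrightarrow> \<omega> p = \<omega>' p"
  then have e: "\<omega> (k, l) = \<omega>' (k, l)" if "l \<le> i" for l using that by auto
  show "si_noise A x0 (\<lambda>i. \<omega> (k, i)) i z = si_noise A x0 (\<lambda>i. \<omega>' (k, i)) i z"
    using si_noise_cong[of i "\<lambda>i. \<omega> (k, i)" "\<lambda>i. \<omega>' (k, i)" A x0] e unfolding si_noise_def by simp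
qed simp

lemma stops_at_cong:
  assumes "\<And>i. 2 \<le> i \<Longrightarrow> i \<le> l \<Longrightarrow> j i = j' i"
  shows "stops_at A x j l = stops_at A x j' l"
proof -
  have "si_out A x j l = si_out A x j' l" by (rule si_out_cong) (rule assms)
  then show ?thesis by (simp add: stops_at_def)
qed

lemma finitely_determined_stops_at: "finitely_determined (\<lambda>\<omega>. stops_at A x (\<lambda>i. \<omega> (k, i)) l)"
  by (rule finitely_determinedI[of "Pair k ` {..l}"]) (auto intro!: stops_at_cong)

lemma sets_not_stopped: "{\<omega>. \<not> stops_at A x (\<lambda>i. \<omega> (k, i)) l} \<in> sets (samples n)"
  using discrete_rv_finitely_determined[OF finitely_determined_stops_at, of n A x k l]
  by (auto simp: discrete_rv_def dest!: measurable_sets[of _ _ _ "{False}"] simp: vimage_def)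

context nnls
begin

text \<open>Resampling the draw of iteration \<open>i\<close> alone freezes the slope and the previous iterate, and the
average of the sampled term over the \<open>n\<close> coordinates is the term subtracted from it.\<close>

lemma integral_noise:
  assumes n: "0 < n" and i: "2 \<le> i"
  shows "(\<integral>\<omega>. si_noise A x0 (\<lambda>l. \<omega> (k, l)) i z \<partial>samples n) = 0"
proof -
  have "(\<integral>\<omega>'. si_noise A x0 (\<lambda>l. mix {(k, i)} \<omega> \<omega>' (k, l)) i z \<partial>samples n) = 0" for \<omega>
  proof -
    define s x where "s = si_slope A x0 (\<lambda>l. \<omega> (k, l)) (i - 1)" and "x = si_x A x0 (\<lambda>l. \<omega> (k, l)) (i - 1)"
    define h where "h c = real n * (s c * (z $ c - x $ c)) - (\<Sum>c<n. s c * (z $ c - x $ c))" for c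
    have "si_noise A x0 (\<lambda>l. mix {(k, i)} \<omega> \<omega>' (k, l)) i z = h (\<omega>' (k, i))" for \<omega>'
    proof -
      have "si_slope A x0 (\<lambda>l. mix {(k, i)} \<omega> \<omega>' (k, l)) (i - 1) = s"
        "si_x A x0 (\<lambda>l. mix {(k, i)} \<omega> \<omega>' (k, l)) (i - 1) = x"
        unfolding s_def x_def by (rule si_noise_cong; simp add: mix_def)+
      then show ?thesis by (simp add: si_noise_def h_def) (simp add: mix_def)
    qed
    then have "(\<integral>\<omega>'. si_noise A x0 (\<lambda>l. mix {(k, i)} \<omega> \<omega>' (k, l)) i z \<partial>samples n) = (\<Sum>c<n. h c) / real n"
      using integral_coordinate[OF n, of h "(k, i)"] by simp
    also have "(\<Sum>c<n. h c) = 0"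
      by (simp add: h_def sum_subtractf flip: sum_distrib_left)
    finally show ?thesis by simp
  qed
  then show ?thesis
    by (subst integral_resample[of _ _ "{(k, i)}"]) (simp_all add: integrable_finitely_determined finitely_determined_si_noise n)
qed

lemma expected_gap:
  assumes n: "4 \<le> n" and x0: "x0 \<in> box A" and z: "z \<in> box A" and l: "1 \<le> l"
  shows "step_sum n l * (\<integral>\<omega>. nnls_obj A (si_out A x0 (\<lambda>i. \<omega> (k, i)) l) - nnls_obj A z \<partial>samples n) \<le> dist_sq z x0"
proof -
  interpret prob_space "samples n" by (rule prob_space_samples)
  have n0: "0 < n" using n by simp
  let ?j = "\<lambda>\<omega> i. \<omega> (k, i)"
  have int: "integrable (samples n) (\<lambda>\<omega>. nnls_obj A (si_out A x0 (?j \<omega>) l) - nnls_obj A z)"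
    by (intro integrable_finitely_determined n0 finitely_determined_compose[OF finitely_determined_si_out])
  have intn: "integrable (samples n) (\<lambda>\<omega>. si_noise A x0 (?j \<omega>) i z)" for i
    by (intro integrable_finitely_determined n0 finitely_determined_si_noise)
  have "AE \<omega> in samples n. step_sum n l * (nnls_obj A (si_out A x0 (?j \<omega>) l) - nnls_obj A z)
     \<le> dist_sq z x0 + (\<Sum>i=2..l. step n i * si_noise A x0 (?j \<omega>) i z)"
    using AE_samples_less[OF n0]
  proof eventually_elim
    case (elim \<omega>)
    interpret nnls_run A m n x0 "?j \<omega>"
      by unfold_locales (use n x0 elim in auto)
    show ?case by (rule gap_le_noise[OF l z])
  qed
  then have "(\<integral>\<omega>. step_sum n l * (nnls_obj A (si_out A x0 (?j \<omega>) l) - nnls_obj A z) \<partial>samples n)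
     \<le> (\<integral>\<omega>. dist_sq z x0 + (\<Sum>i=2..l. step n i * si_noise A x0 (?j \<omega>) i z) \<partial>samples n)"
    by (intro integral_mono_AE) (auto intro!: int intn integrable_mult_right Bochner_Integration.integrable_sum
        Bochner_Integration.integrable_add simp: emeasure_space_1)
  also have "\<dots> = dist_sq z x0 + (\<Sum>i=2..l. step n i * (\<integral>\<omega>. si_noise A x0 (?j \<omega>) i z \<partial>samples n))"
  proof -
    have i: "integrable (samples n) (\<lambda>\<omega>. step n i * si_noise A x0 (?j \<omega>) i z)" for i
      by (intro integrable_mult_right intn)
    show ?thesis
      using i prob_space by (simp add: Bochner_Integration.integral_sum[OF i])
  qed
  also have "\<dots> = dist_sq z x0"
    by (simp add: integral_noise[OF n0])
  finally show ?thesis using int by simp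
qed

text \<open>Markov's inequality for the squared residual, which \<open>residual_sq_le_gap\<close> bounds by the gap. The
distance in \<open>expected_gap\<close> is that from \<open>x0\<close> to its nearest minimizer, which the error bound
compares with the residual of \<open>x0\<close>.\<close>

lemma prob_not_stopped:
  assumes n: "4 \<le> n" and x0: "x0 \<in> box A" and mu: "error_bound_constant A \<mu>" and l: "1 \<le> l"
  shows "measure (samples n) {\<omega>. \<not> stops_at A x0 (\<lambda>i. \<omega> (k, i)) l} \<le> 4 * real n / (\<mu>\<^sup>2 * step_sum n l)"
proof -
  interpret prob_space "samples n" by (rule prob_space_samples)
  have n0: "0 < n" using n by simp
  have mu0: "0 < \<mu>" using mu by (simp add: error_bound_constant_def)
  have Sp: "0 < step_sum n l" by (rule step_sum_pos[OF n l])
  let ?j = "\<lambda>\<omega> i. \<omega> (k, i)"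
  let ?T = "\<lambda>\<omega>. si_out A x0 (?j \<omega>) l"
  let ?E = "{\<omega>. \<not> stops_at A x0 (?j \<omega>) l}"
  define r0 where "r0 = residual A x0"
  have r0: "0 \<le> r0" by (simp add: r0_def residual_nonneg)
  obtain xs where xs: "is_arg_min (\<lambda>z. scaled_norm A (x0 - z)) (is_nnls_minimizer A) xs"
    using ex_nearest_minimizer[OF box_imp_carrier[OF x0]] ..
  then have xm: "is_nnls_minimizer A xs" by (simp add: is_arg_min_def)
  then have xb: "xs \<in> box A" by (rule minimizer_in_box)
  have "\<mu> * scaled_norm A (x0 - xs) \<le> r0"
    using mu xs box_imp_carrier[OF x0] by (simp add: error_bound_constant_def r0_def)
  then have "(\<mu> * scaled_norm A (x0 - xs))\<^sup>2 \<le> r0\<^sup>2"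
    using mu0 by (intro power_mono) (auto simp: scaled_norm_nonneg)
  moreover have "(scaled_norm A (x0 - xs))\<^sup>2 = 2 * dist_sq xs x0"
    unfolding scaled_norm_diff_sq[OF box_imp_carrier[OF x0] box_imp_carrier[OF xb]]
    by (simp add: dist_sq_def power2_commute)
  ultimately have D: "2 * dist_sq xs x0 \<le> r0\<^sup>2 / \<mu>\<^sup>2"
    using mu0 by (simp add: power_mult_distrib field_simps)
  have int: "integrable (samples n) (\<lambda>\<omega>. nnls_obj A (?T \<omega>) - nnls_obj A xs)"
    by (intro integrable_finitely_determined n0 finitely_determined_compose[OF finitely_determined_si_out])
  have intr: "integrable (samples n) (\<lambda>\<omega>. (residual A (?T \<omega>))\<^sup>2)"
    by (intro integrable_finitely_determined n0 finitely_determined_compose[OF finitely_determined_si_out])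
  have box: "AE \<omega> in samples n. ?T \<omega> \<in> box A"
    using AE_samples_less[OF n0]
  proof eventually_elim
    case (elim \<omega>)
    interpret nnls_run A m n x0 "?j \<omega>"
      by unfold_locales (use n x0 elim in auto)
    show ?case by (rule T_box[OF l])
  qed
  have "(\<integral>\<omega>. (residual A (?T \<omega>))\<^sup>2 \<partial>samples n) \<le> (\<integral>\<omega>. 2 * real n * (nnls_obj A (?T \<omega>) - nnls_obj A xs) \<partial>samples n)"
    using box by (intro integral_mono_AE intr integrable_mult_right int)
      (auto elim!: eventually_mono intro: residual_sq_le_gap[OF _ xm] box_imp_orthant)
  also have "\<dots> = 2 * real n * (\<integral>\<omega>. nnls_obj A (?T \<omega>) - nnls_obj A xs \<partial>samples n)"
    by simp
  also have "\<dots> \<le> 2 * real n * (dist_sq xs x0 / step_sum n l)"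
    using expected_gap[OF n x0 xb l, of k] Sp by (intro mult_left_mono) (auto simp: field_simps)
  also have "\<dots> = real n / step_sum n l * (2 * dist_sq xs x0)" by simp
  also have "\<dots> \<le> real n / step_sum n l * (r0\<^sup>2 / \<mu>\<^sup>2)"
    using D Sp by (intro mult_left_mono) auto
  finally have E: "(\<integral>\<omega>. (residual A (?T \<omega>))\<^sup>2 \<partial>samples n) \<le> real n / step_sum n l * (r0\<^sup>2 / \<mu>\<^sup>2)" .
  have Em: "?E \<in> sets (samples n)"
    by (rule sets_not_stopped)
  show ?thesis
  \<comment> \<open>If \<open>x0\<close> is already optimal, Markov's inequality is void, but the expected squared residual is zero.\<close>
  proof (cases "r0 = 0")
    case True
    have "(\<integral>\<omega>. (residual A (?T \<omega>))\<^sup>2 \<partial>samples n) = 0"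
    proof (rule antisym)
      show "(\<integral>\<omega>. (residual A (?T \<omega>))\<^sup>2 \<partial>samples n) \<le> 0" using E True by simp
    qed simp
    then have "AE \<omega> in samples n. (residual A (?T \<omega>))\<^sup>2 = 0"
      using integral_nonneg_eq_0_iff_AE[OF intr] by simp
    then have "AE \<omega> in samples n. \<omega> \<notin> ?E"
      by (rule eventually_mono) (use True l in \<open>auto simp: stops_at_def r0_def\<close>)
    then have "measure (samples n) ?E = 0" using Em by (simp add: prob_eq_0)
    then show ?thesis using mu0 Sp by simp
  next
    case False
    then have r0p: "0 < r0" using r0 by simp
    have "measure (samples n) ?E = (\<integral>\<omega>. indicator ?E \<omega> \<partial>samples n)" using Em by simp
    also have "\<dots> \<le> (\<integral>\<omega>. 4 / r0\<^sup>2 * (residual A (?T \<omega>))\<^sup>2 \<partial>samples n)"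
    proof (rule integral_mono)
      fix \<omega>
      show "indicator ?E \<omega> \<le> 4 / r0\<^sup>2 * (residual A (?T \<omega>))\<^sup>2"
      proof (cases "\<omega> \<in> ?E")
        case True
        then have "r0 / 2 \<le> residual A (?T \<omega>)" using l by (simp add: stops_at_def r0_def)
        then have "(r0 / 2)\<^sup>2 \<le> (residual A (?T \<omega>))\<^sup>2" using r0 by (intro power_mono) auto
        then show ?thesis using True r0p by (simp add: field_simps)
      qed simp
    next
      show "integrable (samples n) (indicator ?E :: _ \<Rightarrow> real)"
        by (intro integrable_real_indicator Em) (simp add: emeasure_eq_measure)
    qed (use intr in auto)
    also have "\<dots> = 4 / r0\<^sup>2 * (\<integral>\<omega>. (residual A (?T \<omega>))\<^sup>2 \<partial>samples n)" by simp
    also have "\<dots> \<le> 4 / r0\<^sup>2 * (real n / step_sum n l * (r0\<^sup>2 / \<mu>\<^sup>2))"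
      using E by (intro mult_left_mono) auto
    also have "\<dots> = 4 * real n / (\<mu>\<^sup>2 * step_sum n l)" using r0p by simp
    finally show ?thesis .
  qed
qed

end

section \<open>Expected cost of runs and restarts\<close>

text \<open>Charge for iteration \<open>l + 1\<close>. It is waived if the stopping test holds after iteration \<open>l\<close>; a test
passed earlier is ignored, which can only enlarge the charge.\<close>

definition iter_bound :: "real \<Rightarrow> real mat \<Rightarrow> real vec \<Rightarrow> (nat \<Rightarrow> nat) \<Rightarrow> nat \<Rightarrow> real" where
  "iter_bound K A x j l =
    (if l = 0 then K * real (nnz A)
     else if stops_at A x j l then 0
     else K * real (nnz_vec (col A (j (Suc l)))))"

definition run_bound :: "real \<Rightarrow> real mat \<Rightarrow> real vec \<Rightarrow> (nat \<Rightarrow> nat) \<Rightarrow> ennreal" where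
  "run_bound K A x j = (\<Sum>l. ennreal (iter_bound K A x j l))"

lemma finitely_determined_iter_bound:
  fixes k :: 'a
  shows "finitely_determined (\<lambda>\<omega>. iter_bound K A x (\<lambda>i. \<omega> (k, i)) l)"
proof (rule finitely_determinedI[of "Pair k ` {..Suc l}"], simp)
  fix \<omega> \<omega>' :: "'a \<times> nat \<Rightarrow> nat" assume "\<And>p. p \<in> Pair k ` {..Suc l} \<Longrightarrow> \<omega> p = \<omega>' p"
  then have e: "\<omega> (k, i) = \<omega>' (k, i)" if "i \<le> Suc l" for i using that by auto
  have "stops_at A x (\<lambda>i. \<omega> (k, i)) l = stops_at A x (\<lambda>i. \<omega>' (k, i)) l"
    by (rule stops_at_cong) (simp add: e)
  then show "iter_bound K A x (\<lambda>i. \<omega> (k, i)) l = iter_bound K A x (\<lambda>i. \<omega>' (k, i)) l"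
    using e[of "Suc l"] by (simp add: iter_bound_def)
qed

lemma suminf_ennreal_ge_1: assumes "\<And>l. 1 \<le> f l" shows "(\<Sum>l. f l :: ennreal) = \<infinity>"
proof (rule ccontr)
  assume "suminf f \<noteq> \<infinity>"
  then obtain N :: nat where "suminf f < of_nat N"
    using ennreal_Ex_less_of_nat[of "suminf f"] by (auto simp: top.not_eq_extremum)
  moreover have "(\<Sum>l<N. 1) \<le> (\<Sum>l<N. f l)" by (intro sum_mono assms)
  moreover have "(\<Sum>l<N. f l) \<le> suminf f" by (rule sum_le_suminf) auto
  ultimately show False by simp
qed

lemma restart_point_cong:
  assumes "\<And>k' l. k' \<le> k \<Longrightarrow> \<omega> (k', l) = \<omega>' (k', l)"
  shows "restart_point A \<omega> k = restart_point A \<omega>' k"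
  using assms
proof (induction k)
  case (Suc k)
  have "(\<lambda>l. \<omega> (Suc k, l)) = (\<lambda>l. \<omega>' (Suc k, l))" using Suc.prems by auto
  with Suc show ?case by (simp add: Let_def)
qed simp

text \<open>For \<open>\<omega>\<close> on which the run never stops, the least element of the empty set is some fixed number, so
measurability holds without an exception.\<close>

lemma discrete_rv_run_length:
  "discrete_rv (samples n) (\<lambda>\<omega>. run_length A x (\<lambda>l. \<omega> (k, l)))"
proof -
  have "(\<lambda>\<omega>. stops_at A x (\<lambda>i. \<omega> (k, i)) l) \<in> measurable (samples n) (count_space UNIV)" for l
    using discrete_rv_finitely_determined[OF finitely_determined_stops_at] by (simp add: discrete_rv_def)
  then have "(\<lambda>\<omega>. run_length A x (\<lambda>l. \<omega> (k, l))) \<in> measurable (samples n) (count_space UNIV)"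
    unfolding run_length_def by (intro measurable_Least) simp
  then show ?thesis by (simp add: discrete_rv_def)
qed

lemma discrete_rv_restart_point: "discrete_rv (samples n) (\<lambda>\<omega>. restart_point A \<omega> k)"
proof (induction k)
  case 0
  show ?case by (simp add: discrete_rv_def)
next
  case (Suc k)
  have "discrete_rv (samples n) (\<lambda>\<omega>. si_out A x (\<lambda>l. \<omega> (Suc k, l)) (run_length A x (\<lambda>l. \<omega> (Suc k, l))))" for x
    by (rule discrete_rv_compose[OF discrete_rv_run_length, where Y = "\<lambda>l \<omega>. si_out A x (\<lambda>i. \<omega> (Suc k, i)) l"])
       (rule discrete_rv_finitely_determined[OF finitely_determined_si_out])
  then show ?case
    using discrete_rv_compose[OF Suc, where Y = "\<lambda>x \<omega>. si_out A x (\<lambda>l. \<omega> (Suc k, l)) (run_length A x (\<lambda>l. \<omega> (Suc k, l)))"]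
    by (simp add: Let_def)
qed

lemma residual_restart_point:
  assumes "\<And>i. 1 \<le> i \<Longrightarrow> i \<le> k \<Longrightarrow> \<exists>l. stops_at A (restart_point A \<omega> (i - 1)) (\<lambda>l. \<omega> (i, l)) l"
  shows "residual A (restart_point A \<omega> k) \<le> (1 / 2) ^ k * residual A (0\<^sub>v (dim_col A))"
  using assms
proof (induction k)
  case (Suc k)
  let ?x = "restart_point A \<omega> k" and ?j = "\<lambda>l. \<omega> (Suc k, l)"
  have "\<exists>l. stops_at A ?x ?j l" using Suc.prems[of "Suc k"] by simp
  then have "stops_at A ?x ?j (run_length A ?x ?j)"
    unfolding run_length_def by (rule LeastI_ex)
  then have "residual A (restart_point A \<omega> (Suc k)) \<le> 1 / 2 * residual A ?x"
    by (simp add: stops_at_def Let_def)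
  also have "\<dots> \<le> 1 / 2 * ((1 / 2) ^ k * residual A (0\<^sub>v (dim_col A)))"
    using Suc by (intro mult_left_mono) auto
  finally show ?case by simp
qed simp

context nnls
begin

lemma nnz_eq_sum: "real (nnz A) = (\<Sum>c<n. real (nnz_vec (col A c)))"
proof -
  have "card {(i, c). i < m \<and> c < n \<and> A $$ (i, c) \<noteq> 0} = card (SIGMA c:{..<n}. {i. i < m \<and> A $$ (i, c) \<noteq> 0})"
    by (rule bij_betw_same_card[of prod.swap]) (auto simp: bij_betw_def inj_on_def image_def)
  also have "\<dots> = (\<Sum>c<n. card {i. i < m \<and> A $$ (i, c) \<noteq> 0})"
    by (rule card_SigmaI) auto
  also have "\<dots> = (\<Sum>c<n. nnz_vec (col A c))"
    by (intro sum.cong) (auto simp: nnz_vec_def intro!: arg_cong[where f = card])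
  finally show ?thesis by (simp add: nnz_def)
qed

lemma nnz_vec_pos: assumes c: "c < n" shows "1 \<le> nnz_vec (col A c)"
proof -
  have "col A c \<noteq> 0\<^sub>v m" using nondegenerate c by (auto simp: nonneg_nondegenerate_def)
  then have "{i. i < dim_vec (col A c) \<and> col A c $ i \<noteq> 0} \<noteq> {}" by (auto simp: vec_eq_iff)
  then show ?thesis by (simp add: nnz_vec_def card_gt_0_iff Suc_le_eq)
qed

lemma nnz_pos: assumes "0 < n" shows "1 \<le> real (nnz A)"
proof -
  have "1 \<le> real (nnz_vec (col A 0))" using nnz_vec_pos[OF assms] by simp
  also have "\<dots> \<le> real (nnz A)"
    unfolding nnz_eq_sum using assms by (intro member_le_sum) auto
  finally show ?thesis .
qed

text \<open>Every column has a nonzero entry, so each iteration is charged at least \<open>1\<close>, and a run that never stops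
is charged an infinite amount, in agreement with its cost.\<close>

lemma run_cost_le_run_bound:
  assumes ops: "lazy_op_count K0 A ops" and K: "1 \<le> K" "K0 \<le> K" and k: "1 \<le> k"
    and \<omega>: "\<And>p. \<omega> p < n" and n: "0 < n"
  shows "run_cost A ops \<omega> k \<le> run_bound K A (restart_point A \<omega> (k - 1)) (\<lambda>l. \<omega> (k, l))"
proof -
  let ?x = "restart_point A \<omega> (k - 1)" and ?j = "\<lambda>l. \<omega> (k, l)"
  let ?b = "iter_bound K A ?x ?j"
  have scale: "K0 * real a \<le> K * real a" for a using K by (intro mult_right_mono) auto
  have "\<forall>k\<ge>1. \<forall>\<omega>. (\<forall>p. \<omega> p < n) \<longrightarrow> real (ops k 1 \<omega>) \<le> K0 * real (nnz A) \<and>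
      (\<forall>l\<ge>2. real (ops k l \<omega>) \<le> K0 * real (nnz_vec (col A (\<omega> (k, l)))))"
    using ops by (simp add: lazy_op_count_def)
  then have K0: "real (ops k 1 \<omega>) \<le> K0 * real (nnz A)"
    "\<forall>l\<ge>2. real (ops k l \<omega>) \<le> K0 * real (nnz_vec (col A (\<omega> (k, l))))"
    using k \<omega> by blast+
  have o1: "real (ops k 1 \<omega>) \<le> K * real (nnz A)"
    using K0(1) scale[of "nnz A"] by linarith
  have ol: "real (ops k l \<omega>) \<le> K * real (nnz_vec (col A (\<omega> (k, l))))" if "2 \<le> l" for l
    using K0(2)[rule_format, OF that] scale[of "nnz_vec (col A (\<omega> (k, l)))"] by linarith
  show ?thesis
  proof (cases "\<exists>l. stops_at A ?x ?j l")
    case True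
    let ?L = "run_length A ?x ?j"
    have "of_nat (ops k (Suc l) \<omega>) \<le> ennreal (?b l)" if l: "l < ?L" for l
    proof -
      have "\<not> stops_at A ?x ?j l" using l unfolding run_length_def by (rule not_less_Least)
      then have "real (ops k (Suc l) \<omega>) \<le> ?b l"
        using o1 ol[of "Suc l"] by (cases "l = 0") (auto simp: iter_bound_def)
      then show ?thesis by (simp add: ennreal_of_nat_eq_real_of_nat ennreal_leI)
    qed
    then have "(\<Sum>l<?L. of_nat (ops k (Suc l) \<omega>)) \<le> (\<Sum>l<?L. ennreal (?b l))"
      by (intro sum_mono) auto
    also have "\<dots> \<le> run_bound K A ?x ?j" unfolding run_bound_def by (rule sum_le_suminf) auto
    also have "(\<Sum>l<?L. of_nat (ops k (Suc l) \<omega>)) = (\<Sum>l = 1..?L. of_nat (ops k l \<omega>) :: ennreal)"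
      by (simp add: sum.atLeast1_atMost_eq)
    finally show ?thesis using True by (simp add: run_cost_def Let_def)
  next
    case False
    have "1 \<le> ennreal (?b l)" for l
    proof -
      have "1 \<le> K * real a" if "1 \<le> real a" for a using mult_mono[of 1 K 1 "real a"] K that by simp
      then have "1 \<le> ?b l"
        using False nnz_pos[OF n] nnz_vec_pos[OF \<omega>] by (simp add: iter_bound_def)
      then show ?thesis by (metis ennreal_1 ennreal_leI)
    qed
    then have "run_bound K A ?x ?j = \<infinity>" unfolding run_bound_def by (rule suminf_ennreal_ge_1)
    then show ?thesis by simp
  qed
qed

text \<open>Whether iteration \<open>l + 1\<close> takes place is decided by the draws up to \<open>l\<close>. Resampling draw \<open>l + 1\<close>
alone thus averages the number of entries over all columns.\<close>

lemma expected_iter_bound: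
  assumes n: "0 < n" and K: "0 \<le> K" and l: "1 \<le> l"
  shows "(\<integral>\<^sup>+\<omega>. ennreal (iter_bound K A x (\<lambda>i. \<omega> (k, i)) l) \<partial>samples n)
    = ennreal (K * real (nnz A) / real n * measure (samples n) {\<omega>. \<not> stops_at A x (\<lambda>i. \<omega> (k, i)) l})"
proof -
  interpret prob_space "samples n" by (rule prob_space_samples)
  let ?E = "{\<omega>. \<not> stops_at A x (\<lambda>i. \<omega> (k, i)) l}"
  have Em: "?E \<in> sets (samples n)"
    by (rule sets_not_stopped)
  have meas: "(\<lambda>\<omega>. ennreal (iter_bound K A x (\<lambda>i. \<omega> (k, i)) l)) \<in> borel_measurable (samples n)"
    by (intro borel_measurable_finitely_determined finitely_determined_compose[OF finitely_determined_iter_bound])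
  have inner: "(\<integral>\<^sup>+\<omega>'. ennreal (iter_bound K A x (\<lambda>i. mix {(k, Suc l)} \<omega> \<omega>' (k, i)) l) \<partial>samples n)
    = ennreal (K * real (nnz A) / real n) * indicator ?E \<omega>" for \<omega>
  proof -
    have "stops_at A x (\<lambda>i. mix {(k, Suc l)} \<omega> \<omega>' (k, i)) l = stops_at A x (\<lambda>i. \<omega> (k, i)) l" for \<omega>'
      by (rule stops_at_cong) (simp add: mix_def)
    then have "iter_bound K A x (\<lambda>i. mix {(k, Suc l)} \<omega> \<omega>' (k, i)) l
      = (if \<omega> \<in> ?E then K * real (nnz_vec (col A (\<omega>' (k, Suc l)))) else 0)" for \<omega>'
      using l by (simp add: iter_bound_def) (simp add: mix_def)
    moreover have "(\<integral>\<^sup>+\<omega>'. ennreal (K * real (nnz_vec (col A (\<omega>' (k, Suc l))))) \<partial>samples n)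
      = ennreal (K * real (nnz A) / real n)"
      using nn_integral_coordinate[OF n, of "\<lambda>c. K * real (nnz_vec (col A c))" "(k, Suc l)"] K
      by (simp add: nnz_eq_sum sum_distrib_left)
    ultimately show ?thesis by (cases "\<omega> \<in> ?E") simp_all
  qed
  have "(\<integral>\<^sup>+\<omega>. ennreal (iter_bound K A x (\<lambda>i. \<omega> (k, i)) l) \<partial>samples n)
    = (\<integral>\<^sup>+\<omega>. ennreal (K * real (nnz A) / real n) * indicator ?E \<omega> \<partial>samples n)"
    unfolding inner[symmetric] by (rule nn_integral_resample[OF meas])
  also have "\<dots> = ennreal (K * real (nnz A) / real n) * emeasure (samples n) ?E"
    using Em by (rule nn_integral_cmult_indicator)
  finally show ?thesis
    using K by (simp only: emeasure_eq_measure) (subst ennreal_mult, auto)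
qed

lemma expected_run_bound:
  assumes n: "4 \<le> n" and K: "0 \<le> K" and x: "x \<in> box A" and mu: "error_bound_constant A \<mu>"
  shows "(\<integral>\<^sup>+\<omega>. run_bound K A x (\<lambda>l. \<omega> (k, l)) \<partial>samples n)
    \<le> ennreal (64 * K * (real (nnz A) * (ln (real n) + sqrt (real n) / \<mu>)))"
proof -
  have n0: "0 < n" using n by simp
  interpret prob_space "samples n" by (rule prob_space_samples)
  have mu0: "0 < \<mu>" using mu by (simp add: error_bound_constant_def)
  define E where "E l = (\<integral>\<^sup>+\<omega>. ennreal (iter_bound K A x (\<lambda>i. \<omega> (k, i)) l) \<partial>samples n)" for l
  define p where "p l = measure (samples n) {\<omega>. \<not> stops_at A x (\<lambda>i. \<omega> (k, i)) l}" for l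
  have meas: "(\<lambda>\<omega>. ennreal (iter_bound K A x (\<lambda>i. \<omega> (k, i)) l)) \<in> borel_measurable (samples n)" for l
    by (intro borel_measurable_finitely_determined finitely_determined_compose[OF finitely_determined_iter_bound])
  have E0: "E 0 = ennreal (K * real (nnz A))"
    by (simp add: E_def iter_bound_def emeasure_space_1[simplified])
  have El: "E l = ennreal (K * real (nnz A) / real n * p l)" if "1 \<le> l" for l
    unfolding E_def p_def by (rule expected_iter_bound[OF n0 K that])
  have part: "(\<Sum>l<N. E l) \<le> ennreal (64 * K * (real (nnz A) * (ln (real n) + sqrt (real n) / \<mu>)))" for N
  proof -
    have "(\<Sum>l=1..N. p l) \<le> 6 * real n * ln (real n) + 64 * real n * sqrt (real n) / \<mu>"
      by (rule sum_tail_bound[OF n mu0]) (auto simp: p_def prob_not_stopped[OF n x mu])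
    then have "K * real (nnz A) / real n * (\<Sum>l=1..N. p l)
      \<le> K * real (nnz A) / real n * (6 * real n * ln (real n) + 64 * real n * sqrt (real n) / \<mu>)"
      using K by (intro mult_left_mono) auto
    also have "\<dots> = K * real (nnz A) * (6 * ln (real n) + 64 * sqrt (real n) / \<mu>)"
      using n0 by (simp add: field_simps)
    finally have "K * real (nnz A) + K * real (nnz A) / real n * (\<Sum>l=1..N. p l)
      \<le> K * real (nnz A) * 1 + K * real (nnz A) * (6 * ln (real n) + 64 * sqrt (real n) / \<mu>)" by simp
    also have "\<dots> = K * real (nnz A) * (1 + 6 * ln (real n) + 64 * sqrt (real n) / \<mu>)"
      by (simp add: distrib_left)
    also have "\<dots> \<le> K * real (nnz A) * (64 * ln (real n) + 64 * sqrt (real n) / \<mu>)"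
      using K ln_ge_1[OF n] by (intro mult_left_mono) auto
    also have "\<dots> = 64 * K * (real (nnz A) * (ln (real n) + sqrt (real n) / \<mu>))"
      by (simp add: algebra_simps)
    finally have le: "K * real (nnz A) + K * real (nnz A) / real n * (\<Sum>l=1..N. p l)
      \<le> 64 * K * (real (nnz A) * (ln (real n) + sqrt (real n) / \<mu>))" .
    have "(\<Sum>l<N. E l) \<le> (\<Sum>l<Suc N. E l)" by simp
    also have "\<dots> = E 0 + (\<Sum>l=1..N. E l)" unfolding sum.lessThan_Suc_shift by (simp add: sum.atLeast1_atMost_eq)
    also have "\<dots> = ennreal (K * real (nnz A)) + (\<Sum>l=1..N. ennreal (K * real (nnz A) / real n * p l))"
      using El by (simp add: E0)
    also have "\<dots> = ennreal (K * real (nnz A) + K * real (nnz A) / real n * (\<Sum>l=1..N. p l))"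
      using K by (subst sum_ennreal)
        (auto simp: p_def sum_distrib_left intro!: sum_nonneg mult_nonneg_nonneg divide_nonneg_nonneg ennreal_plus[symmetric])
    also have "\<dots> \<le> ennreal (64 * K * (real (nnz A) * (ln (real n) + sqrt (real n) / \<mu>)))"
      by (rule ennreal_leI[OF le])
    finally show ?thesis .
  qed
  have "(\<integral>\<^sup>+\<omega>. run_bound K A x (\<lambda>l. \<omega> (k, l)) \<partial>samples n) = (\<Sum>l. E l)"
    unfolding run_bound_def E_def by (rule nn_integral_suminf[OF meas])
  also have "\<dots> = (SUP N. \<Sum>l<N. E l)" by (rule suminf_eq_SUP)
  also have "\<dots> \<le> ennreal (64 * K * (real (nnz A) * (ln (real n) + sqrt (real n) / \<mu>)))"
    by (rule SUP_least) (rule part)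
  finally show ?thesis .
qed

lemma restart_point_box:
  assumes n: "4 \<le> n" and \<omega>: "\<And>p. \<omega> p < n"
  shows "restart_point A \<omega> k \<in> box A"
proof (induction k)
  case 0
  show ?case using zero_in_box by simp
next
  case (Suc k)
  interpret nnls_run A m n "restart_point A \<omega> k" "\<lambda>l. \<omega> (Suc k, l)"
    by unfold_locales (use n \<omega> Suc in auto)
  have "T l \<in> box A" for l using T_box[of l] Suc by (cases l) auto
  then show ?case by (simp add: Let_def)
qed

text \<open>Resampling all draws of run \<open>Suc k\<close> freezes its starting point, which depends on earlier runs only.\<close>

lemma expected_run_bound_restart:
  assumes n: "4 \<le> n" and K: "0 \<le> K" and mu: "error_bound_constant A \<mu>"
  shows "(\<integral>\<^sup>+\<omega>. run_bound K A (restart_point A \<omega> k) (\<lambda>l. \<omega> (Suc k, l)) \<partial>samples n)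
    \<le> ennreal (64 * K * (real (nnz A) * (ln (real n) + sqrt (real n) / \<mu>)))"
    (is "?I \<le> ?B")
    and "(\<lambda>\<omega>. run_bound K A (restart_point A \<omega> k) (\<lambda>l. \<omega> (Suc k, l))) \<in> borel_measurable (samples n)"
proof -
  interpret prob_space "samples n" by (rule prob_space_samples)
  let ?J = "{Suc k} \<times> (UNIV :: nat set)"
  have "(\<lambda>\<omega>. run_bound K A x (\<lambda>l. \<omega> (Suc k, l))) \<in> borel_measurable (samples n)" for x
    unfolding run_bound_def
    by (rule borel_measurable_suminf_order)
       (intro borel_measurable_finitely_determined finitely_determined_compose[OF finitely_determined_iter_bound])
  then show meas: "(\<lambda>\<omega>. run_bound K A (restart_point A \<omega> k) (\<lambda>l. \<omega> (Suc k, l))) \<in> borel_measurable (samples n)"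
    by (rule measurable_discrete_compose[OF discrete_rv_restart_point, where Y = "\<lambda>x \<omega>. run_bound K A x (\<lambda>l. \<omega> (Suc k, l))"])
  have "?I = (\<integral>\<^sup>+\<omega>. \<integral>\<^sup>+\<omega>'. run_bound K A (restart_point A (mix ?J \<omega> \<omega>') k) (\<lambda>l. mix ?J \<omega> \<omega>' (Suc k, l)) \<partial>samples n \<partial>samples n)"
    by (rule nn_integral_resample[OF meas])
  also have "\<dots> = (\<integral>\<^sup>+\<omega>. \<integral>\<^sup>+\<omega>'. run_bound K A (restart_point A \<omega> k) (\<lambda>l. \<omega>' (Suc k, l)) \<partial>samples n \<partial>samples n)"
  proof -
    have "restart_point A (mix ?J \<omega> \<omega>') k = restart_point A \<omega> k" for \<omega> \<omega>'
      by (rule restart_point_cong) (auto simp: mix_def)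
    moreover have "(\<lambda>l. mix ?J \<omega> \<omega>' (Suc k, l)) = (\<lambda>l. \<omega>' (Suc k, l))" for \<omega> \<omega>' :: "nat \<times> nat \<Rightarrow> nat"
      by (simp add: mix_def)
    ultimately show ?thesis by simp
  qed
  also have "\<dots> \<le> (\<integral>\<^sup>+\<omega>. ?B \<partial>samples n)"
  proof (rule nn_integral_mono_AE)
    have "0 < n" using n by simp
    from AE_samples_less[OF this]
    show "AE \<omega> in samples n. (\<integral>\<^sup>+\<omega>'. run_bound K A (restart_point A \<omega> k) (\<lambda>l. \<omega>' (Suc k, l)) \<partial>samples n) \<le> ?B"
      by (rule eventually_mono) (intro expected_run_bound[OF n K _ mu] restart_point_box[OF n], auto)
  qed
  also have "\<dots> = ?B" using emeasure_space_1 by simp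
  finally show "?I \<le> ?B" .
qed

text \<open>If the first \<open>N\<close> runs all stop, the residual has been halved \<open>N\<close> times and the search ends by run \<open>N\<close>;
otherwise the right-hand side is infinite.\<close>

lemma cost_until_le:
  assumes ops: "lazy_op_count K0 A ops" and K: "1 \<le> K" "K0 \<le> K" and n: "0 < n"
    and \<omega>: "\<And>p. \<omega> p < n"
    and P: "residual A (restart_point A \<omega> N) \<le> (1 / 2) ^ N * residual A (0\<^sub>v n) \<Longrightarrow> P N"
  shows "cost_until A ops \<omega> P \<le> (\<Sum>k<N. run_bound K A (restart_point A \<omega> k) (\<lambda>l. \<omega> (Suc k, l)))"
proof -
  have cost: "run_cost A ops \<omega> (Suc k) \<le> run_bound K A (restart_point A \<omega> k) (\<lambda>l. \<omega> (Suc k, l))" for k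
    using run_cost_le_run_bound[OF ops K _ \<omega> n, of "Suc k"] by simp
  show ?thesis
  proof (cases "\<forall>k<N. \<exists>l. stops_at A (restart_point A \<omega> k) (\<lambda>l. \<omega> (Suc k, l)) l")
    case True
    have "residual A (restart_point A \<omega> N) \<le> (1 / 2) ^ N * residual A (0\<^sub>v (dim_col A))"
    proof (rule residual_restart_point)
      fix i assume "1 \<le> i" "i \<le> N"
      then show "\<exists>l. stops_at A (restart_point A \<omega> (i - 1)) (\<lambda>l. \<omega> (i, l)) l"
        using True[rule_format, of "i - 1"] by simp
    qed
    then have PN: "P N" using P by simp
    then have "(LEAST k. P k) \<le> N" by (rule Least_le)
    then have "(\<Sum>k = 1..(LEAST k. P k). run_cost A ops \<omega> k) \<le> (\<Sum>k = 1..N. run_cost A ops \<omega> k)"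
      by (intro sum_mono2) auto
    also have "\<dots> = (\<Sum>k<N. run_cost A ops \<omega> (Suc k))" by (simp add: sum.atLeast1_atMost_eq)
    also have "\<dots> \<le> (\<Sum>k<N. run_bound K A (restart_point A \<omega> k) (\<lambda>l. \<omega> (Suc k, l)))"
      by (intro sum_mono cost)
    finally show ?thesis using PN by (auto simp: cost_until_def)
  next
    case False
    then obtain k where k: "k < N" "\<not> (\<exists>l. stops_at A (restart_point A \<omega> k) (\<lambda>l. \<omega> (Suc k, l)) l)" by blast
    then have "run_cost A ops \<omega> (Suc k) = \<infinity>" by (simp add: run_cost_def Let_def)
    then have "run_bound K A (restart_point A \<omega> k) (\<lambda>l. \<omega> (Suc k, l)) = \<infinity>"
      using cost[of k] by (simp add: top.extremum_unique)
    then have "cost_until A ops \<omega> P \<le> run_bound K A (restart_point A \<omega> k) (\<lambda>l. \<omega> (Suc k, l))" by simp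
    also have "run_bound K A (restart_point A \<omega> k) (\<lambda>l. \<omega> (Suc k, l))
        \<le> (\<Sum>k<N. run_bound K A (restart_point A \<omega> k) (\<lambda>l. \<omega> (Suc k, l)))"
      using k by (intro member_le_sum) auto
    finally show ?thesis .
  qed
qed

lemma expected_cost_until:
  assumes ops: "lazy_op_count K0 A ops" and K: "1 \<le> K" "K0 \<le> K" and n: "4 \<le> n"
    and mu: "error_bound_constant A \<mu>"
    and P: "\<And>\<omega>. (\<And>p. \<omega> p < n) \<Longrightarrow>
      residual A (restart_point A \<omega> N) \<le> (1 / 2) ^ N * residual A (0\<^sub>v n) \<Longrightarrow> P \<omega> N"
  shows "(\<integral>\<^sup>+\<omega>. cost_until A ops \<omega> (P \<omega>) \<partial>samples n)
    \<le> ennreal (real N * (64 * K * (real (nnz A) * (ln (real n) + sqrt (real n) / \<mu>))))"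
proof -
  let ?B = "64 * K * (real (nnz A) * (ln (real n) + sqrt (real n) / \<mu>))"
  have n0: "0 < n" using n by simp
  have "(\<integral>\<^sup>+\<omega>. cost_until A ops \<omega> (P \<omega>) \<partial>samples n)
    \<le> (\<integral>\<^sup>+\<omega>. (\<Sum>k<N. run_bound K A (restart_point A \<omega> k) (\<lambda>l. \<omega> (Suc k, l))) \<partial>samples n)"
    by (rule nn_integral_mono_AE, rule eventually_mono[OF AE_samples_less[OF n0]])
       (rule cost_until_le[OF ops K n0], use P in auto)
  also have "\<dots> = (\<Sum>k<N. \<integral>\<^sup>+\<omega>. run_bound K A (restart_point A \<omega> k) (\<lambda>l. \<omega> (Suc k, l)) \<partial>samples n)"
    using K by (intro nn_integral_sum expected_run_bound_restart(2)[OF n _ mu]) auto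
  also have "\<dots> \<le> (\<Sum>k<N. ennreal ?B)"
    using K by (intro sum_mono expected_run_bound_restart(1)[OF n _ mu]) auto
  also have "\<dots> = ennreal (real N * ?B)"
  proof -
    have "0 \<le> ?B" using K ln_ge_1[OF n] mu
      by (intro mult_nonneg_nonneg add_nonneg_nonneg) (auto simp: error_bound_constant_def)
    then show ?thesis by (simp add: ennreal_mult ennreal_of_nat_eq_real_of_nat)
  qed
  finally show ?thesis .
qed

end

lemma exp_le_2_power: assumes "2 * L \<le> real N" shows "exp L \<le> 2 ^ N"
proof -
  have h: "exp (1 / 2) \<le> (2::real)"
  proof (rule power2_le_imp_le)
    have "(exp (1 / 2))\<^sup>2 = exp (1::real)" by (simp add: power2_eq_square flip: exp_add)
    also have "\<dots> \<le> 3" by (rule exp_le)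
    finally show "(exp (1 / 2))\<^sup>2 \<le> (2::real)\<^sup>2" by simp
  qed simp
  have "exp L \<le> exp (real N * (1 / 2))" using assms by simp
  also have "\<dots> = exp (1 / 2) ^ N" by (rule exp_of_nat_mult)
  also have "\<dots> \<le> 2 ^ N" using h by (intro power_mono) auto
  finally show ?thesis .
qed

theorem theorem4p2:
  fixes K :: real
  shows "\<exists>C>(0::real). \<forall>(m::nat) (n::nat) (A::real mat) (\<mu>::real) (ops :: nat \<Rightarrow> nat \<Rightarrow> (nat \<times> nat \<Rightarrow> nat) \<Rightarrow> nat).
    n \<ge> 4 \<and> A \<in> carrier_mat m n \<and> nonneg_nondegenerate A \<and>
    error_bound_constant A \<mu> \<and> lazy_op_count K A ops \<longrightarrow>
      (\<forall>\<epsilon>>0. (\<integral>\<^sup>+ \<omega>. total_cost A ops \<epsilon> \<omega> \<partial>samples n)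
          \<le> ennreal (C * (real (nnz A) * (ln (real n) + sqrt (real n) / \<mu>)
              * max 1 (ln (residual A (0\<^sub>v n) / \<epsilon>))))) \<and>
      (\<forall>\<delta>>0. \<forall>xs. is_nnls_minimizer A xs \<longrightarrow>
        (\<integral>\<^sup>+ \<omega>. cost_to_relative_gap A ops \<delta> xs \<omega> \<partial>samples n)
          \<le> ennreal (C * (real (nnz A) * (ln (real n) + sqrt (real n) / \<mu>)
              * ln (real n / (\<mu> * \<delta>)))))"
proof -
  \<comment> \<open>Raising the constant to at least \<open>1\<close> keeps the charge of every iteration bounded away from zero.\<close>
  define K' where "K' = max 1 K"
  have K': "1 \<le> K'" "K \<le> K'" by (auto simp: K'_def)
  show ?thesis
  \<comment> \<open>A run costs \<open>64 * K'\<close> times \<open>Q\<close> in expectation, and at most \<open>7\<close> times the logarithmic factor many runs are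
    made in either case.\<close>
  proof (intro exI[of _ "448 * K'"] conjI allI impI)
    show "0 < 448 * K'" using K' by simp
  next
    fix m n A \<mu> ops and \<epsilon> :: real
    assume H: "n \<ge> 4 \<and> A \<in> carrier_mat m n \<and> nonneg_nondegenerate A \<and>
      error_bound_constant A \<mu> \<and> lazy_op_count K A ops" and eps: "0 < \<epsilon>"
    then have n: "4 \<le> n" and mu: "error_bound_constant A \<mu>" and ops: "lazy_op_count K A ops" by auto
    interpret nnls A m n using H by unfold_locales auto
    \<comment> \<open>Two halvings reduce the residual by more than the factor \<open>exp 1\<close>, hence the \<open>2\<close> in \<open>N\<close>.\<close>
    define L Q r0 N where "L = max 1 (ln (residual A (0\<^sub>v n) / \<epsilon>))"
      and "Q = real (nnz A) * (ln (real n) + sqrt (real n) / \<mu>)"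
      and "r0 = residual A (0\<^sub>v n)" and "N = nat \<lceil>2 * L\<rceil>"
    have Q: "0 \<le> Q" using ln_ge_1[OF n] mu by (auto simp: Q_def error_bound_constant_def)
    have r0: "0 < r0" unfolding r0_def using n by (intro residual_zero_pos) simp
    have L: "1 \<le> L" "ln (r0 / \<epsilon>) \<le> L" by (auto simp: L_def r0_def)
    have N: "2 * L \<le> real N" "real N \<le> 2 * L + 1" "1 \<le> N" using L by (auto simp: N_def le_nat_iff)
    have "r0 / \<epsilon> = exp (ln (r0 / \<epsilon>))" using r0 eps by simp
    also have "\<dots> \<le> exp L" using L by simp
    also have "\<dots> \<le> 2 ^ N" by (rule exp_le_2_power[OF N(1)])
    finally have "(1 / 2) ^ N * r0 \<le> \<epsilon>" using eps by (simp add: power_divide field_simps)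
    then have "(\<integral>\<^sup>+ \<omega>. total_cost A ops \<epsilon> \<omega> \<partial>samples n) \<le> ennreal (real N * (64 * K' * Q))"
      unfolding total_cost_def Q_def using N
      by (intro expected_cost_until[OF ops K' n mu]) (auto simp: r0_def)
    also have "\<dots> \<le> ennreal (448 * K' * (Q * L))"
    proof (rule ennreal_leI)
      have "real N * (64 * K' * Q) \<le> (3 * L) * (64 * K' * Q)"
        using N L K' Q by (intro mult_right_mono) auto
      also have "\<dots> = 192 * (K' * (Q * L))" by simp
      also have "\<dots> \<le> 448 * (K' * (Q * L))" using K' Q L by (intro mult_right_mono mult_nonneg_nonneg) auto
      finally show "real N * (64 * K' * Q) \<le> 448 * K' * (Q * L)" by (simp add: mult.assoc)
    qed
    finally show "(\<integral>\<^sup>+ \<omega>. total_cost A ops \<epsilon> \<omega> \<partial>samples n)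
        \<le> ennreal (448 * K' * (real (nnz A) * (ln (real n) + sqrt (real n) / \<mu>)
              * max 1 (ln (residual A (0\<^sub>v n) / \<epsilon>))))"
      by (simp only: Q_def L_def)
  next
    fix m n A \<mu> ops and \<delta> :: real and xs
    assume H: "n \<ge> 4 \<and> A \<in> carrier_mat m n \<and> nonneg_nondegenerate A \<and>
      error_bound_constant A \<mu> \<and> lazy_op_count K A ops" and del: "0 < \<delta>" and xs: "is_nnls_minimizer A xs"
    then have n: "4 \<le> n" and mu: "error_bound_constant A \<mu>" and ops: "lazy_op_count K A ops" by auto
    interpret nnls A m n using H by unfold_locales auto
    have n0: "0 < n" using n by simp
    have fneg: "nnls_obj A xs \<le> 0" by (rule minimum_nonpos[OF xs])
    show "(\<integral>\<^sup>+ \<omega>. cost_to_relative_gap A ops \<delta> xs \<omega> \<partial>samples n)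
          \<le> ennreal (448 * K' * (real (nnz A) * (ln (real n) + sqrt (real n) / \<mu>) * ln (real n / (\<mu> * \<delta>))))"
    \<comment> \<open>For \<open>\<delta> \<ge> 1\<close> the starting point already qualifies at no cost, whatever the sign of the logarithm.\<close>
    proof (cases "1 \<le> \<delta>")
      case True
      have "cost_to_relative_gap A ops \<delta> xs \<omega> = 0" for \<omega>
      proof -
        let ?P = "\<lambda>k. nnls_obj A (restart_point A \<omega> k) - nnls_obj A xs \<le> \<delta> * \<bar>nnls_obj A xs\<bar>"
        have "1 * \<bar>nnls_obj A xs\<bar> \<le> \<delta> * \<bar>nnls_obj A xs\<bar>" using True by (intro mult_right_mono) auto
        then have P0: "?P 0" using fneg by (simp add: obj_zero)
        then have "(LEAST k. ?P k) = 0" by (rule Least_eq_0)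
        moreover have "\<exists>k. ?P k" using P0 by (rule exI[of ?P 0])
        ultimately show ?thesis unfolding cost_to_relative_gap_def cost_until_def by simp
      qed
      then show ?thesis by simp
    next
      case False
      then have del1: "\<delta> < 1" by simp
      have mu1: "0 < \<mu>" "\<mu> \<le> 1" using mu error_bound_le_1[OF mu n0] by (auto simp: error_bound_constant_def)
      \<comment> \<open>The required reduction \<open>2 * n\<^sup>2 / \<delta>\<close> is at most \<open>exp (3 * L)\<close>, which takes \<open>6 * L\<close> halvings.\<close>
      define L Q r0 N where "L = ln (real n / (\<mu> * \<delta>))"
        and "Q = real (nnz A) * (ln (real n) + sqrt (real n) / \<mu>)"
        and "r0 = residual A (0\<^sub>v n)" and "N = nat \<lceil>6 * L\<rceil>"
      have Q: "0 \<le> Q" using ln_ge_1[OF n] mu1 by (auto simp: Q_def)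
      have md: "0 < \<mu> * \<delta>" "\<mu> * \<delta> \<le> \<delta>" "\<mu> * \<delta> \<le> 1"
        using mu1 del del1 by (auto simp: mult_le_one mult_left_le_one_le)
      have nd: "real n / \<delta> \<le> real n / (\<mu> * \<delta>)" using md del by (intro divide_left_mono) auto
      have "real n \<le> real n / (\<mu> * \<delta>)" using md n0 by (simp add: pos_le_divide_eq mult_left_le)
      then have "ln (real n) \<le> L" unfolding L_def using n0 by (subst ln_le_cancel_iff) auto
      then have L: "1 \<le> L" using ln_ge_1[OF n] by simp
      have N: "6 * L \<le> real N" "real N \<le> 6 * L + 1" using L by (auto simp: N_def)
      have "2 * (real n)\<^sup>2 / \<delta> \<le> (real n / \<delta>) ^ 3"
      proof -
        have "2 * (real n)\<^sup>2 \<le> real n ^ 3" using n by (simp add: power2_eq_square power3_eq_cube)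
        moreover have "\<delta> ^ 3 \<le> \<delta>" using del del1 power_decreasing[of 1 3 \<delta>] by simp
        ultimately have "2 * (real n)\<^sup>2 / \<delta> \<le> real n ^ 3 / \<delta> ^ 3"
          using del by (intro frac_le) auto
        then show ?thesis by (simp add: power_divide)
      qed
      also have "\<dots> \<le> (real n / (\<mu> * \<delta>)) ^ 3" using nd del by (intro power_mono) auto
      also have "\<dots> = exp (3 * L)"
      proof -
        have "exp L = real n / (\<mu> * \<delta>)" unfolding L_def using md n0 by simp
        then show ?thesis using exp_of_nat_mult[of 3 L] by simp
      qed
      also have "\<dots> \<le> 2 ^ N" using N by (intro exp_le_2_power) simp
      finally have half: "(1 / 2) ^ N * (2 * (real n)\<^sup>2) \<le> \<delta>" using del by (simp add: power_divide field_simps)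
      have gap: "nnls_obj A (restart_point A \<omega> N) - nnls_obj A xs \<le> \<delta> * \<bar>nnls_obj A xs\<bar>"
        if \<omega>: "\<And>p. \<omega> p < n" and r: "residual A (restart_point A \<omega> N) \<le> (1 / 2) ^ N * residual A (0\<^sub>v n)" for \<omega>
      proof -
        have "nnls_obj A (restart_point A \<omega> N) - nnls_obj A xs
          \<le> real n * residual A (restart_point A \<omega> N) * residual A (0\<^sub>v n)"
          using restart_point_box[OF n \<omega>] xs by (rule gap_le_residual)
        also have "\<dots> \<le> real n * ((1 / 2) ^ N * residual A (0\<^sub>v n)) * residual A (0\<^sub>v n)"
          using r by (intro mult_right_mono mult_left_mono) (auto simp: residual_nonneg)
        also have "\<dots> = real n * (1 / 2) ^ N * (residual A (0\<^sub>v n))\<^sup>2" by (simp add: power2_eq_square)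
        also have "\<dots> \<le> real n * (1 / 2) ^ N * (2 * real n * \<bar>nnls_obj A xs\<bar>)"
          by (intro mult_left_mono residual_zero_sq_le[OF xs]) auto
        also have "\<dots> = ((1 / 2) ^ N * (2 * (real n)\<^sup>2)) * \<bar>nnls_obj A xs\<bar>" by (simp add: power2_eq_square)
        also have "\<dots> \<le> \<delta> * \<bar>nnls_obj A xs\<bar>" by (intro mult_right_mono half) auto
        finally show ?thesis .
      qed
      have "(\<integral>\<^sup>+ \<omega>. cost_to_relative_gap A ops \<delta> xs \<omega> \<partial>samples n) \<le> ennreal (real N * (64 * K' * Q))"
        unfolding cost_to_relative_gap_def Q_def
        by (rule expected_cost_until[OF ops K' n mu]) (rule gap)
      also have "\<dots> \<le> ennreal (448 * K' * (Q * L))"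
      proof (rule ennreal_leI)
        have "real N * (64 * K' * Q) \<le> (7 * L) * (64 * K' * Q)"
          using N L K' Q by (intro mult_right_mono) auto
        then show "real N * (64 * K' * Q) \<le> 448 * K' * (Q * L)" by (simp add: mult_ac)
      qed
      finally show ?thesis by (simp only: Q_def L_def)
    qed
  qed
qed

end
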